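(* Let $\mathcal{M}=(M,L,\mu_0,P)$ be a Markov chain and $\mathcal{B}$ an NGBA over the alphabet $\Sigma$, with $L:M\to\Sigma$. Let $\mathcal{S}$ be the subset automaton of $\mathcal{B}$, let $U$ be the accepting region of $\mathcal{M}\times\mathcal{S}$, i.e. the union of all accepting bottom SCCs of $\mathcal{M}\times\mathcal{S}$, and let $\Diamond U$ be the set of paths containing a state of $U$. Then $$\mathfrak{P}^{\mathcal{M}}(\mathcal{B})=\mathfrak{P}^{\mathcal{M}\times\mathcal{S}}(\Diamond U).$$
   Context: NGBA. $[1..k]=\{1,\dots,k\}$, $k\ge 1$; $j\oplus_k 1=j+1$ for $j<k$, $k\oplus_k 1=1$. An NGBA is $\mathcal{B}=(\Sigma,Q,I,T,(F_j)_{j\in[1..k]})$ with $\Sigma,Q$ finite, $\emptyset\ne I\subseteq Q$, $T\subseteq Q\times\Sigma\times Q$, $F_j\subseteq T$. For $R\subseteq Q$: $T(R,\sigma)=\{q':\exists q\in R,\ (q,\sigma,q')\in T\}$ and $F_j(R,\sigma)=\{q':\exists q\in R,\ (q,\sigma,q')\in F_j\}$. A run on $\alpha\in\Sigma^\omega$ is an infinite $q_0q_1\dots$ with $q_0\in I$, $(q_i,\alpha(i),q_{i+1})\in T$; it is accepting if for each $j$ infinitely many of its transitions lie in $F_j$; $\mathcal{L}(\mathcal B)$ is the set of words with an accepting run. Determinisation $\det(\mathcal{B})$. An ordered tree is a finite nonempty set $\mathcal{T}\subseteq\mathbb{N}^*$ closed under predecessors and older siblings ($vn\in\mathcal T$,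 $i<n$ $\Rightarrow vi\in\mathcal T$); $\epsilon$ is the root. A generalised history tree (GHT) is $d=(\mathcal{T},l,h)$ with $\mathcal T$ an ordered tree, $l:\mathcal{T}\to 2^Q\setminus\{\emptyset\}$, $h:\mathcal T\to[1..k]$, where each non-root label is a proper subset of the predecessor's label, labels of distinct siblings are disjoint, and the union of the labels of the children of $v$ is strictly contained in $l(v)$. $\mathrm{rchd}(d):=l(\epsilon)$. $\mathcal{A}=\det(\mathcal{B})$ is the deterministic Rabin automaton whose states are the GHTs, with initial state $(\{\epsilon\},\epsilon\mapsto I,\epsilon\mapsto 1)$, and for each GHT $d$ and $\sigma$ with $T(l(\epsilon),\sigma)\neq\emptyset$ the $\sigma$-successor of $d$ is obtained as follows (otherwise undefined), with $Q_v:=l(v)$ the old labels: (i) for all nodes $v$ of $d$ set $l(v)=T(Q_v,\sigma)$; (ii) for each node $v$ of $d$ with $c$ children and $h(v)=i$ add a new child $vc$ with $l(vc)=F_i(Q_v,\sigma)$, $h(vc)=1$; (iii) for each node $v$ and each $q\in l(v)$, remove $q$ from the labels of all younger siblings of $v$ and of all their descendants; (iv) for each node $v$ whose label equals the union of the labels of its children, remove all descendants of $v$ and replace $h(v)$ by $h(v)\oplus_k1$; the transition is in $\mathsf A_v$ for all such $v$; (v) remove all nodes with empty label, giving $\mathcal{T}'$; (vi) rename each $v=n_1\dots n_j\in\mathcal T'$ to $\mathrm{rename}(v)=\|n_1\|\,\|n_1n_2\|\dots\|v\|$, where $\|w\|$ is the number of older siblings of $w$ still in $\mathcal{T}'$,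 carrying $l,h$ along; the transition is in $\mathsf R_v$ for each $v\notin\mathcal{T}\cap\mathcal{T}'$ ($\mathcal T$ the tree of $d$) and each $v\in\mathcal T'$ with $\mathrm{rename}(v)\ne v$. The Rabin pairs are $(\mathsf A_v,\mathsf R_v)$ for $v$ ranging over the nodes occurring in some ordered tree with $|Q|$ nodes. Subset automaton $\mathcal{S}$: deterministic, states $2^Q$, initial state $I$, transitions $(R,\sigma,T(R,\sigma))$ for $\emptyset\ne R\subseteq Q$. Markov chains and products. A Markov chain is $(M,L,\mu_0,P)$ with $M$ finite, $L:M\to\Sigma$, $\mu_0$ a distribution on $M$, $P:M\times M\to[0,1]$ with all row sums in $\{0,1\}$; $\mathfrak{P}^{\mathcal M}$ is the induced measure on maximal paths (generated by cylinders), and $\mathfrak{P}^{\mathcal{M}}(\mathcal{B})$ is the probability of the set of infinite paths $m_0m_1\dots$ with $L(m_0)L(m_1)\dots\in\mathcal{L}(\mathcal{B})$. For a deterministic automaton $X$ with initial state $x_0$ and partial transition function $\delta$, $\mathcal{M}\times X$ has states $(m,x)$, initial weights $\mu_0'(m,x)=\mu_0(m)$ if $x=\delta(x_0,L(m))$ and $0$ otherwise, and transition weights $P'((m,x),(m',x'))=P(m,m')$ if $x'=\delta(x,L(m'))$, and $0$ otherwise. Where $\delta$ is undefined probability mass is lost. $\mathcal{M}\otimes X$ is the same object with acceptance: $((m,x),(m',x'))$ inherits the membership in acceptance sets of $(x,L(m'),x')$. A bottom SCC is a nonempty set of states that is strongly connected via positive-weight transitions and in which each state has total outgoing weight $1$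 to states in the set. Acceptance. A bottom SCC of $\mathcal{M}\otimes\mathcal{A}$ is accepting if for some index $v$ some transition inside it is in $\mathsf A_v$ and none is in $\mathsf R_v$. A bottom SCC $\mathtt{S}$ of $\mathcal{M}\times\mathcal{S}$ is accepting iff there is a state $(m,d)$ in an accepting bottom SCC of $\mathcal{M}\otimes\mathcal{A}$ with $(m,\mathrm{rchd}(d))\in\mathtt{S}$. *)

theory Defs
  imports "HOL-Probability.Probability" "HOL-Library.Sublist"
begin

section \<open>Nondeterministic generalised Buechi automata\<close>

record ('q, 'a) ngba =
  alphabet :: "'a set"
  nstates :: "'q set"
  ninit :: "'q set"
  ntrans :: "('q \<times> 'a \<times> 'q) set"
  nacc_count :: nat
  nacc :: "nat \<Rightarrow> ('q \<times> 'a \<times> 'q) set"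

definition is_ngba :: "('q, 'a) ngba \<Rightarrow> bool" where
  "is_ngba B \<longleftrightarrow>
     finite (alphabet B) \<and> finite (nstates B) \<and>
     ninit B \<noteq> {} \<and> ninit B \<subseteq> nstates B \<and>
     ntrans B \<subseteq> nstates B \<times> alphabet B \<times> nstates B \<and>
     nacc_count B \<ge> 1 \<and>
     (\<forall>j \<in> {1..nacc_count B}. nacc B j \<subseteq> ntrans B)"

definition post :: "('q \<times> 'a \<times> 'q) set \<Rightarrow> 'q set \<Rightarrow> 'a \<Rightarrow> 'q set" where
  "post E R \<sigma> = {q'. \<exists>q \<in> R. (q, \<sigma>, q') \<in> E}"

definition is_run :: "('q, 'a) ngba \<Rightarrow> (nat \<Rightarrow> 'a) \<Rightarrow> (nat \<Rightarrow> 'q) \<Rightarrow> bool" where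
  "is_run B \<alpha> \<rho> \<longleftrightarrow> \<rho> 0 \<in> ninit B \<and> (\<forall>i. (\<rho> i, \<alpha> i, \<rho> (Suc i)) \<in> ntrans B)"

definition accepting_run :: "('q, 'a) ngba \<Rightarrow> (nat \<Rightarrow> 'a) \<Rightarrow> (nat \<Rightarrow> 'q) \<Rightarrow> bool" where
  "accepting_run B \<alpha> \<rho> \<longleftrightarrow> is_run B \<alpha> \<rho> \<and>
     (\<forall>j \<in> {1..nacc_count B}. infinite {i. (\<rho> i, \<alpha> i, \<rho> (Suc i)) \<in> nacc B j})"

definition language :: "('q, 'a) ngba \<Rightarrow> (nat \<Rightarrow> 'a) set" where
  "language B = {\<alpha>. (\<forall>i. \<alpha> i \<in> alphabet B) \<and> (\<exists>\<rho>. accepting_run B \<alpha> \<rho>)}"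


section \<open>Deterministic automata\<close>

record ('x, 'a) daut =
  dstates :: "'x set"
  dinit :: 'x
  dstep :: "'x \<Rightarrow> 'a \<Rightarrow> 'x option"

text \<open>A Rabin index \<open>v\<close> carries the pair \<open>(racc v, rrej v)\<close> of transition sets: infinitely many
  transitions in the first, only finitely many in the second.\<close>

record ('x, 'a, 'i) drabin = "('x, 'a) daut" +
  rindex :: "'i set"
  racc :: "'i \<Rightarrow> ('x \<times> 'a \<times> 'x) set"
  rrej :: "'i \<Rightarrow> ('x \<times> 'a \<times> 'x) set"

definition subset_aut :: "('q, 'a) ngba \<Rightarrow> ('q set, 'a) daut" where
  "subset_aut B = \<lparr>
     dstates = Pow (nstates B),
     dinit = ninit B,
     dstep = (\<lambda>R \<sigma>. if R \<in> Pow (nstates B) \<and> R \<noteq> {} \<and> \<sigma> \<in> alphabet B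
                    then Some (post (ntrans B) R \<sigma>) else None)\<rparr>"


section \<open>Generalised history trees\<close>

text \<open>Nodes are words over the naturals; \<open>[]\<close> is the root and \<open>v @ [n]\<close> is the child number \<open>n\<close>
  of \<open>v\<close>.\<close>

definition ordered_tree :: "nat list set \<Rightarrow> bool" where
  "ordered_tree t \<longleftrightarrow> finite t \<and> t \<noteq> {} \<and>
     (\<forall>v n. v @ [n] \<in> t \<longrightarrow> v \<in> t \<and> (\<forall>i < n. v @ [i] \<in> t))"

definition children :: "nat list set \<Rightarrow> nat list \<Rightarrow> nat list set" where
  "children t v = {v @ [n] | n. v @ [n] \<in> t}"

record 'q ght =
  nodes :: "nat list set"
  lab :: "nat list \<Rightarrow> 'q set"
  idx :: "nat list \<Rightarrow> nat"

text \<open>The extensional function spaces make \<open>lab\<close> and \<open>idx\<close> functions with domain \<open>nodes\<close>, so that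
  equality of records is equality of history trees.\<close>

definition is_ght :: "('q, 'a) ngba \<Rightarrow> 'q ght \<Rightarrow> bool" where
  "is_ght B d \<longleftrightarrow>
     ordered_tree (nodes d) \<and>
     lab d \<in> nodes d \<rightarrow>\<^sub>E (Pow (nstates B) - {{}}) \<and>
     idx d \<in> nodes d \<rightarrow>\<^sub>E {1..nacc_count B} \<and>
     (\<forall>v n. v @ [n] \<in> nodes d \<longrightarrow> lab d (v @ [n]) \<subset> lab d v) \<and>
     (\<forall>v m n. v @ [m] \<in> nodes d \<longrightarrow> v @ [n] \<in> nodes d \<longrightarrow> m \<noteq> n \<longrightarrow>
        lab d (v @ [m]) \<inter> lab d (v @ [n]) = {}) \<and>
     (\<forall>v \<in> nodes d. (\<Union>u \<in> children (nodes d) v. lab d u) \<subset> lab d v)"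

definition rchd :: "'q ght \<Rightarrow> 'q set" where
  "rchd d = lab d []"

definition initial_ght :: "('q, 'a) ngba \<Rightarrow> 'q ght" where
  "initial_ght B = \<lparr>nodes = {[]}, lab = (\<lambda>v \<in> {[]}. ninit B), idx = (\<lambda>v \<in> {[]}. 1)\<rparr>"


subsection \<open>The successor of a history tree\<close>

text \<open>The intermediate trees below are not history trees, and the values of \<open>lab\<close> and \<open>idx\<close> outside
  \<open>nodes\<close> are irrelevant until \<open>ght_rename\<close> makes them extensional again.\<close>

definition cyc_suc :: "nat \<Rightarrow> nat \<Rightarrow> nat" where
  "cyc_suc k j = (if j < k then j + 1 else 1)"

definition ght_spawn :: "('q, 'a) ngba \<Rightarrow> 'a \<Rightarrow> 'q ght \<Rightarrow> 'q ght" where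
  "ght_spawn B \<sigma> d = \<lparr>
     nodes = nodes d \<union> {v @ [card (children (nodes d) v)] | v. v \<in> nodes d},
     lab = (\<lambda>v. if v \<in> nodes d then post (ntrans B) (lab d v) \<sigma>
                else post (nacc B (idx d (butlast v))) (lab d (butlast v)) \<sigma>),
     idx = (\<lambda>v. if v \<in> nodes d then idx d v else 1)\<rparr>"

text \<open>A state is removed from the label of \<open>v\<close> if it occurs in the label of an older sibling
  \<open>w @ [i]\<close> of some \<open>w @ [n]\<close>, where \<open>w @ [n]\<close> is \<open>v\<close> or an ancestor of \<open>v\<close>. Testing against the
  labels before any removal yields the same as removing one state after the other: what is
  removed from \<open>w @ [i]\<close> is, for the same reason, removed from everything below \<open>w @ [n]\<close>.\<close>

definition ght_disjoint :: "'q ght \<Rightarrow> 'q ght" where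
  "ght_disjoint d = d\<lparr>lab := (\<lambda>v. {q \<in> lab d v.
     \<not> (\<exists>w n i. prefix (w @ [n]) v \<and> i < n \<and> w @ [i] \<in> nodes d \<and> q \<in> lab d (w @ [i]))})\<rparr>"

definition saturated :: "'q ght \<Rightarrow> nat list \<Rightarrow> bool" where
  "saturated d v \<longleftrightarrow> v \<in> nodes d \<and> lab d v = (\<Union>u \<in> children (nodes d) v. lab d u)"

definition ght_collapse :: "nat \<Rightarrow> 'q ght \<Rightarrow> 'q ght" where
  "ght_collapse k d = d\<lparr>
     nodes := {v \<in> nodes d. \<not> (\<exists>u. saturated d u \<and> strict_prefix u v)},
     idx := (\<lambda>v. if saturated d v then cyc_suc k (idx d v) else idx d v)\<rparr>"

definition ght_nonempty :: "'q ght \<Rightarrow> 'q ght" where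
  "ght_nonempty d = d\<lparr>nodes := {v \<in> nodes d. lab d v \<noteq> {}}\<rparr>"

text \<open>Entry number \<open>i\<close> of the new name counts the remaining older siblings of the prefix of \<open>v\<close> of
  length \<open>i + 1\<close>.\<close>

definition rename :: "nat list set \<Rightarrow> nat list \<Rightarrow> nat list" where
  "rename t v = map (\<lambda>i. card {j. j < v ! i \<and> take i v @ [j] \<in> t}) [0..<length v]"

definition ght_rename :: "'q ght \<Rightarrow> 'q ght" where
  "ght_rename d = (let r = rename (nodes d) in \<lparr>
     nodes = r ` nodes d,
     lab = (\<lambda>u \<in> r ` nodes d. lab d (inv_into (nodes d) r u)),
     idx = (\<lambda>u \<in> r ` nodes d. idx d (inv_into (nodes d) r u))\<rparr>)"

definition ght_split :: "('q, 'a) ngba \<Rightarrow> 'a \<Rightarrow> 'q ght \<Rightarrow> 'q ght" where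
  "ght_split B \<sigma> d = ght_disjoint (ght_spawn B \<sigma> d)"

definition ght_remain :: "('q, 'a) ngba \<Rightarrow> 'a \<Rightarrow> 'q ght \<Rightarrow> 'q ght" where
  "ght_remain B \<sigma> d = ght_nonempty (ght_collapse (nacc_count B) (ght_split B \<sigma> d))"

definition ght_step :: "('q, 'a) ngba \<Rightarrow> 'q ght \<Rightarrow> 'a \<Rightarrow> 'q ght option" where
  "ght_step B d \<sigma> =
     (if is_ght B d \<and> \<sigma> \<in> alphabet B \<and> post (ntrans B) (lab d []) \<sigma> \<noteq> {}
      then Some (ght_rename (ght_remain B \<sigma> d)) else None)"

text \<open>An empty label without nonempty children also counts as saturated. This does not affect
  acceptance: such a node does not remain, so the transition is rejecting for it.\<close>

definition det :: "('q, 'a) ngba \<Rightarrow> ('q ght, 'a, nat list) drabin" where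
  "det B = \<lparr>
     dstates = {d. is_ght B d},
     dinit = initial_ght B,
     dstep = ght_step B,
     rindex = {v. \<exists>t. ordered_tree t \<and> card t = card (nstates B) \<and> v \<in> t},
     racc = (\<lambda>v. {(d, \<sigma>, d'). ght_step B d \<sigma> = Some d' \<and> saturated (ght_split B \<sigma> d) v}),
     rrej = (\<lambda>v. {(d, \<sigma>, d'). ght_step B d \<sigma> = Some d' \<and>
       (let t' = nodes (ght_remain B \<sigma> d)
        in v \<notin> nodes d \<inter> t' \<or> (v \<in> t' \<and> rename t' v \<noteq> v))})\<rparr>"


section \<open>Markov chains\<close>

record 'm weighted_chain =
  mstates :: "'m set"
  minit :: "'m \<Rightarrow> real"
  mtrans :: "'m \<Rightarrow> 'm \<Rightarrow> real"

record ('m, 'a) labelled_chain = "'m weighted_chain" +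
  mlabel :: "'m \<Rightarrow> 'a"

definition is_markov_chain :: "'a set \<Rightarrow> ('m, 'a) labelled_chain \<Rightarrow> bool" where
  "is_markov_chain \<Sigma> M \<longleftrightarrow>
     finite (mstates M) \<and>
     mlabel M \<in> mstates M \<rightarrow> \<Sigma> \<and>
     (\<forall>m \<in> mstates M. 0 \<le> minit M m) \<and> (\<Sum>m \<in> mstates M. minit M m) = 1 \<and>
     (\<forall>m \<in> mstates M. \<forall>m' \<in> mstates M. mtrans M m m' \<in> {0..1}) \<and>
     (\<forall>m \<in> mstates M. (\<Sum>m' \<in> mstates M. mtrans M m m') \<in> {0, 1})"

text \<open>A maximal path is infinite or ends in a state without successors. It is represented by a
  function that is \<open>None\<close> from the end of the path on.\<close>

definition maximal_paths :: "('m, 'z) weighted_chain_scheme \<Rightarrow> (nat \<Rightarrow> 'm option) set" where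
  "maximal_paths C = {\<omega>.
     (\<exists>m \<in> mstates C. \<omega> 0 = Some m) \<and>
     (\<forall>i. case \<omega> i of
        None \<Rightarrow> \<omega> (Suc i) = None
      | Some m \<Rightarrow> (case \<omega> (Suc i) of
            None \<Rightarrow> \<forall>m' \<in> mstates C. mtrans C m m' = 0
          | Some m' \<Rightarrow> m' \<in> mstates C \<and> mtrans C m m' > 0))}"

definition cylinder ::
    "('m, 'z) weighted_chain_scheme \<Rightarrow> 'm list \<Rightarrow> (nat \<Rightarrow> 'm option) set" where
  "cylinder C xs = {\<omega> \<in> maximal_paths C. \<forall>i < length xs. \<omega> i = Some (xs ! i)}"

definition path_weight :: "('m, 'z) weighted_chain_scheme \<Rightarrow> 'm list \<Rightarrow> real" where
  "path_weight C xs = minit C (xs ! 0) * (\<Prod>i < length xs - 1. mtrans C (xs ! i) (xs ! Suc i))"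

text \<open>The measure on maximal paths generated by the cylinders. For the finite chains considered here
  it exists and is unique; \<open>extend_measure\<close> would return the zero measure otherwise.\<close>

definition path_measure ::
    "('m, 'z) weighted_chain_scheme \<Rightarrow> (nat \<Rightarrow> 'm option) measure" where
  "path_measure C = extend_measure (maximal_paths C) {xs. xs \<noteq> [] \<and> set xs \<subseteq> mstates C}
     (cylinder C) (\<lambda>xs. ennreal (path_weight C xs))"

definition prob_ngba :: "('m, 'a) labelled_chain \<Rightarrow> ('q, 'a) ngba \<Rightarrow> real" where
  "prob_ngba M B = measure (path_measure M)
     {\<omega> \<in> maximal_paths M. \<exists>\<pi>. (\<forall>i. \<omega> i = Some (\<pi> i)) \<and> (\<lambda>i. mlabel M (\<pi> i)) \<in> language B}"

definition reach_paths ::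
    "('m, 'z) weighted_chain_scheme \<Rightarrow> 'm set \<Rightarrow> (nat \<Rightarrow> 'm option) set" where
  "reach_paths C U = {\<omega> \<in> maximal_paths C. \<exists>i. \<exists>s \<in> U. \<omega> i = Some s}"

definition chain_product ::
    "('m, 'a) labelled_chain \<Rightarrow> ('x, 'a, 'z) daut_scheme \<Rightarrow> ('m \<times> 'x) weighted_chain" where
  "chain_product M X = \<lparr>
     mstates = mstates M \<times> dstates X,
     minit = (\<lambda>(m, x). if dstep X (dinit X) (mlabel M m) = Some x then minit M m else 0),
     mtrans = (\<lambda>(m, x) (m', x'). if dstep X x (mlabel M m') = Some x' then mtrans M m m' else 0)\<rparr>"


section \<open>Accepting bottom strongly connected components\<close>

text \<open>Connectivity is required within \<open>S\<close>. As total outgoing weights never exceed 1, no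
  positive-weight transition leaves \<open>S\<close>, and \<open>S\<close> is maximal.\<close>

definition bottom_scc :: "('m, 'z) weighted_chain_scheme \<Rightarrow> 'm set \<Rightarrow> bool" where
  "bottom_scc C S \<longleftrightarrow> S \<noteq> {} \<and> S \<subseteq> mstates C \<and>
     (\<forall>s \<in> S. \<forall>t \<in> S. (s, t) \<in> {(u, w). u \<in> S \<and> w \<in> S \<and> mtrans C u w > 0}\<^sup>*) \<and>
     (\<forall>s \<in> S. (\<Sum>t \<in> S. mtrans C s t) = 1)"

definition rabin_accepting ::
    "('m, 'a) labelled_chain \<Rightarrow> ('x, 'a, 'i) drabin \<Rightarrow> ('m \<times> 'x) set \<Rightarrow> bool" where
  "rabin_accepting M A S \<longleftrightarrow>
     (let inside = (\<lambda>E. \<exists>(m, x) \<in> S. \<exists>(m', x') \<in> S.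
        mtrans (chain_product M A) (m, x) (m', x') > 0 \<and> (x, mlabel M m', x') \<in> E)
      in \<exists>v \<in> rindex A. inside (racc A v) \<and> \<not> inside (rrej A v))"

definition accepting_subset_bscc ::
    "('m, 'a) labelled_chain \<Rightarrow> ('q, 'a) ngba \<Rightarrow> ('m \<times> 'q set) set \<Rightarrow> bool" where
  "accepting_subset_bscc M B S \<longleftrightarrow>
     bottom_scc (chain_product M (subset_aut B)) S \<and>
     (\<exists>D m d. bottom_scc (chain_product M (det B)) D \<and> rabin_accepting M (det B) D \<and>
        (m, d) \<in> D \<and> (m, rchd d) \<in> S)"

definition accepting_region ::
    "('m, 'a) labelled_chain \<Rightarrow> ('q, 'a) ngba \<Rightarrow> ('m \<times> 'q set) set" where
  "accepting_region M B = \<Union> {S. accepting_subset_bscc M B S}"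

end

theory Submission
  imports Defs
begin

text \<open>The determinisation is correct from every history tree \<^term>\<open>d\<close>: a word has an accepting run
  from \<^term>\<open>rchd d\<close> iff the run of the Rabin automaton from \<^term>\<open>d\<close> accepts it. Almost surely,
  for each of the countably many deterministic observers started at some time in some state, every
  product state that is visited infinitely often is followed infinitely often by each of its
  successors; what follows is about individual such paths. If the word of a path is accepted, the
  product states with the determinisation that recur form an accepting bottom SCC, and the product
  states with the subset automaton that recur form a bottom SCC, which is accepting as it contains
  their images. Conversely, a path that reaches an accepting bottom SCC of \<^term>\<open>M\<close> and the subset
  automaton visits all its states, in particular some \<^term>\<open>(m, rchd d)\<close> with \<^term>\<open>(m, d)\<close> in an
  accepting bottom SCC of the determinisation. A second copy of the determinisation started there
  in \<^term>\<open>d\<close> takes all transitions of that SCC infinitely often and hence accepts.\<close>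

section \<open>Ordered trees and renaming\<close>

text \<open>In the product with the determinisation, mass can be lost for some letters only: a row
  sum may lie strictly between 0 and 1, and then there need not be a path measure. Hence all
  probability lives on the paths of \<open>M\<close>; automata only read these paths, and components
  of the product with \<open>det B\<close> arise as sets of pairs recurring along one path. Only the
  product with \<open>subset_aut B\<close> is given a path measure, as an image of that of
  \<open>M\<close>: in each state this automaton is stuck for all letters of the alphabet or for
  none. The component of the determinisation that makes a subset component accepting need not be
  reachable from the initial tree, and the copy that has been running may be in another tree with
  the same root label. This is why correctness is needed from every tree: the words accepted from
  \<open>d\<close> depend on \<open>rchd d\<close> only, so the copy may be exchanged at a moment
  when the subset state equals \<open>rchd d\<close>.\<close>

lemma ordered_treeD:
  assumes "ordered_tree t"
  shows "finite t" and "t \<noteq> {}"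
    and "\<forall>v n. v @ [n] \<in> t \<longrightarrow> v \<in> t \<and> (\<forall>i < n. v @ [i] \<in> t)"
  using assms unfolding ordered_tree_def by - (elim conjE, assumption)+

lemma ordered_tree_parent: "ordered_tree t \<Longrightarrow> v @ [n] \<in> t \<Longrightarrow> v \<in> t"
  and ordered_tree_older: "ordered_tree t \<Longrightarrow> v @ [n] \<in> t \<Longrightarrow> i < n \<Longrightarrow> v @ [i] \<in> t"
  using ordered_treeD(3)[rule_format] by blast+

text \<open>The numbers of the children of \<open>v\<close> form a finite downward closed set, hence
  an initial segment. So \<open>card (children t v)\<close> is the first free child number, and the
  spawned child is both new and youngest.\<close>

lemma ordered_tree_child_iff:
  assumes "ordered_tree t"
  shows "v @ [n] \<in> t \<longleftrightarrow> n < card (children t v)"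
proof -
  let ?A = "{n. v @ [n] \<in> t}"
  have eq: "children t v = (\<lambda>n. v @ [n]) ` ?A"
    by (auto simp: children_def)
  have inj: "inj_on (\<lambda>n. v @ [n]) ?A"
    by (auto simp: inj_on_def)
  have "finite (children t v)"
    by (rule finite_subset[OF _ ordered_treeD(1)[OF assms]]) (auto simp: children_def)
  then have fin: "finite ?A"
    using finite_imageD[OF _ inj] eq by simp
  have dc: "i \<in> ?A" if "n \<in> ?A" "i < n" for i n
    using ordered_tree_older[OF assms] that by simp
  have "?A = {..<card ?A}"
  proof (cases "?A = {}")
    case False
    have "?A = {..Max ?A}"
      using Max_in[OF fin False] dc Max_ge[OF fin] by (metis (no_types, lifting) atMost_iff dual_order.strict_iff_order order_le_less set_eqI mem_Collect_eq)
    then show ?thesis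
      by (metis card_atMost lessThan_Suc_atMost)
  qed auto
  then show ?thesis
    using card_image[OF inj] eq by (metis lessThan_iff mem_Collect_eq)
qed

lemma prefix_closed_induct:
  assumes "\<And>v n. v @ [n] \<in> t \<Longrightarrow> v \<in> t" and "v \<in> t" and "prefix u v"
  shows "u \<in> t"
proof -
  have "u @ w \<in> t \<Longrightarrow> u \<in> t" for w
  proof (induction w rule: rev_induct)
    case (snoc n w)
    then show ?case
      using assms(1)[of "u @ w" n] by simp
  qed simp
  then show ?thesis
    using assms(2,3) by (auto simp: prefix_def)
qed

lemma ordered_tree_prefix:
  assumes "ordered_tree t" "v \<in> t" "prefix u v"
  shows "u \<in> t"
  using ordered_tree_parent[OF assms(1)] assms(2,3) by (rule prefix_closed_induct)

lemma rename_Nil [simp]: "rename t [] = []"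
  by (simp add: rename_def)

lemma rename_snoc: "rename t (v @ [n]) = rename t v @ [card {j. j < n \<and> v @ [j] \<in> t}]"
  by (simp add: rename_def nth_append)

lemma length_rename [simp]: "length (rename t v) = length v"
  by (simp add: rename_def)

text \<open>By induction from the last letter. Among siblings present in \<open>t\<close>, the
  number of older ones still present increases strictly, since the older of two siblings is itself
  counted for the younger. Older siblings may be missing in \<open>t\<close>, hence the assumption
  of closure under parents alone.\<close>

lemma rename_inj_on:
  assumes closed: "\<And>v n. v @ [n] \<in> t \<Longrightarrow> v \<in> t"
  shows "inj_on (rename t) t"
proof -
  have "v \<in> t \<Longrightarrow> w \<in> t \<Longrightarrow> rename t v = rename t w \<Longrightarrow> v = w" for v w
  proof (induction v arbitrary: w rule: rev_induct)
    case Nil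
    then show ?case
      by (metis length_0_conv length_rename)
  next
    case (snoc n v)
    then obtain w' m where w: "w = w' @ [m]"
      by (metis length_0_conv length_rename rev_exhaust snoc_eq_iff_butlast)
    have v: "v = w'"
      using snoc.IH[of w'] snoc.prems closed[of v n] closed[of w' m] w by (simp add: rename_snoc)
    have *: "card {j. j < a \<and> w' @ [j] \<in> t} < card {j. j < b \<and> w' @ [j] \<in> t}"
      if "w' @ [a] \<in> t" "a < b" for a b
      by (rule psubset_card_mono) (use that in auto)
    have "card {j. j < n \<and> w' @ [j] \<in> t} = card {j. j < m \<and> w' @ [j] \<in> t}"
      using snoc.prems(3) w v by (simp add: rename_snoc)
    then have "n = m"
      using *[of n m] *[of m n] snoc.prems(1,2)[unfolded w v] by (cases n m rule: linorder_cases) simp_all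
    then show ?case
      using v w by simp
  qed
  then show ?thesis
    by (auto simp: inj_on_def)
qed

text \<open>The conditions on a history tree before renaming: the older siblings of a node may be
  missing.\<close>

definition pre_ght :: "('q, 'a) ngba \<Rightarrow> 'q ght \<Rightarrow> bool" where
  "pre_ght B d \<longleftrightarrow>
     finite (nodes d) \<and> [] \<in> nodes d \<and>
     (\<forall>v n. v @ [n] \<in> nodes d \<longrightarrow> v \<in> nodes d) \<and>
     (\<forall>v \<in> nodes d. lab d v \<subseteq> nstates B \<and> lab d v \<noteq> {} \<and> idx d v \<in> {1..nacc_count B}) \<and>
     (\<forall>v m n. v @ [m] \<in> nodes d \<longrightarrow> v @ [n] \<in> nodes d \<longrightarrow> m \<noteq> n \<longrightarrow>
        lab d (v @ [m]) \<inter> lab d (v @ [n]) = {}) \<and>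
     (\<forall>v \<in> nodes d. (\<Union>u \<in> children (nodes d) v. lab d u) \<subset> lab d v)"

lemma pre_ghtD:
  assumes "pre_ght B d"
  shows "finite (nodes d)" and "[] \<in> nodes d"
    and "\<forall>v n. v @ [n] \<in> nodes d \<longrightarrow> v \<in> nodes d"
    and "\<forall>v \<in> nodes d. lab d v \<subseteq> nstates B \<and> lab d v \<noteq> {} \<and> idx d v \<in> {1..nacc_count B}"
    and "\<forall>v m n. v @ [m] \<in> nodes d \<longrightarrow> v @ [n] \<in> nodes d \<longrightarrow> m \<noteq> n \<longrightarrow>
        lab d (v @ [m]) \<inter> lab d (v @ [n]) = {}"
    and "\<forall>v \<in> nodes d. (\<Union>u \<in> children (nodes d) v. lab d u) \<subset> lab d v"
  using assms unfolding pre_ght_def by - (elim conjE, assumption)+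

lemmas pre_ght_finite = pre_ghtD(1)
lemmas pre_ght_root = pre_ghtD(2)
lemmas pre_ght_closed = pre_ghtD(3)[rule_format]
lemmas pre_ght_lab = pre_ghtD(4)[rule_format, THEN conjunct1]
  and pre_ght_lab_ne = pre_ghtD(4)[rule_format, THEN conjunct2, THEN conjunct1]
  and pre_ght_idx = pre_ghtD(4)[rule_format, THEN conjunct2, THEN conjunct2]
lemmas pre_ght_siblings = pre_ghtD(5)[rule_format]
lemmas pre_ght_union = pre_ghtD(6)[rule_format]

lemma is_ghtD:
  assumes "is_ght B d"
  shows "ordered_tree (nodes d)"
    and "lab d \<in> nodes d \<rightarrow>\<^sub>E (Pow (nstates B) - {{}})"
    and "idx d \<in> nodes d \<rightarrow>\<^sub>E {1..nacc_count B}"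
    and "\<forall>v m n. v @ [m] \<in> nodes d \<longrightarrow> v @ [n] \<in> nodes d \<longrightarrow> m \<noteq> n \<longrightarrow>
        lab d (v @ [m]) \<inter> lab d (v @ [n]) = {}"
    and "\<forall>v \<in> nodes d. (\<Union>u \<in> children (nodes d) v. lab d u) \<subset> lab d v"
  using assms unfolding is_ght_def by - (elim conjE, assumption)+

lemma is_ght_root:
  assumes "is_ght B d"
  shows "[] \<in> nodes d"
proof -
  note t = is_ghtD(1)[OF assms]
  obtain v where "v \<in> nodes d" using ordered_treeD(2)[OF t] by blast
  then show ?thesis
    by (rule ordered_tree_prefix[OF t]) simp
qed

lemma is_ght_imp_pre_ght: "is_ght B d \<Longrightarrow> pre_ght B d"
proof -
  assume d: "is_ght B d"
  have "lab d v \<subseteq> nstates B \<and> lab d v \<noteq> {} \<and> idx d v \<in> {1..nacc_count B}" if "v \<in> nodes d" for v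
    using PiE_mem[OF is_ghtD(2)[OF d] that] PiE_mem[OF is_ghtD(3)[OF d] that] by auto
  then show ?thesis
    unfolding pre_ght_def
    using ordered_treeD(1)[OF is_ghtD(1)[OF d]] is_ght_root[OF d]
      ordered_tree_parent[OF is_ghtD(1)[OF d]] is_ghtD(4,5)[OF d]
    by (intro conjI) (assumption | blast)+
qed

text \<open>Counting smaller elements takes every value below \<open>card A\<close>; this is what
  closes the gaps between siblings when nodes are renamed.\<close>

lemma rank_exists:
  fixes A :: "nat set"
  assumes "finite A" "i < card A"
  shows "\<exists>a \<in> A. card {x \<in> A. x < a} = i"
  using assms
proof (induction "card A" arbitrary: A)
  case (Suc c)
  then have ne: "A \<noteq> {}" by auto
  let ?m = "Max A"
  have m: "?m \<in> A" using Suc ne by auto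
  have c: "card (A - {?m}) = c" using Suc m by simp
  show ?case
  proof (cases "i < c")
    case True
    then obtain a where a: "a \<in> A - {?m}" "card {x \<in> A - {?m}. x < a} = i"
      using Suc.hyps(1)[of "A - {?m}"] c Suc.prems by auto
    have "a < ?m" using a Suc.prems by (simp add: order_less_le)
    then have "{x \<in> A - {?m}. x < a} = {x \<in> A. x < a}" by auto
    then show ?thesis using a by auto
  next
    case False
    have "{x \<in> A. x < ?m} = A - {?m}"
      using Suc.prems Max_ge[of A] by (auto simp: order_less_le)
    then show ?thesis using m c False Suc by (metis less_SucE)
  qed
qed auto

lemma rename_snoc_in_image:
  assumes closed: "\<And>v n. v @ [n] \<in> t \<Longrightarrow> v \<in> t"
    and "u @ [m] \<in> rename t ` t"
  obtains v n where "v @ [n] \<in> t" "rename t v = u" "rename t (v @ [n]) = u @ [m]"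
proof -
  obtain w where w: "w \<in> t" "rename t w = u @ [m]" using assms(2) by force
  then have "w \<noteq> []" by auto
  then obtain v n where "w = v @ [n]" by (metis rev_exhaust)
  then show ?thesis using that w by (auto simp: rename_snoc)
qed

lemma ordered_tree_rename:
  assumes closed: "\<And>v n. v @ [n] \<in> t \<Longrightarrow> v \<in> t" and "finite t" "t \<noteq> {}"
  shows "ordered_tree (rename t ` t)"
  unfolding ordered_tree_def
proof (intro conjI allI impI)
  fix u m assume *: "u @ [m] \<in> rename t ` t"
  obtain v n where v: "v @ [n] \<in> t" "rename t v = u" "rename t (v @ [n]) = u @ [m]"
    by (rule rename_snoc_in_image[OF closed *])
  show "u \<in> rename t ` t" using v closed by blast
  fix i assume "i < m"
  let ?A = "{j. j < n \<and> v @ [j] \<in> t}"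
  have "i < card ?A" using v \<open>i < m\<close> by (simp add: rename_snoc)
  \<comment> \<open>The child of \<open>v\<close> that receives the number \<open>i\<close> is the
    one with exactly \<open>i\<close> remaining older siblings.\<close>
  then obtain a where a: "a \<in> ?A" "card {x \<in> ?A. x < a} = i" using rank_exists[of ?A i] by auto
  have "{x \<in> ?A. x < a} = {j. j < a \<and> v @ [j] \<in> t}" using a by auto
  then have "rename t (v @ [a]) = u @ [i]" using a v by (simp add: rename_snoc)
  then show "u @ [i] \<in> rename t ` t" using a by (metis (no_types, lifting) image_eqI mem_Collect_eq)
qed (use assms in auto)

lemma nodes_ght_rename: "nodes (ght_rename d) = rename (nodes d) ` nodes d"
  by (simp add: ght_rename_def Let_def)

lemma lab_ght_rename:
  assumes "pre_ght B d" "v \<in> nodes d"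
  shows "lab (ght_rename d) (rename (nodes d) v) = lab d v"
    and "idx (ght_rename d) (rename (nodes d) v) = idx d v"
proof -
  have "inj_on (rename (nodes d)) (nodes d)"
    by (rule rename_inj_on[OF pre_ght_closed[OF assms(1)]])
  then show "lab (ght_rename d) (rename (nodes d) v) = lab d v"
    and "idx (ght_rename d) (rename (nodes d) v) = idx d v"
    using assms(2) by (simp_all add: ght_rename_def Let_def)
qed

lemma children_ght_rename:
  assumes "pre_ght B d" "v \<in> nodes d"
  shows "children (nodes (ght_rename d)) (rename (nodes d) v) = rename (nodes d) ` children (nodes d) v"
proof
  note closed = pre_ght_closed[OF assms(1)]
  show "rename (nodes d) ` children (nodes d) v \<subseteq> children (nodes (ght_rename d)) (rename (nodes d) v)"
  proof
    fix u assume "u \<in> rename (nodes d) ` children (nodes d) v"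
    then obtain n where n: "v @ [n] \<in> nodes d" "u = rename (nodes d) (v @ [n])"
      by (auto simp: children_def)
    then have "u \<in> nodes (ght_rename d)" by (simp add: nodes_ght_rename)
    then show "u \<in> children (nodes (ght_rename d)) (rename (nodes d) v)"
      using n(2) by (auto simp: children_def rename_snoc)
  qed
  show "children (nodes (ght_rename d)) (rename (nodes d) v) \<subseteq> rename (nodes d) ` children (nodes d) v"
  proof
    fix u assume "u \<in> children (nodes (ght_rename d)) (rename (nodes d) v)"
    then obtain m where u: "u = rename (nodes d) v @ [m]" "rename (nodes d) v @ [m] \<in> rename (nodes d) ` nodes d"
      by (auto simp: children_def nodes_ght_rename)
    obtain v' n where v': "v' @ [n] \<in> nodes d" "rename (nodes d) v' = rename (nodes d) v"
       "rename (nodes d) (v' @ [n]) = rename (nodes d) v @ [m]"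
      by (rule rename_snoc_in_image[OF closed u(2)])
    have "v' = v"
      by (rule inj_onD[OF rename_inj_on[OF closed] v'(2) closed[OF v'(1)] assms(2)])
    then have "v' @ [n] \<in> children (nodes d) v" using v'(1) by (simp add: children_def)
    then show "u \<in> rename (nodes d) ` children (nodes d) v"
      using v'(3) u(1) by (metis imageI)
  qed
qed

text \<open>Every condition relates a node to its children only, and renaming maps the children of a
  node onto those of its image. Strict inclusion of a single child follows from that of the
  union.\<close>

lemma is_ght_rename:
  assumes "pre_ght B d"
  shows "is_ght B (ght_rename d)"
proof -
  let ?t = "nodes d" and ?r = "rename (nodes d)" and ?e = "ght_rename d"
  note closed = pre_ght_closed[OF assms]
  have n: "nodes ?e = ?r ` ?t" by (rule nodes_ght_rename)
  have union: "(\<Union>u \<in> children (nodes ?e) v. lab ?e u) \<subset> lab ?e v" if v: "v \<in> nodes ?e" for v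
  proof -
    obtain w where w: "w \<in> ?t" "v = ?r w" using v n by auto
    have "(\<Union>u \<in> children (nodes ?e) v. lab ?e u) = (\<Union>u \<in> children ?t w. lab ?e (?r u))"
      using children_ght_rename[OF assms w(1)] w(2) by simp
    also have "\<dots> = (\<Union>u \<in> children ?t w. lab d u)"
      by (rule SUP_cong) (auto simp: lab_ght_rename[OF assms] children_def)
    also have "\<dots> \<subset> lab d w" by (rule pre_ght_union[OF assms w(1)])
    also have "\<dots> = lab ?e v" using lab_ght_rename[OF assms w(1)] w by simp
    finally show ?thesis .
  qed
  have tree: "ordered_tree (nodes ?e)"
    unfolding n by (rule ordered_tree_rename[OF closed]) (use pre_ght_finite pre_ght_root assms in blast)+
  note closed' = ordered_tree_parent[OF tree]
  show ?thesis
    unfolding is_ght_def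
  proof (intro conjI allI impI ballI)
    show "ordered_tree (nodes ?e)" by (rule tree)
    show "lab ?e \<in> nodes ?e \<rightarrow>\<^sub>E (Pow (nstates B) - {{}})"
      unfolding PiE_iff
    proof
      show "\<forall>i\<in>nodes ?e. lab ?e i \<in> Pow (nstates B) - {{}}"
        using n pre_ght_lab[OF assms] pre_ght_lab_ne[OF assms] by (auto simp: lab_ght_rename[OF assms])
      show "lab ?e \<in> extensional (nodes ?e)" by (auto simp: ght_rename_def Let_def)
    qed
    show "idx ?e \<in> nodes ?e \<rightarrow>\<^sub>E {1..nacc_count B}"
      unfolding PiE_iff
    proof
      show "\<forall>i\<in>nodes ?e. idx ?e i \<in> {1..nacc_count B}"
        using n pre_ght_idx[OF assms] by (simp add: lab_ght_rename[OF assms])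
      show "idx ?e \<in> extensional (nodes ?e)" by (auto simp: ght_rename_def Let_def)
    qed
    show "(\<Union>u \<in> children (nodes ?e) v. lab ?e u) \<subset> lab ?e v" if "v \<in> nodes ?e" for v
      by (rule union[OF that])
    show "lab ?e (v @ [n]) \<subset> lab ?e v" if "v @ [n] \<in> nodes ?e" for v n
      using union[OF closed'[OF that]] that by (auto simp: children_def)
    show "lab ?e (v @ [m]) \<inter> lab ?e (v @ [n]) = {}"
      if that: "v @ [m] \<in> nodes ?e" "v @ [n] \<in> nodes ?e" "m \<noteq> n" for v m n
    proof -
      have "v \<in> ?r ` ?t" using closed'[OF that(1)] by (simp add: n)
      then obtain w where w: "w \<in> ?t" "v = ?r w" by blast
      have "v @ [m] \<in> ?r ` children ?t w" "v @ [n] \<in> ?r ` children ?t w"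
        using children_ght_rename[OF assms w(1)] w that by (auto simp: children_def)
      then obtain a b where ab: "w @ [a] \<in> ?t" "v @ [m] = ?r (w @ [a])" "w @ [b] \<in> ?t" "v @ [n] = ?r (w @ [b])"
        by (auto simp: children_def)
      then have "a \<noteq> b" using that(3) by (metis last_snoc)
      then show ?thesis using ab pre_ght_siblings[OF assms] by (simp add: lab_ght_rename[OF assms])
    qed
  qed
qed

section \<open>The successor of a history tree\<close>

lemma is_ngbaD:
  assumes "is_ngba B"
  shows "finite (alphabet B)" "finite (nstates B)" "ninit B \<noteq> {}" "ninit B \<subseteq> nstates B"
    "ntrans B \<subseteq> nstates B \<times> alphabet B \<times> nstates B" "nacc_count B \<ge> 1"
    "\<And>j. j \<in> {1..nacc_count B} \<Longrightarrow> nacc B j \<subseteq> ntrans B"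
  using assms by (auto simp: is_ngba_def)

lemma post_mono: "E \<subseteq> E' \<Longrightarrow> R \<subseteq> R' \<Longrightarrow> post E R \<sigma> \<subseteq> post E' R' \<sigma>"
  by (auto simp: post_def)

lemma post_subset_nstates: "is_ngba B \<Longrightarrow> post (ntrans B) R \<sigma> \<subseteq> nstates B"
  using is_ngbaD(5) by (fastforce simp: post_def)

context
  fixes B :: "('q, 'a) ngba" and d :: "'q ght" and \<sigma> :: 'a
  assumes B: "is_ngba B" and d: "is_ght B d"
begin

lemma nodes_split:
  "nodes (ght_split B \<sigma> d) = nodes d \<union> {v @ [card (children (nodes d) v)] | v. v \<in> nodes d}"
  by (simp add: ght_split_def ght_disjoint_def ght_spawn_def)

lemma new_child_notin: "v @ [card (children (nodes d) v)] \<notin> nodes d"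
  using ordered_tree_child_iff[OF is_ghtD(1)[OF d]] by simp

text \<open>Spawned nodes are leaves: each of them hangs below an old node, and none gets a child in
  the same step.\<close>

lemma split_parent: "v @ [n] \<in> nodes (ght_split B \<sigma> d) \<Longrightarrow> v \<in> nodes d"
  using ordered_tree_parent[OF is_ghtD(1)[OF d]] by (auto simp: nodes_split)

lemma ordered_tree_split: "ordered_tree (nodes (ght_split B \<sigma> d))"
proof -
  note t = is_ghtD(1)[OF d]
  have "finite ((\<lambda>v. v @ [card (children (nodes d) v)]) ` nodes d)"
    using ordered_treeD(1)[OF t] by simp
  then have fin: "finite (nodes (ght_split B \<sigma> d))"
    using ordered_treeD(1)[OF t] by (simp add: nodes_split setcompr_eq_image)
  have "v @ [i] \<in> nodes (ght_split B \<sigma> d)" if "v @ [n] \<in> nodes (ght_split B \<sigma> d)" "i < n" for v n i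
  proof -
    have "n < card (children (nodes d) v) \<or> n = card (children (nodes d) v)"
      using that(1) ordered_tree_child_iff[OF t, of v n] by (auto simp: nodes_split)
    then have "v @ [i] \<in> nodes d"
      using that(2) ordered_tree_child_iff[OF t, of v i] by auto
    then show ?thesis by (simp add: nodes_split)
  qed
  moreover have "v \<in> nodes (ght_split B \<sigma> d)" if "v @ [n] \<in> nodes (ght_split B \<sigma> d)" for v n
    using split_parent[OF that] by (simp add: nodes_split)
  moreover have "nodes (ght_split B \<sigma> d) \<noteq> {}"
    using is_ght_root[OF d] by (auto simp: nodes_split)
  ultimately show ?thesis
    using fin unfolding ordered_tree_def by blast
qed

lemma lab_spawn_old: "v \<in> nodes d \<Longrightarrow> lab (ght_spawn B \<sigma> d) v = post (ntrans B) (lab d v) \<sigma>"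
  by (simp add: ght_spawn_def)

lemma lab_spawn_new:
  "lab (ght_spawn B \<sigma> d) (v @ [card (children (nodes d) v)]) = post (nacc B (idx d v)) (lab d v) \<sigma>"
  using new_child_notin by (simp add: ght_spawn_def)

lemma ght_lab_child:
  assumes "v @ [n] \<in> nodes d"
  shows "lab d (v @ [n]) \<subseteq> lab d v"
proof -
  have "v @ [n] \<in> children (nodes d) v" using assms by (simp add: children_def)
  moreover have "(\<Union>u \<in> children (nodes d) v. lab d u) \<subset> lab d v"
    by (rule pre_ght_union[OF is_ght_imp_pre_ght[OF d] ordered_tree_parent[OF is_ghtD(1)[OF d] assms]])
  ultimately show ?thesis by blast
qed

lemma spawn_child_cases:
  assumes "v @ [n] \<in> nodes (ght_split B \<sigma> d)"
  obtains "v @ [n] \<in> nodes d" | "n = card (children (nodes d) v)" "v \<in> nodes d"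
  using assms by (auto simp: nodes_split)

lemma nacc_idx_subset: "v \<in> nodes d \<Longrightarrow> nacc B (idx d v) \<subseteq> ntrans B"
  using is_ngbaD(7)[OF B pre_ght_idx[OF is_ght_imp_pre_ght[OF d]]] .

lemma lab_spawn_child:
  assumes "v @ [n] \<in> nodes (ght_split B \<sigma> d)"
  shows "lab (ght_spawn B \<sigma> d) (v @ [n]) \<subseteq> lab (ght_spawn B \<sigma> d) v"
  using assms
proof (cases rule: spawn_child_cases)
  case 1
  then show ?thesis
    using lab_spawn_old[OF 1] lab_spawn_old[OF split_parent[OF assms]]
      post_mono[OF subset_refl ght_lab_child[OF 1]] by simp
next
  case 2
  then show ?thesis
    using lab_spawn_new[of v] lab_spawn_old[OF 2(2)]
      post_mono[OF nacc_idx_subset[OF 2(2)] subset_refl] by simp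
qed

lemma lab_split:
  "lab (ght_split B \<sigma> d) v = {q \<in> lab (ght_spawn B \<sigma> d) v.
     \<not> (\<exists>w n i. prefix (w @ [n]) v \<and> i < n \<and> w @ [i] \<in> nodes (ght_split B \<sigma> d) \<and>
        q \<in> lab (ght_spawn B \<sigma> d) (w @ [i]))}"
  by (simp add: ght_split_def ght_disjoint_def)

text \<open>The removal condition quantifies over prefixes, so whatever is removed from
  \<open>v\<close> is also removed below \<open>v\<close>, and the inclusion of labels
  survives.\<close>

lemma lab_split_child:
  assumes "v @ [n] \<in> nodes (ght_split B \<sigma> d)"
  shows "lab (ght_split B \<sigma> d) (v @ [n]) \<subseteq> lab (ght_split B \<sigma> d) v"
  using lab_spawn_child[OF assms] prefix_prefix[of _ v "[n]"] unfolding lab_split by blast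

lemma lab_split_siblings:
  assumes "v @ [m] \<in> nodes (ght_split B \<sigma> d)" "v @ [n] \<in> nodes (ght_split B \<sigma> d)" "m \<noteq> n"
  shows "lab (ght_split B \<sigma> d) (v @ [m]) \<inter> lab (ght_split B \<sigma> d) (v @ [n]) = {}"
proof -
  have "lab (ght_split B \<sigma> d) (v @ [m]) \<inter> lab (ght_split B \<sigma> d) (v @ [n]) = {}"
    if "m < n" "v @ [m] \<in> nodes (ght_split B \<sigma> d)" for m n
    using that unfolding lab_split by blast
  then show ?thesis
    using assms by (cases m n rule: linorder_cases) blast+
qed

lemma lab_split_root: "lab (ght_split B \<sigma> d) [] = post (ntrans B) (lab d []) \<sigma>"
  using lab_spawn_old[OF is_ght_root[OF d]] by (simp add: lab_split)

text \<open>The host is the oldest child holding \<open>q\<close> before the removal. By minimality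
  no older sibling of that child can take \<open>q\<close>, and an older sibling of \<open>v\<close>
  or of an ancestor would have taken \<open>q\<close> from \<open>v\<close> as well.\<close>

lemma lab_split_host:
  assumes "q \<in> lab (ght_split B \<sigma> d) v" "v @ [n] \<in> nodes (ght_split B \<sigma> d)"
    and "q \<in> lab (ght_spawn B \<sigma> d) (v @ [n])"
  obtains m where "m \<le> n" "v @ [m] \<in> nodes (ght_split B \<sigma> d)" "q \<in> lab (ght_split B \<sigma> d) (v @ [m])"
proof -
  let ?P = "\<lambda>m. v @ [m] \<in> nodes (ght_split B \<sigma> d) \<and> q \<in> lab (ght_spawn B \<sigma> d) (v @ [m])"
  obtain m where m: "?P m" and least: "\<And>i. i < m \<Longrightarrow> \<not> ?P i"
    using exists_least_iff[of ?P] assms(2,3) by blast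
  have le: "m \<le> n"
    using least[of n] assms(2,3) by (meson not_le)
  have "q \<in> lab (ght_split B \<sigma> d) (v @ [m])"
  proof (rule ccontr)
    assume "\<not> ?thesis"
    then obtain w n' i where w: "prefix (w @ [n']) (v @ [m])" "i < n'"
      "w @ [i] \<in> nodes (ght_split B \<sigma> d)" "q \<in> lab (ght_spawn B \<sigma> d) (w @ [i])"
      using m unfolding lab_split by blast
    have "w @ [n'] = v @ [m] \<or> prefix (w @ [n']) v"
      using w(1) by (simp only: prefix_snoc)
    then consider "w @ [n'] = v @ [m]" | "prefix (w @ [n']) v" by blast
    then show False
    proof cases
      case 1
      then show ?thesis using w(2-4) least[of i] by simp
    next
      case 2
      then show ?thesis using w assms(1) unfolding lab_split by blast
    qed
  qed
  then show ?thesis using that m le by blast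
qed

lemma nodes_remain:
  "nodes (ght_remain B \<sigma> d) = {v \<in> nodes (ght_split B \<sigma> d).
     (\<forall>u. strict_prefix u v \<longrightarrow> \<not> saturated (ght_split B \<sigma> d) u) \<and> lab (ght_split B \<sigma> d) v \<noteq> {}}"
  by (auto simp: ght_remain_def ght_nonempty_def ght_collapse_def)

lemma lab_remain: "lab (ght_remain B \<sigma> d) = lab (ght_split B \<sigma> d)"
  by (simp add: ght_remain_def ght_nonempty_def ght_collapse_def)

lemma idx_split: "idx (ght_split B \<sigma> d) v = (if v \<in> nodes d then idx d v else 1)"
  by (simp add: ght_split_def ght_disjoint_def ght_spawn_def)

lemma idx_remain: "idx (ght_remain B \<sigma> d) v =
   (let i = if v \<in> nodes d then idx d v else 1
    in if saturated (ght_split B \<sigma> d) v then cyc_suc (nacc_count B) i else i)"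
  by (simp add: ght_remain_def ght_nonempty_def ght_collapse_def idx_split Let_def)

text \<open>Strict inclusion of the union of the children has two sources: a saturated node has lost
  all descendants and keeps a nonempty label, and at any other node the union was strictly smaller
  already and can only have shrunk. The assumption keeps the root from being deleted.\<close>

lemma pre_ght_remain:
  assumes "post (ntrans B) (lab d []) \<sigma> \<noteq> {}"
  shows "pre_ght B (ght_remain B \<sigma> d)"
proof -
  let ?s = "ght_split B \<sigma> d" and ?r = "ght_remain B \<sigma> d"
  have sub: "children (nodes ?r) v \<subseteq> children (nodes ?s) v" for v
    by (auto simp: children_def nodes_remain)
  have closed: "v \<in> nodes ?r" if "v @ [n] \<in> nodes ?r" for v n
  proof -
    have *: "v @ [n] \<in> nodes ?s" "lab ?s (v @ [n]) \<noteq> {}" using that by (auto simp: nodes_remain)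
    have "v \<in> nodes ?s" using ordered_tree_parent[OF ordered_tree_split *(1)] .
    moreover have "lab ?s v \<noteq> {}" using lab_split_child[OF *(1)] * by auto
    moreover have "\<not> saturated ?s u" if "strict_prefix u v" for u
      using \<open>v @ [n] \<in> nodes ?r\<close> that prefix_order.less_le_trans[OF that, of "v @ [n]"]
      by (auto simp: nodes_remain)
    ultimately show ?thesis by (auto simp: nodes_remain)
  qed
  have lab_sub: "lab ?s v \<subseteq> nstates B" if "v \<in> nodes ?s" for v
    using that
  proof (induction v rule: rev_induct)
    case Nil
    then show ?case using post_subset_nstates[OF B] by (simp add: lab_split_root)
  next
    case (snoc n v)
    then show ?case
      using lab_split_child[OF snoc.prems] ordered_tree_parent[OF ordered_tree_split snoc.prems] by blast
  qed
  have idx: "idx ?r v \<in> {1..nacc_count B}" if "v \<in> nodes ?r" for v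
    using is_ngbaD(6)[OF B] pre_ght_idx[OF is_ght_imp_pre_ght[OF d], of v]
    by (auto simp: idx_remain Let_def cyc_suc_def)
  have union: "(\<Union>u \<in> children (nodes ?r) v. lab ?r u) \<subset> lab ?r v" if v: "v \<in> nodes ?r" for v
  proof (cases "saturated ?s v")
    case True
    then have "children (nodes ?r) v = {}"
      by (auto simp: children_def nodes_remain strict_prefix_def)
    then show ?thesis using v by (auto simp: nodes_remain lab_remain)
  next
    case False
    then have "(\<Union>u \<in> children (nodes ?s) v. lab ?s u) \<noteq> lab ?s v"
      using v by (auto simp: saturated_def nodes_remain)
    moreover have "(\<Union>u \<in> children (nodes ?s) v. lab ?s u) \<subseteq> lab ?s v"
      using lab_split_child unfolding children_def by blast
    ultimately show ?thesis
      using sub[of v] unfolding lab_remain by blast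
  qed
  show ?thesis
    unfolding pre_ght_def
  proof (intro conjI allI impI ballI)
    show "finite (nodes ?r)"
      by (rule finite_subset[OF _ ordered_treeD(1)[OF ordered_tree_split]]) (auto simp: nodes_remain)
    show "[] \<in> nodes ?r"
      using assms is_ght_root[OF d] lab_split_root by (simp add: nodes_remain nodes_split)
    show "lab ?r (v @ [m]) \<inter> lab ?r (v @ [n]) = {}"
      if "v @ [m] \<in> nodes ?r" "v @ [n] \<in> nodes ?r" "m \<noteq> n" for v m n
      using lab_split_siblings that by (simp add: lab_remain nodes_remain)
    show "v \<in> nodes ?r" if "v @ [n] \<in> nodes ?r" for v n using closed that .
    show "lab ?r v \<subseteq> nstates B" if "v \<in> nodes ?r" for v
      using that lab_sub by (simp add: lab_remain nodes_remain)
    show "lab ?r v \<noteq> {}" if "v \<in> nodes ?r" for v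
      using that by (simp add: lab_remain nodes_remain)
  qed (use idx union in auto)
qed

end

lemma ght_stepD:
  assumes "ght_step B d \<sigma> = Some d'"
  shows "is_ght B d" "\<sigma> \<in> alphabet B" "post (ntrans B) (lab d []) \<sigma> \<noteq> {}"
    "d' = ght_rename (ght_remain B \<sigma> d)"
  using assms by (auto simp: ght_step_def split: if_splits)

lemma ght_step_is_ght:
  assumes "is_ngba B" "ght_step B d \<sigma> = Some d'"
  shows "is_ght B d'"
  using is_ght_rename[OF pre_ght_remain] ght_stepD[OF assms(2)] assms(1) by metis

lemma ght_step_lab:
  assumes "is_ngba B" "ght_step B d \<sigma> = Some d'" "v \<in> nodes (ght_remain B \<sigma> d)"
  shows "rename (nodes (ght_remain B \<sigma> d)) v \<in> nodes d'"
    "lab d' (rename (nodes (ght_remain B \<sigma> d)) v) = lab (ght_split B \<sigma> d) v"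
    "idx d' (rename (nodes (ght_remain B \<sigma> d)) v) = idx (ght_remain B \<sigma> d) v"
    "children (nodes d') (rename (nodes (ght_remain B \<sigma> d)) v) =
       rename (nodes (ght_remain B \<sigma> d)) ` children (nodes (ght_remain B \<sigma> d)) v"
proof -
  note s = ght_stepD[OF assms(2)]
  note pre = pre_ght_remain[OF assms(1) s(1,3)]
  show "rename (nodes (ght_remain B \<sigma> d)) v \<in> nodes d'"
    using assms(3) by (simp add: s(4) nodes_ght_rename)
  show "lab d' (rename (nodes (ght_remain B \<sigma> d)) v) = lab (ght_split B \<sigma> d) v"
    "idx d' (rename (nodes (ght_remain B \<sigma> d)) v) = idx (ght_remain B \<sigma> d) v"
    using lab_ght_rename[OF pre assms(3)] lab_remain[OF assms(1) s(1)] by (simp_all add: s(4))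
  show "children (nodes d') (rename (nodes (ght_remain B \<sigma> d)) v) =
       rename (nodes (ght_remain B \<sigma> d)) ` children (nodes (ght_remain B \<sigma> d)) v"
    using children_ght_rename[OF pre assms(3)] by (simp add: s(4))
qed

lemma root_in_remain:
  assumes "is_ngba B" "ght_step B d \<sigma> = Some d'"
  shows "[] \<in> nodes (ght_remain B \<sigma> d)"
  using pre_ght_root[OF pre_ght_remain] ght_stepD[OF assms(2)] assms(1) by metis

text \<open>The root has no siblings, so the removal of shared states leaves its label untouched,
  and renaming fixes it. Root labels therefore follow the subset automaton.\<close>

lemma rchd_ght_step:
  assumes "is_ngba B" "ght_step B d \<sigma> = Some d'"
  shows "rchd d' = post (ntrans B) (rchd d) \<sigma>"
  using ght_step_lab(2)[OF assms root_in_remain[OF assms]] lab_split_root[OF assms(1) ght_stepD(1)[OF assms(2)]]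
  by (simp add: rchd_def)

lemma is_ght_initial:
  assumes "is_ngba B"
  shows "is_ght B (initial_ght B)"
  using is_ngbaD(3,4,6)[OF assms]
  by (auto simp: is_ght_def initial_ght_def ordered_tree_def children_def)

section \<open>Bounds on the size and the number of history trees\<close>

lemma ght_lab_prefix:
  assumes "is_ngba B" "is_ght B d" "v \<in> nodes d" "prefix u v"
  shows "lab d v \<subseteq> lab d u"
proof -
  have "lab d (u @ x) \<subseteq> lab d u" if "u @ x \<in> nodes d" for x
    using that
  proof (induction x rule: rev_induct)
    case (snoc n x)
    then show ?case
      using ght_lab_child[OF assms(1,2), of "u @ x" n]
        ordered_tree_parent[OF is_ghtD(1)[OF assms(2)], of "u @ x" n] by auto
  qed simp
  then show ?thesis using assms(3,4) by (auto simp: prefix_def)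
qed

text \<open>Every node of a history tree owns a state that lies in none of its children's labels.\<close>

lemma card_nodes_le:
  assumes "is_ngba B" "is_ght B d"
  shows "card (nodes d) \<le> card (nstates B)"
proof -
  note pre = is_ght_imp_pre_ght[OF assms(2)]
  note tree = is_ghtD(1)[OF assms(2)]
  let ?own = "\<lambda>v. lab d v - (\<Union>u \<in> children (nodes d) v. lab d u)"
  have "\<exists>q. q \<in> ?own v" if "v \<in> nodes d" for v
    using pre_ght_union[OF pre that] by blast
  then obtain f where f: "\<And>v. v \<in> nodes d \<Longrightarrow> f v \<in> ?own v" by metis
  have lab_prefix: "lab d (v @ u) \<subseteq> lab d v" if "v @ u \<in> nodes d" for u v
    by (rule ght_lab_prefix[OF assms that]) simp
  have desc: "f v \<noteq> f (v @ n # u)" if "v \<in> nodes d" "v @ n # u \<in> nodes d" for v n u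
  proof -
    have "v @ [n] \<in> nodes d"
      by (rule ordered_tree_prefix[OF tree that(2)]) simp
    then have "f (v @ n # u) \<in> (\<Union>u \<in> children (nodes d) v. lab d u)"
      using lab_prefix[of "v @ [n]" u] that f[of "v @ n # u"] by (auto simp: children_def)
    then show ?thesis using f[of v] that by auto
  qed
  have "inj_on f (nodes d)"
  proof (rule inj_onI, rule ccontr)
    fix v w assume vw: "v \<in> nodes d" "w \<in> nodes d" "f v = f w" "v \<noteq> w"
    have "\<not> prefix v w" "\<not> prefix w v"
      using desc vw by (metis append_Nil2 neq_Nil_conv prefix_def)+
    then have "parallel v w" by auto
    then obtain z a v' b w' where z: "a \<noteq> b" "v = z @ a # v'" "w = z @ b # w'"
      using parallel_decomp by metis
    have ab: "z @ [a] \<in> nodes d" "z @ [b] \<in> nodes d"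
      using ordered_tree_prefix[OF tree vw(1), of "z @ [a]"]
        ordered_tree_prefix[OF tree vw(2), of "z @ [b]"] z by auto
    have "f v \<in> lab d (z @ [a])" "f w \<in> lab d (z @ [b])"
      using f[OF vw(1)] f[OF vw(2)] lab_prefix[of "z @ [a]" v'] lab_prefix[of "z @ [b]" w'] z vw by auto
    then show False using pre_ght_siblings[OF pre ab z(1)] vw(3) by auto
  qed
  moreover have "f ` nodes d \<subseteq> nstates B" using f pre_ght_lab[OF pre] by blast
  ultimately show ?thesis using card_inj_on_le is_ngbaD(2)[OF assms(1)] by blast
qed

text \<open>\<open>rindex\<close> is made of the nodes of trees with exactly
  \<open>card (nstates B)\<close> nodes, whereas a history tree may be smaller. It is padded with
  new youngest children of the root.\<close>

lemma ordered_tree_card_extend: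
  assumes "ordered_tree t" "[] \<in> t" "card t \<le> n"
  shows "\<exists>t'. ordered_tree t' \<and> card t' = n \<and> t \<subseteq> t'"
  using assms
proof (induction "n - card t" arbitrary: t)
  case 0
  then show ?case by auto
next
  case (Suc k)
  let ?c = "[card (children t [])]" and ?t = "insert [card (children t [])] t"
  have c: "?c \<notin> t" using ordered_tree_child_iff[OF Suc.prems(1), of "[]"] by auto
  have older: "[i] \<in> t" if "i < card (children t [])" for i
    using ordered_tree_child_iff[OF Suc.prems(1), of "[]" i] that by auto
  have "ordered_tree ?t"
    unfolding ordered_tree_def
  proof (intro conjI allI impI)
    fix v m assume "v @ [m] \<in> ?t"
    then consider "v @ [m] \<in> t" | "v = []" "m = card (children t [])" by auto
    note cases = this
    show "v \<in> ?t"
      using cases ordered_tree_parent[OF Suc.prems(1), of v m] Suc.prems(2) by cases auto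
    show "v @ [i] \<in> ?t" if "i < m" for i
      using cases ordered_tree_older[OF Suc.prems(1), of v m i] older that by cases auto
  qed (use ordered_treeD(1)[OF Suc.prems(1)] in auto)
  moreover have "card ?t = Suc (card t)" using c ordered_treeD(1)[OF Suc.prems(1)] by simp
  ultimately show ?case
    using Suc.hyps(1)[of ?t] Suc.hyps(2) Suc.prems by fastforce
qed

lemma ght_node_in_rindex:
  assumes "is_ngba B" "is_ght B d" "v \<in> nodes d"
  shows "v \<in> rindex (det B)"
  using ordered_tree_card_extend[OF is_ghtD(1)[OF assms(2)] is_ght_root[OF assms(2)]
      card_nodes_le[OF assms(1,2)]] assms(3)
  by (auto simp: det_def)

text \<open>A node of depth \<open>n\<close> has \<open>n + 1\<close> prefixes, and a child with
  number \<open>n\<close> has \<open>n\<close> older siblings; all of these are nodes, so the size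
  of the tree bounds both depth and entries.\<close>

lemma ght_node_bounds:
  assumes "is_ngba B" "is_ght B d" "v \<in> nodes d"
  shows "length v < card (nstates B)" and "set v \<subseteq> {..<card (nstates B)}"
proof -
  note tree = is_ghtD(1)[OF assms(2)]
  have fin: "finite (nodes d)" using ordered_treeD(1)[OF tree] .
  have take: "take i v \<in> nodes d" for i
    by (rule ordered_tree_prefix[OF tree assms(3) take_is_prefix])
  have "inj_on (\<lambda>i. take i v) {..length v}"
    by (rule inj_on_inverseI[of _ length]) auto
  then have "card {..length v} \<le> card (nodes d)"
    using take fin by (intro card_inj_on_le) auto
  then show "length v < card (nstates B)"
    using card_nodes_le[OF assms(1,2)] by simp
  show "set v \<subseteq> {..<card (nstates B)}"
  proof
    fix n assume "n \<in> set v"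
    then obtain u w where v: "v = u @ n # w" by (metis split_list)
    have un: "u @ [n] \<in> nodes d"
      by (rule ordered_tree_prefix[OF tree assms(3)]) (simp add: v)
    have "(\<lambda>i. u @ [i]) ` {..n} \<subseteq> nodes d"
      using un ordered_tree_older[OF tree un] by (auto simp: le_less)
    then have "card {..n} \<le> card (nodes d)"
      by (intro card_inj_on_le[of "\<lambda>i. u @ [i]"]) (auto simp: inj_on_def fin)
    then show "n \<in> {..<card (nstates B)}" using card_nodes_le[OF assms(1,2)] by simp
  qed
qed

text \<open>Nodes are words of bounded length over a bounded alphabet, and labels and indices are
  extensional, so a tree amounts to finitely many finite choices.\<close>

lemma finite_ghts:
  assumes "is_ngba B"
  shows "finite {d. is_ght B d}"
proof -
  let ?N = "{v. set v \<subseteq> {..<card (nstates B)} \<and> length v \<le> card (nstates B)}"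
  let ?S = "SIGMA t:Pow ?N. (t \<rightarrow>\<^sub>E Pow (nstates B)) \<times> (t \<rightarrow>\<^sub>E {1..nacc_count B})"
  have N: "finite ?N" by (rule finite_lists_length_le) simp
  have "finite ?S"
    using N is_ngbaD(2)[OF assms]
    by (intro finite_SigmaI finite_cartesian_product finite_PiE) (auto dest: finite_subset)
  moreover have "{d. is_ght B d} \<subseteq> (\<lambda>(t, l, h). \<lparr>nodes = t, lab = l, idx = h\<rparr>) ` ?S"
  proof
    fix d assume "d \<in> {d. is_ght B d}"
    then have d: "is_ght B d" by simp
    have "nodes d \<subseteq> ?N" using ght_node_bounds[OF assms d] by (auto intro: less_imp_le)
    moreover have "lab d \<in> nodes d \<rightarrow>\<^sub>E Pow (nstates B)"
      using is_ghtD(2)[OF d] PiE_mono[of "nodes d" "\<lambda>_. Pow (nstates B) - {{}}" "\<lambda>_. Pow (nstates B)"] by blast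
    ultimately have "(nodes d, lab d, idx d) \<in> ?S" using is_ghtD(3)[OF d] by blast
    then show "d \<in> (\<lambda>(t, l, h). \<lparr>nodes = t, lab = l, idx = h\<rparr>) ` ?S"
      by (rule rev_image_eqI) (cases d, simp)
  qed
  ultimately show ?thesis by (rule rev_finite_subset[OF finite_imageI])
qed

section \<open>Correctness of the determinisation\<close>

text \<open>The start set is a parameter because acceptance has to be compared from the root label
  of an arbitrary tree, at an arbitrary time.\<close>

definition lang_from :: "('q, 'a) ngba \<Rightarrow> 'q set \<Rightarrow> (nat \<Rightarrow> 'a) set" where
  "lang_from B R = {w. \<exists>\<rho>. \<rho> 0 \<in> R \<and> (\<forall>i. (\<rho> i, w i, \<rho> (Suc i)) \<in> ntrans B) \<and>
     (\<forall>j \<in> {1..nacc_count B}. infinite {i. (\<rho> i, w i, \<rho> (Suc i)) \<in> nacc B j})}"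

lemma language_eq: "language B = {w. (\<forall>i. w i \<in> alphabet B) \<and> w \<in> lang_from B (ninit B)}"
  by (auto simp: language_def lang_from_def accepting_run_def is_run_def)

text \<open>The complement of the rejecting condition for \<open>v\<close>: the node is old,
  remains, and keeps its name. The Rabin condition for \<open>v\<close> thus says: stable from some
  time on and saturated infinitely often.\<close>

definition stable_node :: "('q, 'a) ngba \<Rightarrow> 'a \<Rightarrow> 'q ght \<Rightarrow> nat list \<Rightarrow> bool" where
  "stable_node B \<sigma> d v \<longleftrightarrow> v \<in> nodes d \<and> v \<in> nodes (ght_remain B \<sigma> d) \<and>
     rename (nodes (ght_remain B \<sigma> d)) v = v"

text \<open>Otherwise every \<open>x\<close> fails at some index and at all later ones; at the
  maximum of these finitely many indices no \<open>x\<close> is left.\<close>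

lemma finite_antimono_pigeonhole:
  assumes "finite A" "\<And>k::nat. \<exists>x \<in> A. P k x" "\<And>k x. P (Suc k) x \<Longrightarrow> P k x"
  shows "\<exists>x \<in> A. \<forall>k. P k x"
proof (rule ccontr)
  assume "\<not> ?thesis"
  then obtain K where K: "\<And>x. x \<in> A \<Longrightarrow> \<not> P (K x) x" by metis
  have anti: "P k x" if "P l x" "k \<le> l" for k l x
    using that(2,1) by (induction rule: dec_induct) (auto dest: assms(3))
  obtain x where x: "x \<in> A" "P (Max (K ` A)) x" using assms(2) by blast
  have "K x \<le> Max (K ` A)" using assms(1) x(1) by simp
  then show False using anti x K by blast
qed

text \<open>Levels are finite and nonempty and every vertex has a predecessor, so arbitrarily long
  paths start on level 0; compactness turns them into an infinite one. The vertices will be the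
  states that the labels admit as current state of a run.\<close>

lemma koenig:
  fixes V :: "nat \<Rightarrow> 'x set"
  assumes fin: "\<And>n. finite (V n)" and ne: "\<And>n. V n \<noteq> {}"
    and pred: "\<And>n y. y \<in> V (Suc n) \<Longrightarrow> \<exists>x \<in> V n. R n x y"
  shows "\<exists>f. \<forall>n. f n \<in> V n \<and> R n (f n) (f (Suc n))"
proof -
  \<comment> \<open>\<open>E k n x\<close> says that a path of \<open>k\<close> further edges leaves
    \<open>x\<close> on level \<open>n\<close>. The infinite path stays among the vertices for which
    this holds for all \<open>k\<close>.\<close>
  define E where "E = rec_nat (\<lambda>_ _. True) (\<lambda>k Ek n x. \<exists>y \<in> V (Suc n). R n x y \<and> Ek (Suc n) y)"
  have E0: "E 0 n x" and ESuc: "E (Suc k) n x \<longleftrightarrow> (\<exists>y \<in> V (Suc n). R n x y \<and> E k (Suc n) y)" for k n x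
    by (simp_all add: E_def)
  have anti: "E (Suc k) n x \<Longrightarrow> E k n x" for k n x
    by (induction k arbitrary: n x) (auto simp: E0 ESuc)
  have ex: "\<exists>x \<in> V n. E k n x" for k n
  proof (induction k arbitrary: n)
    case 0
    then show ?case using ne by (auto simp: E0)
  next
    case (Suc k)
    then show ?case using pred by (fastforce simp: ESuc)
  qed
  have start: "\<exists>x \<in> V 0. \<forall>k. E k 0 x"
    by (rule finite_antimono_pigeonhole) (use fin ex anti in auto)
  have step: "\<exists>y. (y \<in> V (Suc n) \<and> (\<forall>k. E k (Suc n) y)) \<and> R n x y" if "\<forall>k. E k n x" for n x
  proof -
    have "\<exists>y \<in> {y \<in> V (Suc n). R n x y}. E k (Suc n) y" for k
      using that[rule_format, of "Suc k"] by (auto simp: ESuc)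
    then have "\<exists>y \<in> {y \<in> V (Suc n). R n x y}. \<forall>k. E k (Suc n) y"
      by (intro finite_antimono_pigeonhole) (use fin anti in auto)
    then show ?thesis by blast
  qed
  have "\<exists>f. \<forall>n. (f n \<in> V n \<and> (\<forall>k. E k n (f n))) \<and> R n (f n) (f (Suc n))"
    by (rule dependent_nat_choice) (use start step in auto)
  then show ?thesis by blast
qed

lemma cyc_suc_reach:
  assumes "h \<in> {1..k}" "t \<in> {1..k}"
  shows "\<exists>m. (cyc_suc k ^^ m) h = t"
proof -
  have up: "(cyc_suc k ^^ m) h = h + m" if "h + m \<le> k" "1 \<le> h" for h m
    using that by (induction m) (auto simp: cyc_suc_def)
  have "(cyc_suc k ^^ (k - h)) h = k" "(cyc_suc k ^^ (t - 1)) 1 = t"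
    using up[of h "k - h"] up[of 1 "t - 1"] assms by auto
  \<comment> \<open>\<open>k - h\<close> steps climb from \<open>h\<close> to \<open>k\<close>, one
    step wraps to 1, and \<open>t - 1\<close> steps climb to \<open>t\<close>.\<close>
  then have "(cyc_suc k ^^ (t - 1 + (1 + (k - h)))) h = t"
    unfolding funpow_add o_apply by (simp add: cyc_suc_def)
  then show ?thesis by blast
qed

lemma det_sound:
  assumes B: "is_ngba B"
    and step: "\<And>i. ght_step B (d i) (w i) = Some (d (Suc i))"
    and stable: "\<And>i. n \<le> i \<Longrightarrow> stable_node B (w i) (d i) v"
    and sat: "\<exists>\<^sub>\<infinity>i. saturated (ght_split B (w i) (d i)) v"
  shows "w \<in> lang_from B (rchd (d 0))"
proof -
  note ght = ght_stepD(1)[OF step]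
  let ?S = "\<lambda>i. ght_split B (w i) (d i)" and ?M = "\<lambda>i. ght_remain B (w i) (d i)"
  define U where "U i = (\<Union>u \<in> children (nodes (d i)) v. lab (d i) u)" for i
  define U' where "U' i = (\<Union>u \<in> children (nodes (?S i)) v. lab (?S i) u)" for i
  have vn: "v \<in> nodes (d i)" if "n \<le> i" for i using stable[OF that] by (simp add: stable_node_def)
  have lab': "lab (d (Suc i)) v = lab (?S i) v"
    and idx': "idx (d (Suc i)) v =
       (if saturated (?S i) v then cyc_suc (nacc_count B) (idx (d i) v) else idx (d i) v)"
    and ch': "children (nodes (d (Suc i))) v = rename (nodes (?M i)) ` children (nodes (?M i)) v"
    if "n \<le> i" for i
    using ght_step_lab[OF B step[of i], of v] stable[OF that] idx_remain[OF B ght[of i], where v = v]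
    by (simp_all add: stable_node_def)
  have UU': "U (Suc i) \<subseteq> U' i" if "n \<le> i" for i
  proof -
    have "U (Suc i) = (\<Union>u \<in> children (nodes (?M i)) v. lab (?S i) u)"
      unfolding U_def ch'[OF that] image_image
      by (intro SUP_cong refl ght_step_lab(2)[OF B step[of i]]) (auto simp: children_def)
    then show ?thesis by (auto simp: U'_def children_def nodes_remain[OF B ght])
  qed
  have Usat: "U (Suc i) = {}" if "n \<le> i" "saturated (?S i) v" for i
    using that unfolding U_def ch'[OF that(1)]
    by (auto simp: children_def nodes_remain[OF B ght] strict_prefix_def)
  \<comment> \<open>Choosing predecessors by \<open>R\<close> makes a run that is in a child of \<open>v\<close> either stay in the children of
    \<open>v\<close> or have entered them by a transition in the set \<open>idx (d i) v\<close>. The children of \<open>v\<close> vanish when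
    \<open>v\<close> is saturated, so the run takes such a transition between any two saturations.\<close>
  define W where "W i = (if i < n then rchd (d i) else lab (d i) v)" for i
  define R where "R i q q' \<longleftrightarrow> (q, w i, q') \<in> ntrans B \<and>
    (n \<le> i \<longrightarrow> q' \<in> U' i \<longrightarrow> q \<in> U i \<or> (q, w i, q') \<in> nacc B (idx (d i) v))" for i q q'
  have "\<exists>\<rho>. \<forall>i. \<rho> i \<in> W i \<and> R i (\<rho> i) (\<rho> (Suc i))"
  proof (rule koenig)
    fix i
    have "W i \<subseteq> nstates B" "W i \<noteq> {}"
      using pre_ght_lab[OF is_ght_imp_pre_ght[OF ght]] pre_ght_lab_ne[OF is_ght_imp_pre_ght[OF ght]]
        is_ght_root[OF ght[of i]] vn[of i] by (auto simp: W_def rchd_def)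
    then show "finite (W i)" "W i \<noteq> {}"
      using is_ngbaD(2)[OF B] finite_subset by auto
  next
    fix i q' assume q': "q' \<in> W (Suc i)"
    show "\<exists>q \<in> W i. R i q q'"
    \<comment> \<open>Before \<open>n\<close> the node \<open>v\<close> need not exist, so the run
      is tracked in the root label only; from \<open>n\<close> on it lives in the label of
      \<open>v\<close>.\<close>
    proof (cases "i < n")
      case True
      have "W (Suc i) \<subseteq> rchd (d (Suc i))"
        using ght_lab_prefix[OF B ght vn[of "Suc i"], of "[]"] by (auto simp: W_def rchd_def)
      then have "q' \<in> post (ntrans B) (rchd (d i)) (w i)"
        using q' rchd_ght_step[OF B step[of i]] by auto
      then show ?thesis using True by (auto simp: W_def R_def post_def)
    next
      case False
      then have i: "n \<le> i" by simp
      have q: "q' \<in> lab (?S i) v" using q' i lab' by (simp add: W_def)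
      show ?thesis
      proof (cases "q' \<in> U' i")
        case False
        have "q' \<in> post (ntrans B) (lab (d i) v) (w i)"
          using q lab_split[OF B ght[of i]] lab_spawn_old[OF B ght vn[OF i]] by blast
        then show ?thesis using False i by (auto simp: W_def R_def post_def)
      next
        case True
        then obtain c where c: "v @ [c] \<in> nodes (?S i)" "q' \<in> lab (ght_spawn B (w i) (d i)) (v @ [c])"
          using lab_split[OF B ght[of i]] by (auto simp: U'_def children_def)
        \<comment> \<open>A state in a child of \<open>v\<close> either moved along inside an old
          child, or was put into the spawned child by a transition in the set numbered
          \<open>idx (d i) v\<close>. The disjunction in \<open>R\<close> records these two
          origins.\<close>
        from c(1) show ?thesis
        proof (cases rule: spawn_child_cases[OF B ght[of i], of v c "w i", consumes 1, case_names 1 2])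
          case 1
          then obtain q where "q \<in> lab (d i) (v @ [c])" "(q, w i, q') \<in> ntrans B"
            using c(2) unfolding lab_spawn_old[OF B ght 1] by (auto simp: post_def)
          then show ?thesis
            using ght_lab_child[OF B ght 1] 1 i
            by (intro bexI[of _ q]) (auto simp: W_def R_def U_def children_def)
        next
          case 2
          then obtain q where "q \<in> lab (d i) v" "(q, w i, q') \<in> nacc B (idx (d i) v)"
            using c(2) lab_spawn_new[OF B ght[of i], where v = v] by (auto simp: post_def)
          then show ?thesis
            using nacc_idx_subset[OF B ght vn[OF i]] i
            by (intro bexI[of _ q]) (auto simp: W_def R_def)
        qed
      qed
    qed
  qed
  then obtain \<rho> where \<rho>: "\<And>i. \<rho> i \<in> W i" "\<And>i. R i (\<rho> i) (\<rho> (Suc i))" by blast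
  have start: "\<rho> 0 \<in> rchd (d 0)"
    using \<rho>(1)[of 0] ght_lab_prefix[OF B ght vn[of 0], of "[]"] by (auto simp: W_def rchd_def split: if_splits)
  let ?acc = "\<lambda>i j. (\<rho> i, w i, \<rho> (Suc i)) \<in> nacc B j"
  \<comment> \<open>After the saturation at \<open>a\<close> the children are gone, so a run found
    in a child later has entered since. If it is in a child at \<open>Suc j\<close>, then
    \<open>v\<close> was not saturated at \<open>j\<close> and its index did not move, so the set it
    entered by is still the current one.\<close>
  have visited: "\<exists>i. a < i \<and> i < j \<and> ?acc i (idx (d j) v)"
    if "n \<le> a" "saturated (?S a) v" "Suc a \<le> j" "\<rho> j \<in> U j" for a j
    using that(3,4)
  proof (induction rule: dec_induct)
    case base
    then show ?case using Usat[OF that(1,2)] by simp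
  next
    case (step j)
    then have j: "n \<le> j" using that(1) by simp
    have ns: "\<not> saturated (?S j) v" using step.prems Usat[OF j] by auto
    have "\<rho> (Suc j) \<in> U' j" using UU'[OF j] step.prems by auto
    then have "\<rho> j \<in> U j \<or> ?acc j (idx (d j) v)" using \<rho>(2)[of j] j by (auto simp: R_def)
    then show ?case
      using step.IH step.hyps idx'[OF j] ns by (metis Suc_le_lessD less_Suc_eq)
  qed
  have visited_sat: "\<exists>i>a. ?acc i (idx (d b) v)"
    if "n \<le> a" "saturated (?S a) v" "a < b" "saturated (?S b) v" for a b
  proof -
    have b: "n \<le> b" using that by simp
    \<comment> \<open>Saturation at \<open>b\<close> means that the children cover the label of
      \<open>v\<close>, so the run must be in one of them.\<close>
    have "\<rho> (Suc b) \<in> U' b"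
      using \<rho>(1)[of "Suc b"] that(4) lab'[OF b] b by (simp add: W_def U'_def saturated_def)
    then have "\<rho> b \<in> U b \<or> ?acc b (idx (d b) v)" using \<rho>(2)[of b] b by (auto simp: R_def)
    then show ?thesis using visited[OF that(1,2), of b] that(3) by auto
  qed
  have next_sat: "\<exists>b'>b. saturated (?S b') v \<and> idx (d b') v = cyc_suc (nacc_count B) (idx (d b) v)"
    if "n \<le> b" "saturated (?S b) v" for b
  proof -
    \<comment> \<open>\<open>b'\<close> is the next saturation after \<open>b\<close>; in between
      the index advances only once, at \<open>b\<close> itself.\<close>
    obtain b' where b': "saturated (?S b') v" "b < b'"
      and least: "\<And>j. j < b' \<Longrightarrow> \<not> (saturated (?S j) v \<and> b < j)"
      using sat[unfolded INFM_nat, rule_format, of b] exists_least_iff[of "\<lambda>j. saturated (?S j) v \<and> b < j"] by blast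
    have "idx (d j) v = cyc_suc (nacc_count B) (idx (d b) v)" if "Suc b \<le> j" "j \<le> b'" for j
      using that
    proof (induction rule: dec_induct)
      case base
      then show ?case using idx'[OF \<open>n \<le> b\<close>] \<open>saturated (?S b) v\<close> by simp
    next
      case (step j)
      then show ?case using idx'[of j] \<open>n \<le> b\<close> least[of j] by auto
    qed
    then show ?thesis using b' by auto
  qed
  have sat_idx: "\<exists>b\<ge>N. saturated (?S b) v \<and> idx (d b) v = t" if t: "t \<in> {1..nacc_count B}" for N t
  proof -
    obtain b where b: "b > max n N" "saturated (?S b) v"
      using sat unfolding INFM_nat by blast
    have h: "idx (d b) v \<in> {1..nacc_count B}"
      using pre_ght_idx[OF is_ght_imp_pre_ght[OF ght] vn[of b]] b by simp
    have "\<exists>b'\<ge>b. saturated (?S b') v \<and> idx (d b') v = (cyc_suc (nacc_count B) ^^ m) (idx (d b) v)" for m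
    proof (induction m)
      case (Suc m)
      then obtain b' where "b' \<ge> b" "saturated (?S b') v"
        "idx (d b') v = (cyc_suc (nacc_count B) ^^ m) (idx (d b) v)" by blast
      moreover from this obtain b'' where "b'' > b'" "saturated (?S b'') v"
        "idx (d b'') v = cyc_suc (nacc_count B) (idx (d b') v)"
        using next_sat[of b'] b(1) by auto
      ultimately show ?case by (intro exI[of _ b'']) auto
    qed (use b in auto)
    then show ?thesis using cyc_suc_reach[OF h t] b(1) by (metis le_trans less_imp_le max.boundedE)
  qed
  have "infinite {i. ?acc i j}" if j: "j \<in> {1..nacc_count B}" for j
    unfolding infinite_nat_iff_unbounded
  proof
    fix N
    obtain a where a: "max n N < a" "saturated (?S a) v"
      using sat unfolding INFM_nat by blast
    obtain b where "b \<ge> Suc a" "saturated (?S b) v" "idx (d b) v = j"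
      using sat_idx[OF j] by blast
    then obtain i where "i > a" "?acc i j" using visited_sat[of a b] a by auto
    then show "\<exists>i>N. i \<in> {i. ?acc i j}" using a by (intro exI[of _ i]) auto
  qed
  then show ?thesis
    using start \<rho>(2) unfolding lang_from_def R_def by blast
qed

text \<open>\<open>m2\<close> is the child number after shared states have been removed,
  \<open>m3\<close> the one after renaming; neither operation can increase it. The child survives
  the collapse since \<open>v\<close> is not saturated and, as \<open>v\<close> remains, none of its
  ancestors is.\<close>

lemma host_child_step:
  assumes B: "is_ngba B" and step: "ght_step B d \<sigma> = Some d'" and st: "stable_node B \<sigma> d v"
    and ns: "\<not> saturated (ght_split B \<sigma> d) v" and q: "q \<in> lab d' v"
    and m: "v @ [m] \<in> nodes (ght_split B \<sigma> d)" "q \<in> lab (ght_spawn B \<sigma> d) (v @ [m])"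
  obtains m2 m3 where "m2 \<le> m" "m3 \<le> m2" "v @ [m2] \<in> nodes (ght_remain B \<sigma> d)"
    "rename (nodes (ght_remain B \<sigma> d)) (v @ [m2]) = v @ [m3]"
    "v @ [m3] \<in> nodes d'" "q \<in> lab d' (v @ [m3])"
proof -
  note ght = ght_stepD(1)[OF step]
  let ?M = "ght_remain B \<sigma> d"
  have v: "v \<in> nodes ?M" "rename (nodes ?M) v = v" using st by (auto simp: stable_node_def)
  have "q \<in> lab (ght_split B \<sigma> d) v" using q ght_step_lab(2)[OF B step v(1)] v(2) by simp
  then obtain m2 where m2: "m2 \<le> m" "v @ [m2] \<in> nodes (ght_split B \<sigma> d)"
    "q \<in> lab (ght_split B \<sigma> d) (v @ [m2])"
    using lab_split_host[OF B ght _ m] by blast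
  have "\<not> saturated (ght_split B \<sigma> d) u" if "strict_prefix u (v @ [m2])" for u
  proof (cases "u = v")
    case False
    then have "strict_prefix u v" using that by (auto simp: strict_prefix_def)
    then show ?thesis using v(1) by (auto simp: nodes_remain[OF B ght])
  qed (use ns in simp)
  then have M2: "v @ [m2] \<in> nodes ?M" using m2 by (auto simp: nodes_remain[OF B ght])
  define m3 where "m3 = card {j. j < m2 \<and> v @ [j] \<in> nodes ?M}"
  have r: "rename (nodes ?M) (v @ [m2]) = v @ [m3]" by (simp add: rename_snoc v(2) m3_def)
  have "m3 \<le> m2" unfolding m3_def using card_mono[of "{..<m2}" "{j. j < m2 \<and> v @ [j] \<in> nodes ?M}"] by auto
  then show ?thesis
    using that[of m2 m3] m2 M2 r ght_step_lab(1,2)[OF B step M2] by simp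
qed

lemma stable_child:
  assumes B: "is_ngba B"
    and step: "\<And>i. ght_step B (d i) (w i) = Some (d (Suc i))"
    and run: "\<And>i. (\<rho> i, w i, \<rho> (Suc i)) \<in> ntrans B"
    and acc: "\<And>j. j \<in> {1..nacc_count B} \<Longrightarrow> infinite {i. (\<rho> i, w i, \<rho> (Suc i)) \<in> nacc B j}"
    and v: "\<And>i. n \<le> i \<Longrightarrow> stable_node B (w i) (d i) v \<and> \<rho> i \<in> lab (d i) v"
    and nsat: "\<And>i. n \<le> i \<Longrightarrow> \<not> saturated (ght_split B (w i) (d i)) v"
  shows "\<exists>c n'. \<forall>i\<ge>n'. stable_node B (w i) (d i) (v @ [c]) \<and> \<rho> i \<in> lab (d i) (v @ [c])"
proof -
  note ght = ght_stepD(1)[OF step]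
  \<comment> \<open>Once the run is in a child of \<open>v\<close>, its child number never increases, neither by the removal of
    older siblings' states nor by the renaming; the least number \<open>m\<close> reached is therefore kept.\<close>
  define Q where "Q i m \<longleftrightarrow> v @ [m] \<in> nodes (d i) \<and> \<rho> i \<in> lab (d i) (v @ [m])" for i m
  have idx: "idx (d i) v = idx (d n) v" if "n \<le> i" for i
    using that
  proof (induction rule: dec_induct)
    case (step i)
    then show ?case
      using ght_step_lab(3)[OF B assms(2)[of i], of v] v[of i] nsat[of i] idx_remain[OF B ght[of i], where v = v]
      by (simp add: stable_node_def)
  qed simp
  have vn: "v \<in> nodes (d i)" if "n \<le> i" for i using v[OF that] by (simp add: stable_node_def)
  have "idx (d n) v \<in> {1..nacc_count B}"
    using pre_ght_idx[OF is_ght_imp_pre_ght[OF ght] vn] by simp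
  \<comment> \<open>While \<open>v\<close> is unsaturated its index is constant, so the run
    eventually takes a transition in that very set. The target is then in the spawned child before
    the removal, and from there some child of \<open>v\<close> hosts the run.\<close>
  then obtain i where i: "i \<ge> n" "(\<rho> i, w i, \<rho> (Suc i)) \<in> nacc B (idx (d n) v)"
    using acc by (metis (no_types, lifting) infinite_nat_iff_unbounded_le mem_Collect_eq)
  have "\<rho> (Suc i) \<in> lab (ght_spawn B (w i) (d i)) (v @ [card (children (nodes (d i)) v)])"
    unfolding lab_spawn_new[OF B ght] using i v[OF i(1)] idx[OF i(1)] by (auto simp: post_def)
  moreover have "v @ [card (children (nodes (d i)) v)] \<in> nodes (ght_split B (w i) (d i))"
    using vn[OF i(1)] by (auto simp: nodes_split[OF B ght])
  ultimately have "\<exists>m. Q (Suc i) m"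
    using host_child_step[OF B step[of i] _ nsat[OF i(1)], of "\<rho> (Suc i)"] v[of i] v[of "Suc i"] i(1)
    unfolding Q_def by (metis le_SucI)
  then have "\<exists>m i. n \<le> i \<and> Q i m" using i(1) le_SucI by blast
  then obtain m where m: "\<exists>i. n \<le> i \<and> Q i m" and least: "\<And>m' i. m' < m \<Longrightarrow> n \<le> i \<Longrightarrow> \<not> Q i m'"
    using exists_least_iff[of "\<lambda>m. \<exists>i. n \<le> i \<and> Q i m"] by blast
  have next_Q: "Q (Suc i) m \<and> stable_node B (w i) (d i) (v @ [m])" if i: "n \<le> i" and Q: "Q i m" for i
  proof -
    have "\<rho> (Suc i) \<in> lab (ght_spawn B (w i) (d i)) (v @ [m])"
      using Q run[of i] lab_spawn_old[OF B ght[of i], of "v @ [m]"] by (auto simp: Q_def post_def)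
    moreover have "v @ [m] \<in> nodes (ght_split B (w i) (d i))"
      using Q by (simp add: Q_def nodes_split[OF B ght])
    moreover have "stable_node B (w i) (d i) v" "\<rho> (Suc i) \<in> lab (d (Suc i)) v"
      using v[of i] v[of "Suc i"] i by auto
    ultimately obtain m2 m3 where m23: "m2 \<le> m" "m3 \<le> m2" "v @ [m2] \<in> nodes (ght_remain B (w i) (d i))"
      "rename (nodes (ght_remain B (w i) (d i))) (v @ [m2]) = v @ [m3]" "Q (Suc i) m3"
      using host_child_step[OF B step[of i] _ nsat[OF i], of "\<rho> (Suc i)" m] unfolding Q_def by metis
    \<comment> \<open>Minimality of \<open>m\<close> squeezes \<open>m3 <= m2 <= m\<close> to
      equality: the run stays in this child, and the child keeps its name.\<close>
    then have "m \<le> m3" using least[of m3 "Suc i"] i by (meson le_SucI not_le)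
    then have "m2 = m" "m3 = m" using m23 by auto
    then show ?thesis using m23 Q by (auto simp: stable_node_def Q_def)
  qed
  from m obtain n' where n': "n \<le> n'" "Q n' m" by blast
  have "Q i m" if "n' \<le> i" for i
    using that by (induction rule: dec_induct) (use n' next_Q in auto)
  then show ?thesis using next_Q n'(1) unfolding Q_def by (meson le_trans)
qed

lemma det_complete:
  assumes B: "is_ngba B"
    and step: "\<And>i. ght_step B (d i) (w i) = Some (d (Suc i))"
    and start: "\<rho> 0 \<in> rchd (d 0)"
    and run: "\<And>i. (\<rho> i, w i, \<rho> (Suc i)) \<in> ntrans B"
    and acc: "\<And>j. j \<in> {1..nacc_count B} \<Longrightarrow> infinite {i. (\<rho> i, w i, \<rho> (Suc i)) \<in> nacc B j}"
  obtains v n where "\<And>i. n \<le> i \<Longrightarrow> stable_node B (w i) (d i) v"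
    "\<exists>\<^sub>\<infinity>i. saturated (ght_split B (w i) (d i)) v"
proof -
  note ght = ght_stepD(1)[OF step]
  \<comment> \<open>The node of the accepting pair is the deepest one in which the run stays forever.\<close>
  define P where "P v \<longleftrightarrow> (\<exists>n. \<forall>i\<ge>n. stable_node B (w i) (d i) v \<and> \<rho> i \<in> lab (d i) v)" for v
  have root: "\<rho> i \<in> rchd (d i)" for i
  proof (induction i)
    case (Suc i)
    then show ?case using run[of i] by (auto simp: rchd_ght_step[OF B step] post_def)
  qed (rule start)
  have "stable_node B (w i) (d i) []" for i
    using is_ght_root[OF ght] root_in_remain[OF B step] by (simp add: stable_node_def)
  then have "P []" using root unfolding P_def rchd_def by blast
  \<comment> \<open>Depth is bounded by the number of states of \<open>B\<close>, so a deepest node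
    of this kind exists.\<close>
  moreover have "length v < card (nstates B)" if "P v" for v
    using that ght_node_bounds(1)[OF B ght] by (auto simp: P_def stable_node_def)
  ultimately obtain v where v: "P v" and max: "\<And>u. P u \<Longrightarrow> length u \<le> length v"
    using ex_has_greatest_nat[of P "[]" length "card (nstates B)"] by (meson less_imp_le)
  from v obtain n where n: "\<And>i. n \<le> i \<Longrightarrow> stable_node B (w i) (d i) v \<and> \<rho> i \<in> lab (d i) v"
    unfolding P_def by blast
  have "\<exists>\<^sub>\<infinity>i. saturated (ght_split B (w i) (d i)) v"
  proof (rule ccontr)
    assume "\<not> ?thesis"
    then obtain n' where n': "\<And>i. n' \<le> i \<Longrightarrow> \<not> saturated (ght_split B (w i) (d i)) v"
      unfolding INFM_nat_le by blast
    \<comment> \<open>If \<open>v\<close> were unsaturated from some time on, the run would settle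
      in a child of \<open>v\<close>, against maximal depth.\<close>
    have "\<exists>c n'. \<forall>i\<ge>n'. stable_node B (w i) (d i) (v @ [c]) \<and> \<rho> i \<in> lab (d i) (v @ [c])"
      by (rule stable_child[OF B step run acc, where n = "max n n'"]) (use n n' in auto)
    then obtain c where "P (v @ [c])" unfolding P_def by blast
    then show False using max by fastforce
  qed
  then show ?thesis using that n by blast
qed

section \<open>Existence of the path measure\<close>

definition chain_words :: "('m, 'z) weighted_chain_scheme \<Rightarrow> 'm list set" where
  "chain_words C = {xs. xs \<noteq> [] \<and> set xs \<subseteq> mstates C}"

lemma cylinder_subset: "cylinder C ` chain_words C \<subseteq> Pow (maximal_paths C)"
  by (auto simp: cylinder_def)

lemma path_measure_alt: "path_measure C =
    extend_measure (maximal_paths C) (chain_words C) (cylinder C) (\<lambda>xs. ennreal (path_weight C xs))"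
  by (simp add: path_measure_def chain_words_def)

lemma space_path_measure [simp]: "space (path_measure C) = maximal_paths C"
  by (simp add: path_measure_alt space_extend_measure[OF cylinder_subset])

lemma sets_path_measure:
  "sets (path_measure C) = sigma_sets (maximal_paths C) (cylinder C ` chain_words C)"
  by (simp add: path_measure_alt sets_extend_measure[OF cylinder_subset])

lemma cylinder_in_sets: "xs \<in> chain_words C \<Longrightarrow> cylinder C xs \<in> sets (path_measure C)"
  by (auto simp: sets_path_measure)

lemma cylinder_Int:
  assumes "length xs \<le> length ys"
  shows "cylinder C xs \<inter> cylinder C ys = {} \<or> cylinder C xs \<inter> cylinder C ys = cylinder C ys"
proof (cases "\<forall>i < length xs. xs ! i = ys ! i")
  case True
  then have "cylinder C ys \<subseteq> cylinder C xs" using assms by (auto simp: cylinder_def)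
  then show ?thesis by blast
qed (use assms in \<open>auto simp: cylinder_def\<close>)

text \<open>\<open>extend_measure\<close> is meaningful once some measure has the required values on
  the generators, and \<open>N\<close> is that witness. Equality on all sets follows since cylinders
  are nested or disjoint: together with the empty set they form an intersection-stable generator,
  and finitely many of them, of finite mass, cover the space.\<close>

lemma path_measure_eqI:
  assumes fin: "finite (mstates C)"
    and sets: "sets N = sigma_sets (maximal_paths C) (cylinder C ` chain_words C)"
    and cyl: "\<And>xs. xs \<in> chain_words C \<Longrightarrow> emeasure N (cylinder C xs) = ennreal (path_weight C xs)"
  shows "path_measure C = N"
proof -
  let ?E = "insert {} (cylinder C ` chain_words C)"
  have eq: "emeasure (path_measure C) (cylinder C xs) = ennreal (path_weight C xs)"
    if "xs \<in> chain_words C" for xs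
  proof (rule emeasure_extend_measure[OF path_measure_alt cyl cylinder_subset _ _ that])
    show "positive (sets (path_measure C)) (emeasure N)"
      by (simp add: positive_def)
    show "countably_additive (sets (path_measure C)) (emeasure N)"
      using emeasure_countably_additive[of N] sets by (simp add: sets_path_measure)
  qed
  have sigma: "sigma_sets (maximal_paths C) (cylinder C ` chain_words C) = sigma_sets (maximal_paths C) ?E"
    by (intro sigma_sets_eqI) (auto intro: sigma_sets.Empty)
  show ?thesis
  proof (rule measure_eqI_generator_eq_countable[where E = ?E and A = "(\<lambda>m. cylinder C [m]) ` mstates C"])
    show "Int_stable ?E"
    proof (rule Int_stableI)
      fix a b assume ab: "a \<in> ?E" "b \<in> ?E"
      have "cylinder C xs \<inter> cylinder C ys \<in> ?E" if "xs \<in> chain_words C" "ys \<in> chain_words C" for xs ys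
        using cylinder_Int[of xs ys C] cylinder_Int[of ys xs C] that
        by (cases "length xs \<le> length ys") (auto simp: Int_commute)
      then show "a \<inter> b \<in> ?E" using ab by auto
    qed
    show "?E \<subseteq> Pow (maximal_paths C)" using cylinder_subset by auto
    show "emeasure (path_measure C) X = emeasure N X" if "X \<in> ?E" for X
      using that eq cyl by auto
    show "sets (path_measure C) = sigma_sets (maximal_paths C) ?E"
      "sets N = sigma_sets (maximal_paths C) ?E"
      by (simp_all add: sets_path_measure sets sigma)
    show "(\<lambda>m. cylinder C [m]) ` mstates C \<subseteq> ?E" by (auto simp: chain_words_def)
    show "\<Union> ((\<lambda>m. cylinder C [m]) ` mstates C) = maximal_paths C"
      by (auto simp: cylinder_def maximal_paths_def)
    show "countable ((\<lambda>m. cylinder C [m]) ` mstates C)" using fin by (simp add: countable_finite)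
    show "emeasure (path_measure C) a \<noteq> \<infinity>" if "a \<in> (\<lambda>m. cylinder C [m]) ` mstates C" for a
      using that eq by (auto simp: chain_words_def)
  qed
qed

section \<open>A product space of independent samples that drives the chain\<close>

lemma pmf_embed_finite:
  assumes "finite S" "\<And>m. m \<in> S \<Longrightarrow> 0 \<le> f m" "sum f S = 1"
  shows "pmf (embed_pmf (\<lambda>m. if m \<in> S then f m else 0)) m = (if m \<in> S then f m else (0::real))"
proof (rule pmf_embed_pmf)
  have "(\<integral>\<^sup>+x. ennreal (if x \<in> S then f x else 0) \<partial>count_space UNIV)
      = (\<Sum>x\<in>S. ennreal (if x \<in> S then f x else 0))"
    by (rule nn_integral_count_space') (use assms in auto)
  also have "\<dots> = (\<Sum>x\<in>S. ennreal (f x))" by (intro sum.cong) auto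
  also have "\<dots> = ennreal (sum f S)" using assms by (intro sum_ennreal) auto
  finally show "(\<integral>\<^sup>+x. ennreal (if x \<in> S then f x else 0) \<partial>count_space UNIV) = 1"
    using assms by simp
qed (use assms in auto)

locale finite_chain =
  fixes C :: "('m, 'z) weighted_chain_scheme"
  assumes finite_states: "finite (mstates C)"
    and init_nonneg: "m \<in> mstates C \<Longrightarrow> 0 \<le> minit C m"
    and init_sum: "(\<Sum>m \<in> mstates C. minit C m) = 1"
    and trans_nonneg: "m \<in> mstates C \<Longrightarrow> m' \<in> mstates C \<Longrightarrow> 0 \<le> mtrans C m m'"
    and trans_sum: "m \<in> mstates C \<Longrightarrow> (\<Sum>m' \<in> mstates C. mtrans C m m') \<in> {0, 1}"
begin

definition row :: "'m \<Rightarrow> real" where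
  "row m = (\<Sum>m' \<in> mstates C. mtrans C m m')"

lemma row_1_iff: "m \<in> mstates C \<Longrightarrow> row m = 1 \<longleftrightarrow> (\<exists>m' \<in> mstates C. mtrans C m m' > 0)"
  using trans_sum[of m] sum_nonneg_eq_0_iff[OF finite_states, of "mtrans C m"] trans_nonneg[of m]
  by (fastforce simp: row_def less_le)

text \<open>The chain is driven by independent samples \<^term>\<open>u (n, Some m)\<close> for the state after a visit
  to \<^term>\<open>m\<close> at time \<^term>\<open>n - 1\<close>; \<^term>\<open>u (0, None)\<close> is the initial state.\<close>

definition succ_pmf :: "'m option \<Rightarrow> 'm pmf" where
  "succ_pmf s = (case s of
     None \<Rightarrow> embed_pmf (\<lambda>m. if m \<in> mstates C then minit C m else 0)
   | Some m \<Rightarrow> if m \<in> mstates C \<and> row m = 1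
       then embed_pmf (\<lambda>m'. if m' \<in> mstates C then mtrans C m m' else 0) else return_pmf m)"

text \<open>Samples outside the support have probability 0 but exist as points of the space.
  Replacing them makes every driven path maximal, not only almost every one.\<close>

definition pick :: "'m option \<Rightarrow> 'm \<Rightarrow> 'm" where
  "pick s y = (if y \<in> set_pmf (succ_pmf s) then y else SOME y. y \<in> set_pmf (succ_pmf s))"

primrec driven_path :: "(nat \<times> 'm option \<Rightarrow> 'm) \<Rightarrow> nat \<Rightarrow> 'm option" where
  "driven_path u 0 = Some (pick None (u (0, None)))"
| "driven_path u (Suc n) = (case driven_path u n of
     None \<Rightarrow> None
   | Some m \<Rightarrow> if row m = 1 then Some (pick (Some m) (u (Suc n, Some m))) else None)"

lemma pmf_succ_None: "pmf (succ_pmf None) m = (if m \<in> mstates C then minit C m else 0)"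
  using pmf_embed_finite[OF finite_states init_nonneg init_sum] by (simp add: succ_pmf_def)

lemma pmf_succ_Some:
  assumes "m \<in> mstates C" "row m = 1"
  shows "pmf (succ_pmf (Some m)) m' = (if m' \<in> mstates C then mtrans C m m' else 0)"
  using pmf_embed_finite[OF finite_states, of "mtrans C m" m'] trans_nonneg[OF assms(1)] assms
  by (simp add: succ_pmf_def row_def)

lemma pick_in_set: "pick s y \<in> set_pmf (succ_pmf s)"
  unfolding pick_def by (simp add: some_in_eq set_pmf_not_empty)

lemma emeasure_pick: "emeasure (measure_pmf (succ_pmf s)) {y. pick s y = x} = ennreal (pmf (succ_pmf s) x)"
proof -
  have "AE y in measure_pmf (succ_pmf s). y \<in> {y. pick s y = x} \<longleftrightarrow> y \<in> {x}"
    by (rule AE_pmfI) (simp add: pick_def)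
  then have "emeasure (measure_pmf (succ_pmf s)) {y. pick s y = x} = emeasure (measure_pmf (succ_pmf s)) {x}"
    by (intro emeasure_eq_AE) auto
  then show ?thesis by (simp add: emeasure_pmf_single)
qed

lemma pick_None: "pick None y \<in> mstates C"
  using pick_in_set[of None y] pmf_succ_None by (auto simp: set_pmf_iff split: if_splits)

lemma pick_Some:
  assumes "m \<in> mstates C" "row m = 1"
  shows "pick (Some m) y \<in> mstates C" "mtrans C m (pick (Some m) y) > 0"
  using pick_in_set[of "Some m" y] pmf_succ_Some[OF assms] trans_nonneg[OF assms(1)]
  by (auto simp: set_pmf_iff less_le split: if_splits)

lemma driven_path_state: "driven_path u n = Some m \<Longrightarrow> m \<in> mstates C"
proof (induction n arbitrary: m)
  case (Suc n)
  then show ?case using pick_Some(1) by (auto split: option.splits if_splits)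
qed (use pick_None in auto)

lemma driven_path_maximal: "driven_path u \<in> maximal_paths C"
proof -
  have "case driven_path u i of
      None \<Rightarrow> driven_path u (Suc i) = None
    | Some m \<Rightarrow> (case driven_path u (Suc i) of
          None \<Rightarrow> \<forall>m' \<in> mstates C. mtrans C m m' = 0
        | Some m' \<Rightarrow> m' \<in> mstates C \<and> mtrans C m m' > 0)" for i
  proof (cases "driven_path u i")
    case (Some m)
    then have m: "m \<in> mstates C" by (rule driven_path_state)
    show ?thesis
    proof (cases "row m = 1")
      case True
      then show ?thesis using Some pick_Some[OF m True] by simp
    next
      case False
      then have "\<forall>m' \<in> mstates C. mtrans C m m' = 0"
        using row_1_iff[OF m] trans_nonneg[OF m] by (auto simp: less_le)
      then show ?thesis using Some False by simp
    qed
  qed simp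
  moreover have "\<exists>m \<in> mstates C. driven_path u 0 = Some m" using pick_None by simp
  ultimately show ?thesis by (simp only: maximal_paths_def mem_Collect_eq) blast
qed

text \<open>The sample that decides position \<open>k\<close> of a path along \<open>xs\<close> has
  the index \<open>(k, before xs k)\<close>.\<close>

definition before :: "'m list \<Rightarrow> nat \<Rightarrow> 'm option" where
  "before xs k = (if k = 0 then None else Some (xs ! (k - 1)))"

text \<open>Following \<open>xs\<close> becomes a family of conditions on pairwise different
  coordinates of \<open>u\<close>, which are independent under the product measure, plus the
  deterministic condition that no state before the last is a dead end.\<close>

lemma driven_path_prefix:
  "(\<forall>i<l. driven_path u i = Some (xs ! i)) \<longleftrightarrow>
     (\<forall>k<l. pick (before xs k) (u (k, before xs k)) = xs ! k) \<and> (\<forall>k. Suc k < l \<longrightarrow> row (xs ! k) = 1)"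
proof (induction l)
  case (Suc l)
  have "(\<forall>i<Suc l. driven_path u i = Some (xs ! i)) \<longleftrightarrow>
    (\<forall>i<l. driven_path u i = Some (xs ! i)) \<and> driven_path u l = Some (xs ! l)"
    by (auto simp: less_Suc_eq)
  moreover have "driven_path u l = Some (xs ! l) \<longleftrightarrow>
      pick (before xs l) (u (l, before xs l)) = xs ! l \<and> (l \<noteq> 0 \<longrightarrow> row (xs ! (l - 1)) = 1)"
    if "\<forall>i<l. driven_path u i = Some (xs ! i)"
    using that by (cases l) (auto simp: before_def)
  moreover have "(\<forall>k. Suc k < Suc l \<longrightarrow> row (xs ! k) = 1) \<longleftrightarrow>
      (\<forall>k. Suc k < l \<longrightarrow> row (xs ! k) = 1) \<and> (l \<noteq> 0 \<longrightarrow> row (xs ! (l - 1)) = 1)"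
    by (cases l) (auto simp: less_Suc_eq)
  ultimately show ?case using Suc.IH by (auto simp: less_Suc_eq)
qed simp

definition driver :: "(nat \<times> 'm option \<Rightarrow> 'm) measure" where
  "driver = PiM UNIV (\<lambda>i. measure_pmf (succ_pmf (snd i)))"

lemma space_driver [simp]: "space driver = UNIV"
  by (simp add: driver_def space_PiM PiE_def)

lemma driver_cylinder:
  assumes xs: "xs \<in> chain_words C"
  shows "{u. driven_path u \<in> cylinder C xs} \<in> sets driver"
    and "emeasure driver {u. driven_path u \<in> cylinder C xs} = ennreal (path_weight C xs)"
proof -
  interpret product_prob_space "\<lambda>i. measure_pmf (succ_pmf (snd i))" UNIV
    by unfold_locales
  obtain l where l: "length xs = Suc l" using xs by (cases xs) (auto simp: chain_words_def)
  have st: "xs ! k \<in> mstates C" if "k \<le> l" for k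
    using xs that l by (auto simp: chain_words_def subset_iff)
  let ?rows = "\<forall>k<l. row (xs ! k) = 1"
  let ?J = "(\<lambda>k. (k, before xs k)) ` {..l}"
  let ?X = "\<lambda>j. {y. pick (snd j) y = xs ! fst j}"
  have eq: "{u. driven_path u \<in> cylinder C xs} = (if ?rows then {u \<in> space driver. \<forall>j \<in> ?J. u j \<in> ?X j} else {})"
    using driven_path_prefix[of "Suc l" _ xs] l driven_path_maximal
    by (auto simp: cylinder_def less_Suc_eq_le)
  have "{u \<in> space driver. \<forall>j \<in> ?J. u j \<in> ?X j} \<in> sets driver"
    unfolding driver_def by (intro sets.sets_Collect_finite_All sets_Collect_single) auto
  then show "{u. driven_path u \<in> cylinder C xs} \<in> sets driver"
    unfolding eq by simp
  show "emeasure driver {u. driven_path u \<in> cylinder C xs} = ennreal (path_weight C xs)"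
  proof (cases ?rows)
    case False
    then obtain k where k: "k < l" "row (xs ! k) \<noteq> 1" by blast
    \<comment> \<open>A word that goes on after a dead end has weight 0, in agreement with the empty
      event.\<close>
    then have "mtrans C (xs ! k) (xs ! Suc k) = 0"
      using row_1_iff[OF st, of k] st[of "Suc k"] trans_nonneg[OF st st, of k "Suc k"]
      by (auto simp: less_le)
    then have "path_weight C xs = 0"
      using k(1) l by (auto simp: path_weight_def)
    then show ?thesis unfolding eq if_not_P[OF False] by simp
  next
    case True
    have "emeasure driver {u \<in> space driver. \<forall>j \<in> ?J. u j \<in> ?X j} =
        (\<Prod>j\<in>?J. emeasure (measure_pmf (succ_pmf (snd j))) (?X j))"
      unfolding driver_def by (rule emeasure_PiM_Collect) auto
    \<comment> \<open>The time component keeps the coordinates apart even when a state repeats in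
      \<open>xs\<close>.\<close>
    also have "\<dots> = (\<Prod>k\<le>l. emeasure (measure_pmf (succ_pmf (before xs k))) {y. pick (before xs k) y = xs ! k})"
      by (subst prod.reindex) (auto simp: inj_on_def)
    also have "\<dots> = (\<Prod>k\<le>l. ennreal (pmf (succ_pmf (before xs k)) (xs ! k)))"
      by (simp add: emeasure_pick)
    also have "\<dots> = ennreal (\<Prod>k\<le>l. pmf (succ_pmf (before xs k)) (xs ! k))"
      by (rule prod_ennreal) simp
    also have "(\<Prod>k\<le>l. pmf (succ_pmf (before xs k)) (xs ! k)) =
        pmf (succ_pmf None) (xs ! 0) * (\<Prod>k<l. pmf (succ_pmf (Some (xs ! k))) (xs ! Suc k))"
      unfolding prod.atMost_shift by (simp add: before_def)
    also have "\<dots> = path_weight C xs"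
      unfolding path_weight_def l using pmf_succ_None st True
      by (auto intro!: prod.cong simp: pmf_succ_Some)
    finally show ?thesis unfolding eq using True by simp
  qed
qed

lemma driven_path_measurable:
  "driven_path \<in> driver \<rightarrow>\<^sub>M sigma (maximal_paths C) (cylinder C ` chain_words C)"
  by (rule measurable_measure_of)
    (use cylinder_subset driven_path_maximal driver_cylinder(1) in \<open>auto simp: vimage_def\<close>)

lemma path_measure_eq_distr:
  "path_measure C = distr driver (sigma (maximal_paths C) (cylinder C ` chain_words C)) driven_path"
proof (rule path_measure_eqI[OF finite_states])
  let ?N = "sigma (maximal_paths C) (cylinder C ` chain_words C)"
  show sets: "sets (distr driver ?N driven_path) = sigma_sets (maximal_paths C) (cylinder C ` chain_words C)"
    by (simp add: sets_measure_of[OF cylinder_subset])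
  show "emeasure (distr driver ?N driven_path) (cylinder C xs) = ennreal (path_weight C xs)"
    if "xs \<in> chain_words C" for xs
    using driver_cylinder(2)[OF that] that cylinder_subset driven_path_measurable
    by (subst emeasure_distr) (auto simp: vimage_def)
qed

sublocale prob_space "path_measure C"
proof -
  interpret D: product_prob_space "\<lambda>i. measure_pmf (succ_pmf (snd i))" "UNIV :: (nat \<times> 'm option) set"
    by unfold_locales
  have "prob_space driver" unfolding driver_def by (rule D.prob_space_axioms)
  then show "prob_space (path_measure C)"
    unfolding path_measure_eq_distr by (rule prob_space.prob_space_distr[OF _ driven_path_measurable])
qed

lemma emeasure_cylinder:
  assumes "xs \<in> chain_words C"
  shows "emeasure (path_measure C) (cylinder C xs) = ennreal (path_weight C xs)"
  unfolding path_measure_eq_distr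
  using driver_cylinder(2)[OF assms] assms cylinder_subset driven_path_measurable
  by (subst emeasure_distr) (auto simp: vimage_def)

lemma path_weight_nonneg:
  assumes "xs \<in> chain_words C"
  shows "0 \<le> path_weight C xs"
proof -
  have "xs ! i \<in> mstates C" if "i < length xs" for i
    using assms that by (auto simp: chain_words_def subset_iff)
  then show ?thesis
    using assms unfolding path_weight_def
    by (intro mult_nonneg_nonneg prod_nonneg ballI trans_nonneg init_nonneg) (auto simp: chain_words_def)
qed

lemma measure_cylinder: "xs \<in> chain_words C \<Longrightarrow> prob (cylinder C xs) = path_weight C xs"
  using emeasure_cylinder path_weight_nonneg by (simp add: measure_def)

end

section \<open>Recurrence\<close>

lemma maximal_pathsD:
  assumes "\<omega> \<in> maximal_paths C"
  shows "\<omega> 0 \<noteq> None"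
    and "\<omega> i = None \<Longrightarrow> \<omega> (Suc i) = None"
    and "\<omega> i = Some m \<Longrightarrow> m \<in> mstates C"
    and "\<omega> i = Some m \<Longrightarrow> \<omega> (Suc i) = Some m' \<Longrightarrow> mtrans C m m' > 0"
    and "\<omega> i = Some m \<Longrightarrow> \<omega> (Suc i) = None \<Longrightarrow> m' \<in> mstates C \<Longrightarrow> mtrans C m m' = 0"
proof -
  have 0: "\<exists>m \<in> mstates C. \<omega> 0 = Some m"
    and s: "case \<omega> i of None \<Rightarrow> \<omega> (Suc i) = None
      | Some m \<Rightarrow> (case \<omega> (Suc i) of None \<Rightarrow> \<forall>m' \<in> mstates C. mtrans C m m' = 0
          | Some m' \<Rightarrow> m' \<in> mstates C \<and> mtrans C m m' > 0)" for i
    using assms unfolding maximal_paths_def by blast+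
  show "\<omega> 0 \<noteq> None" using 0 by auto
  show "\<omega> i = None \<Longrightarrow> \<omega> (Suc i) = None" using s[of i] by simp
  show "\<omega> i = Some m \<Longrightarrow> m \<in> mstates C"
  proof (cases i)
    case (Suc j)
    then show "\<omega> i = Some m \<Longrightarrow> m \<in> mstates C" using s[of j] by (auto split: option.splits)
  qed (use 0 in auto)
  show "\<omega> i = Some m \<Longrightarrow> \<omega> (Suc i) = Some m' \<Longrightarrow> mtrans C m m' > 0"
    and "\<omega> i = Some m \<Longrightarrow> \<omega> (Suc i) = None \<Longrightarrow> m' \<in> mstates C \<Longrightarrow> mtrans C m m' = 0"
    using s[of i] by auto
qed

section \<open>Measurability of events that depend on finitely many positions\<close>

lemma path_event: "Measurable.pred (path_measure C) P \<Longrightarrow> {\<omega> \<in> maximal_paths C. P \<omega>} \<in> sets (path_measure C)"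
  unfolding pred_def space_path_measure .

lemma maximal_path_None_mono:
  assumes "\<omega> \<in> maximal_paths C" "\<omega> i = None" "i \<le> j"
  shows "\<omega> j = None"
  using assms(3,2) by (induction rule: dec_induct) (auto dest: maximal_pathsD(2)[OF assms(1)])

lemma state_event:
  assumes "finite (mstates C)"
  shows "{\<omega> \<in> maximal_paths C. \<omega> i = s} \<in> sets (path_measure C)"
proof -
  have some: "{\<omega> \<in> maximal_paths C. \<omega> i = Some m} \<in> sets (path_measure C)" for m
  proof -
    let ?X = "{xs. set xs \<subseteq> mstates C \<and> length xs = Suc i \<and> xs ! i = m}"
    have "finite ?X"
      by (rule finite_subset[OF _ finite_lists_length_eq[OF assms, of "Suc i"]]) auto
    moreover have "cylinder C xs \<in> sets (path_measure C)" if "xs \<in> ?X" for xs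
      using that by (intro cylinder_in_sets) (auto simp: chain_words_def)
    moreover have "{\<omega> \<in> maximal_paths C. \<omega> i = Some m} = (\<Union>xs \<in> ?X. cylinder C xs)"
    proof
      show "(\<Union>xs \<in> ?X. cylinder C xs) \<subseteq> {\<omega> \<in> maximal_paths C. \<omega> i = Some m}"
        by (auto simp: cylinder_def)
      show "{\<omega> \<in> maximal_paths C. \<omega> i = Some m} \<subseteq> (\<Union>xs \<in> ?X. cylinder C xs)"
      proof
        fix \<omega> assume "\<omega> \<in> {\<omega> \<in> maximal_paths C. \<omega> i = Some m}"
        then have \<omega>: "\<omega> \<in> maximal_paths C" "\<omega> i = Some m" by auto
        let ?xs = "map (\<lambda>j. the (\<omega> j)) [0..<Suc i]"
        have *: "\<omega> j = Some (the (\<omega> j))" if "j \<le> i" for j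
          using maximal_path_None_mono[OF \<omega>(1) _ that] \<omega>(2) by (cases "\<omega> j") auto
        have "the (\<omega> j) \<in> mstates C" if "j \<le> i" for j
          using maximal_pathsD(3)[OF \<omega>(1) *[OF that]] .
        then have "?xs \<in> ?X" using \<omega>(2) by (auto simp del: upt_Suc simp: nth_append less_Suc_eq_le)
        moreover have "\<omega> \<in> cylinder C ?xs"
          using \<omega>(1) * by (auto simp: cylinder_def less_Suc_eq_le simp del: upt_Suc)
        ultimately show "\<omega> \<in> (\<Union>xs \<in> ?X. cylinder C xs)" by blast
      qed
    qed
    ultimately show ?thesis by (metis (no_types, lifting) sets.finite_UN)
  qed
  show ?thesis
  proof (cases s)
    case None
    have "\<omega> i = None \<longleftrightarrow> (\<forall>m \<in> mstates C. \<omega> i \<noteq> Some m)" if "\<omega> \<in> maximal_paths C" for \<omega>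
      using maximal_pathsD(3)[OF that, of i] by (cases "\<omega> i") auto
    then have "{\<omega> \<in> maximal_paths C. \<omega> i = None} =
        space (path_measure C) - (\<Union>m \<in> mstates C. {\<omega> \<in> maximal_paths C. \<omega> i = Some m})"
      unfolding space_path_measure by blast
    moreover have "(\<Union>m \<in> mstates C. {\<omega> \<in> maximal_paths C. \<omega> i = Some m}) \<in> sets (path_measure C)"
      using assms some by (rule sets.finite_UN)
    ultimately show ?thesis
      unfolding None by (simp only: sets.compl_sets)
  qed (use some in auto)
qed


text \<open>There are finitely many states, so such an event is a finite union of events fixing the
  first \<open>n\<close> entries. Locality is required for all functions, because the representative
  \<open>?f os\<close> of a prefix need not be a maximal path.\<close>

lemma local_pred:
  assumes fin: "finite (mstates C)"
    and local: "\<And>\<omega> \<omega>'. (\<And>i. i < n \<Longrightarrow> \<omega> i = \<omega>' i) \<Longrightarrow> P \<omega> = P \<omega>'"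
  shows "Measurable.pred (path_measure C) P"
proof -
  let ?O = "{os. set os \<subseteq> insert None (Some ` mstates C) \<and> length os = n}"
  let ?E = "\<lambda>os. {\<omega> \<in> maximal_paths C. \<forall>i\<in>{..<n}. \<omega> i = os ! i}"
  let ?f = "\<lambda>os i. if i < n then os ! i else None"
  have "finite {os \<in> ?O. P (?f os)}"
    by (rule finite_subset[OF _ finite_lists_length_eq[of "insert None (Some ` mstates C)" n]])
      (use fin in auto)
  moreover have "?E os \<in> sets (path_measure C)" for os :: "'a option list"
  proof -
    have "{\<omega> \<in> space (path_measure C). \<forall>i\<in>{..<n}. \<omega> i = os ! i} \<in> sets (path_measure C)"
      by (intro sets.sets_Collect_finite_All) (use state_event[OF fin] in auto)
    then show ?thesis unfolding space_path_measure .
  qed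
  moreover have "{\<omega> \<in> maximal_paths C. P \<omega>} = (\<Union>os \<in> {os \<in> ?O. P (?f os)}. ?E os)"
  proof
    show "{\<omega> \<in> maximal_paths C. P \<omega>} \<subseteq> (\<Union>os \<in> {os \<in> ?O. P (?f os)}. ?E os)"
    proof
      fix \<omega> assume "\<omega> \<in> {\<omega> \<in> maximal_paths C. P \<omega>}"
      then have \<omega>: "\<omega> \<in> maximal_paths C" "P \<omega>" by auto
      have "\<omega> i \<in> insert None (Some ` mstates C)" for i
        using maximal_pathsD(3)[OF \<omega>(1), of i] by (cases "\<omega> i") auto
      then have "map \<omega> [0..<n] \<in> ?O" by auto
      moreover have "P (?f (map \<omega> [0..<n]))"
        using \<omega>(2) local[of "?f (map \<omega> [0..<n])" \<omega>] by simp
      ultimately show "\<omega> \<in> (\<Union>os \<in> {os \<in> ?O. P (?f os)}. ?E os)"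
        using \<omega>(1) by (intro UN_I[of "map \<omega> [0..<n]"]) auto
    qed
    show "(\<Union>os \<in> {os \<in> ?O. P (?f os)}. ?E os) \<subseteq> {\<omega> \<in> maximal_paths C. P \<omega>}"
    proof
      fix \<omega> assume "\<omega> \<in> (\<Union>os \<in> {os \<in> ?O. P (?f os)}. ?E os)"
      then obtain os where os: "P (?f os)" "\<omega> \<in> maximal_paths C" "\<forall>i\<in>{..<n}. \<omega> i = os ! i" by blast
      then show "\<omega> \<in> {\<omega> \<in> maximal_paths C. P \<omega>}" using local[of "?f os" \<omega>] by simp
    qed
  qed
  ultimately show ?thesis
    unfolding pred_def space_path_measure by (simp only: sets.finite_UN)
qed

lemma path_weight_snoc:
  assumes "xs \<noteq> []"
  shows "path_weight C (xs @ [s]) = path_weight C xs * mtrans C (last xs) s"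
proof -
  obtain l where l: "length xs = Suc l" using assms by (cases xs) auto
  have "(\<Prod>i<l. mtrans C ((xs @ [s]) ! i) ((xs @ [s]) ! Suc i)) = (\<Prod>i<l. mtrans C (xs ! i) (xs ! Suc i))"
    by (intro prod.cong) (auto simp: nth_append l)
  then show ?thesis
    using assms l by (simp add: path_weight_def nth_append last_conv_nth)
qed

text \<open>The history up to and including time \<open>n\<close>. An arbitrary predicate on it will
  stand for the state of an observing automaton, which keeps the recurrence argument free of
  automata.\<close>

definition pre :: "(nat \<Rightarrow> 'm option) \<Rightarrow> nat \<Rightarrow> 'm list" where
  "pre \<omega> n = map (\<lambda>i. the (\<omega> i)) [0..<Suc n]"

lemma pre_cong: "(\<And>i. i \<le> n \<Longrightarrow> \<omega> i = \<omega>' i) \<Longrightarrow> pre \<omega> n = pre \<omega>' n"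
  by (simp add: pre_def del: upt_Suc)

lemma pre_cylinder: "\<omega> \<in> cylinder C xs \<Longrightarrow> length xs = Suc l \<Longrightarrow> pre \<omega> l = xs"
  by (rule nth_equalityI) (auto simp: pre_def cylinder_def simp del: upt_Suc)

context finite_chain
begin

section \<open>Repeated failure of a possible transition\<close>

lemma row_le_1: "m \<in> mstates C \<Longrightarrow> (\<Sum>s \<in> mstates C. mtrans C m s) \<le> 1"
  using trans_sum by force

context
  fixes A :: "'m list \<Rightarrow> bool" and m m' :: 'm
  assumes m: "m \<in> mstates C" "m' \<in> mstates C" and pos: "mtrans C m m' > 0"
begin

definition hit :: "(nat \<Rightarrow> 'm option) \<Rightarrow> nat \<Rightarrow> bool" where
  "hit \<omega> n \<longleftrightarrow> \<omega> n = Some m \<and> A (pre \<omega> n)"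

text \<open>The window of times is bounded so that the event depends on finitely many positions and
  can be estimated by induction on its length, with a bound that does not depend on that
  length.\<close>

definition missed :: "nat \<Rightarrow> nat \<Rightarrow> nat \<Rightarrow> (nat \<Rightarrow> 'm option) set" where
  "missed l t k = {\<omega> \<in> maximal_paths C. k \<le> card {n \<in> {l..<l + t}. hit \<omega> n} \<and>
     (\<forall>n \<in> {l..<l + t}. hit \<omega> n \<longrightarrow> \<omega> (Suc n) \<noteq> Some m')}"

lemma hit_cong: "(\<And>i. i \<le> n \<Longrightarrow> \<omega> i = \<omega>' i) \<Longrightarrow> hit \<omega> n = hit \<omega>' n"
  using pre_cong[of n \<omega> \<omega>'] by (simp add: hit_def)

lemma hit_measurable [measurable]: "Measurable.pred (path_measure C) (\<lambda>\<omega>. hit \<omega> n)"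
  by (rule local_pred[OF finite_states, of "Suc n"]) (rule hit_cong, simp)

lemma success_measurable [measurable]: "Measurable.pred (path_measure C) (\<lambda>\<omega>. \<omega> n = s)"
  by (rule local_pred[OF finite_states, of "Suc n"]) auto

lemma missed_in_sets: "missed l t k \<in> sets (path_measure C)"
proof -
  have "Measurable.pred (path_measure C) (\<lambda>\<omega>. k \<le> card {n \<in> {l..<l + t}. hit \<omega> n} \<and>
      (\<forall>n \<in> {l..<l + t}. hit \<omega> n \<longrightarrow> \<omega> (Suc n) \<noteq> Some m'))"
  proof (rule local_pred[OF finite_states, of "l + t + 1"])
    fix \<omega> \<omega>' :: "nat \<Rightarrow> 'm option" assume eq: "\<And>i. i < l + t + 1 \<Longrightarrow> \<omega> i = \<omega>' i"
    then have "hit \<omega> n = hit \<omega>' n \<and> \<omega> (Suc n) = \<omega>' (Suc n)" if "n \<in> {l..<l + t}" for n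
      using that hit_cong[of n \<omega> \<omega>'] by simp
    then show "(k \<le> card {n \<in> {l..<l + t}. hit \<omega> n} \<and> (\<forall>n \<in> {l..<l + t}. hit \<omega> n \<longrightarrow> \<omega> (Suc n) \<noteq> Some m')) =
      (k \<le> card {n \<in> {l..<l + t}. hit \<omega>' n} \<and> (\<forall>n \<in> {l..<l + t}. hit \<omega>' n \<longrightarrow> \<omega>' (Suc n) \<noteq> Some m'))"
      by (metis (mono_tags, lifting) Collect_cong)
  qed
  then show ?thesis unfolding missed_def by (rule path_event)
qed

lemma miss_prob_le_1: "0 \<le> 1 - mtrans C m m'" and miss_prob_less: "1 - mtrans C m m' < 1"
  using row_le_1[OF m(1)] member_le_sum[OF m(2), of "mtrans C m"] trans_nonneg[OF m(1)] finite_states pos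
  by force+

text \<open>The induction is on the number of remaining steps: extending \<^term>\<open>xs\<close> by one state either
  leaves \<^term>\<open>k\<close> unchanged or uses up one of the \<^term>\<open>k\<close> hits at the price of the factor
  \<^term>\<open>1 - mtrans C m m'\<close>.\<close>

lemma prob_missed_cylinder:
  assumes "xs \<in> chain_words C" "length xs = Suc l"
  shows "prob (cylinder C xs \<inter> missed l t k) \<le> (1 - mtrans C m m') ^ k * path_weight C xs"
  using assms
proof (induction t arbitrary: xs l k)
  case 0
  show ?case
  proof (cases k)
    case 0
    then show ?thesis
      using finite_measure_mono[OF Int_lower1 cylinder_in_sets[OF "0.prems"(1)]] measure_cylinder[OF "0.prems"(1)]
      by simp
  next
    case (Suc k')
    then have "missed l 0 k = {}" by (simp add: missed_def)
    then show ?thesis using path_weight_nonneg[OF "0.prems"(1)] miss_prob_le_1 by simp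
  qed
next
  case (Suc t)
  note xs = Suc.prems(1) and len = Suc.prems(2)
  have ne: "xs \<noteq> []" and last: "last xs = xs ! l" "last xs \<in> mstates C"
    using xs len last_in_set[of xs] by (auto simp: chain_words_def last_conv_nth)
  show ?case
  proof (cases k)
    case 0
    then show ?thesis
      using finite_measure_mono[OF Int_lower1 cylinder_in_sets[OF xs]] measure_cylinder[OF xs] by simp
  next
    case (Suc k')
    \<comment> \<open>Whether time \<open>l\<close> is a hit depends on \<open>xs\<close> alone. If
      it is, \<open>m'\<close> is excluded as next state and one of the required hits is
      spent.\<close>
    define h where "h \<longleftrightarrow> last xs = m \<and> A xs"
    define S' where "S' = (if h then mstates C - {m'} else mstates C)"
    define k'' where "k'' = (if h then k' else k)"
    have S': "finite S'" "S' \<subseteq> mstates C" using finite_states by (auto simp: S'_def)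
    have words: "xs @ [s] \<in> chain_words C" if "s \<in> S'" for s
      using xs that S' by (auto simp: chain_words_def)
    have "cylinder C xs \<inter> missed l (Suc t) k \<subseteq> (\<Union>s\<in>S'. cylinder C (xs @ [s]) \<inter> missed (Suc l) t k'')"
    proof
      fix \<omega> assume \<omega>: "\<omega> \<in> cylinder C xs \<inter> missed l (Suc t) k"
      then have max: "\<omega> \<in> maximal_paths C" by (simp add: cylinder_def)
      have \<omega>l: "\<omega> l = Some (last xs)" using \<omega> len last by (simp add: cylinder_def)
      have hit: "hit \<omega> l \<longleftrightarrow> h" using \<omega>l pre_cylinder[of \<omega> C xs l] \<omega> len by (simp add: hit_def h_def)
      have ins: "{l..<l + Suc t} = insert l {Suc l..<Suc l + t}" by auto
      have "{n \<in> {l..<l + Suc t}. hit \<omega> n} =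
          (if h then insert l {n \<in> {Suc l..<Suc l + t}. hit \<omega> n} else {n \<in> {Suc l..<Suc l + t}. hit \<omega> n})"
        using hit unfolding ins by auto
      then have "card {n \<in> {l..<l + Suc t}. hit \<omega> n} =
          (if h then 1 else 0) + card {n \<in> {Suc l..<Suc l + t}. hit \<omega> n}"
        by simp
      then have k'': "k'' \<le> card {n \<in> {Suc l..<Suc l + t}. hit \<omega> n}" and
        miss: "\<forall>n \<in> {Suc l..<Suc l + t}. hit \<omega> n \<longrightarrow> \<omega> (Suc n) \<noteq> Some m'" and
        missl: "h \<longrightarrow> \<omega> (Suc l) \<noteq> Some m'"
        using \<omega> hit Suc by (auto simp: missed_def k''_def)
      \<comment> \<open>A path ending here has no further hits, so the only one required must be at
        \<open>l\<close>; but then the state is \<open>m\<close>, which has the successor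
        \<open>m'\<close>.\<close>
      have "\<omega> (Suc l) \<noteq> None"
      proof
        assume None: "\<omega> (Suc l) = None"
        have no_hits: "{n \<in> {Suc l..<Suc l + t}. hit \<omega> n} = {}"
          using maximal_path_None_mono[OF max None] by (auto simp: hit_def)
        have "k'' = 0" using k'' unfolding no_hits by simp
        then have h using Suc by (simp add: k''_def split: if_splits)
        then show False using maximal_pathsD(5)[OF max \<omega>l None m(2)] pos by (simp add: h_def)
      qed
      then obtain s where s: "\<omega> (Suc l) = Some s" by blast
      then have "s \<in> S'" using maximal_pathsD(3)[OF max s] missl by (auto simp: S'_def)
      moreover have "\<omega> \<in> cylinder C (xs @ [s])"
        using \<omega> s len by (auto simp: cylinder_def nth_append less_Suc_eq)
      moreover have "\<omega> \<in> missed (Suc l) t k''" using k'' miss max by (auto simp: missed_def)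
      ultimately show "\<omega> \<in> (\<Union>s\<in>S'. cylinder C (xs @ [s]) \<inter> missed (Suc l) t k'')" by blast
    qed
    moreover have meas: "cylinder C (xs @ [s]) \<inter> missed (Suc l) t k'' \<in> events" if "s \<in> S'" for s
      by (intro sets.Int cylinder_in_sets words missed_in_sets that)
    ultimately have "prob (cylinder C xs \<inter> missed l (Suc t) k) \<le> prob (\<Union>s\<in>S'. cylinder C (xs @ [s]) \<inter> missed (Suc l) t k'')"
      using S'(1) by (intro finite_measure_mono sets.finite_UN)
    also have "\<dots> \<le> (\<Sum>s\<in>S'. prob (cylinder C (xs @ [s]) \<inter> missed (Suc l) t k''))"
      using S'(1) meas by (intro finite_measure_subadditive_finite image_subsetI)
    also have "\<dots> \<le> (\<Sum>s\<in>S'. (1 - mtrans C m m') ^ k'' * path_weight C (xs @ [s]))"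
      using Suc.IH words len by (intro sum_mono) auto
    also have "\<dots> = (1 - mtrans C m m') ^ k'' * path_weight C xs * (\<Sum>s\<in>S'. mtrans C (last xs) s)"
      using ne by (simp add: path_weight_snoc sum_distrib_left mult.assoc)
    also have "\<dots> \<le> (1 - mtrans C m m') ^ k'' * path_weight C xs * (if h then 1 - mtrans C m m' else 1)"
    proof (intro mult_left_mono mult_nonneg_nonneg zero_le_power miss_prob_le_1 path_weight_nonneg[OF xs])
      show "(\<Sum>s\<in>S'. mtrans C (last xs) s) \<le> (if h then 1 - mtrans C m m' else 1)"
        using row_le_1[OF last(2)] sum_diff1[OF finite_states, of "mtrans C m" m'] m(2)
        by (auto simp: S'_def h_def)
    qed
    also have "\<dots> = (1 - mtrans C m m') ^ k * path_weight C xs"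
      using Suc by (simp add: k''_def)
    finally show ?thesis .
  qed
qed

lemma prob_missed: "prob (missed 0 t k) \<le> (1 - mtrans C m m') ^ k"
proof -
  have words: "[s] \<in> chain_words C" if "s \<in> mstates C" for s
    using that by (simp add: chain_words_def)
  have "missed 0 t k = (\<Union>s\<in>mstates C. cylinder C [s] \<inter> missed 0 t k)"
  proof
    show "missed 0 t k \<subseteq> (\<Union>s\<in>mstates C. cylinder C [s] \<inter> missed 0 t k)"
    proof
      fix \<omega> assume \<omega>: "\<omega> \<in> missed 0 t k"
      then have max: "\<omega> \<in> maximal_paths C" by (simp add: missed_def)
      then obtain s where s: "\<omega> 0 = Some s" using maximal_pathsD(1) by blast
      then have "\<omega> \<in> cylinder C [s]" using max by (simp add: cylinder_def)
      then show "\<omega> \<in> (\<Union>s\<in>mstates C. cylinder C [s] \<inter> missed 0 t k)"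
        using \<omega> maximal_pathsD(3)[OF max s] by blast
    qed
  qed blast
  moreover have "prob (\<Union>s\<in>mstates C. cylinder C [s] \<inter> missed 0 t k)
      \<le> (\<Sum>s\<in>mstates C. prob (cylinder C [s] \<inter> missed 0 t k))"
    by (intro finite_measure_subadditive_finite finite_states image_subsetI sets.Int
        cylinder_in_sets words missed_in_sets)
  ultimately have "prob (missed 0 t k) \<le> (\<Sum>s\<in>mstates C. prob (cylinder C [s] \<inter> missed 0 t k))"
    by simp
  also have "\<dots> \<le> (\<Sum>s\<in>mstates C. (1 - mtrans C m m') ^ k * path_weight C [s])"
    using prob_missed_cylinder words by (intro sum_mono) auto
  also have "\<dots> = (1 - mtrans C m m') ^ k"
    using init_sum by (simp add: path_weight_def flip: sum_distrib_left)
  finally show ?thesis .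
qed

text \<open>Infinitely many hits without a success contain \<open>k\<close> failures in some bounded
  window, for every \<open>k\<close>. The bad event thus has probability at most
  \<open>(1 - mtrans C m m') ^ k\<close>, which tends to 0.\<close>

lemma AE_hit_success: "AE \<omega> in path_measure C. (\<exists>\<^sub>\<infinity>n. hit \<omega> n) \<longrightarrow> (\<exists>n. hit \<omega> n \<and> \<omega> (Suc n) = Some m')"
proof -
  let ?bad = "{\<omega> \<in> maximal_paths C. (\<exists>\<^sub>\<infinity>n. hit \<omega> n) \<and> (\<forall>n. hit \<omega> n \<longrightarrow> \<omega> (Suc n) \<noteq> Some m')}"
  have bad: "?bad \<in> sets (path_measure C)"
    unfolding INFM_nat by (rule path_event) measurable
  have le: "prob ?bad \<le> (1 - mtrans C m m') ^ k" for k
  proof -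
    \<comment> \<open>\<open>?Z t\<close> forbids success at all times, not only inside the window.
      This makes it increase with \<open>t\<close>, which \<open>missed 0 t k\<close> need not
      do.\<close>
    let ?Z = "\<lambda>t. {\<omega> \<in> maximal_paths C. k \<le> card {n \<in> {..<t}. hit \<omega> n} \<and> (\<forall>n. hit \<omega> n \<longrightarrow> \<omega> (Suc n) \<noteq> Some m')}"
    have Z: "?Z t \<in> sets (path_measure C)" for t
    proof -
      have [measurable]: "Measurable.pred (path_measure C) (\<lambda>\<omega>. k \<le> card {n \<in> {..<t}. hit \<omega> n})"
      proof (rule local_pred[OF finite_states, of "Suc t"])
        fix \<omega> \<omega>' :: "nat \<Rightarrow> 'm option" assume eq: "\<And>i. i < Suc t \<Longrightarrow> \<omega> i = \<omega>' i"
        then have "hit \<omega> n = hit \<omega>' n" if "n \<in> {..<t}" for n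
          using that hit_cong[of n \<omega> \<omega>'] by simp
        then show "(k \<le> card {n \<in> {..<t}. hit \<omega> n}) = (k \<le> card {n \<in> {..<t}. hit \<omega>' n})"
          by (metis (mono_tags, lifting) Collect_cong)
      qed
      show ?thesis by (rule path_event) measurable
    qed
    then have rangeZ: "range ?Z \<subseteq> sets (path_measure C)" by (rule image_subsetI)
    have card_mono': "card {n \<in> {..<t}. hit \<omega> n} \<le> card {n \<in> {..<t'}. hit \<omega> n}" if "t \<le> t'" for t t' \<omega>
      by (intro card_mono) (use that in auto)
    have "incseq ?Z"
      unfolding incseq_def using card_mono' le_trans by blast
    then have "(\<lambda>t. prob (?Z t)) \<longlonglongrightarrow> prob (\<Union>t. ?Z t)"
      by (rule finite_Lim_measure_incseq[OF rangeZ])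
    moreover have "prob (?Z t) \<le> (1 - mtrans C m m') ^ k" for t
    proof -
      have "?Z t \<subseteq> missed 0 t k" by (auto simp: missed_def atLeast0LessThan)
      then show ?thesis using finite_measure_mono[OF _ missed_in_sets] prob_missed order_trans by blast
    qed
    ultimately have "prob (\<Union>t. ?Z t) \<le> (1 - mtrans C m m') ^ k"
      by (intro LIMSEQ_le_const2) auto
    moreover have "?bad \<subseteq> (\<Union>t. ?Z t)"
    proof
      fix \<omega> assume \<omega>: "\<omega> \<in> ?bad"
      then have "infinite {n. hit \<omega> n}" by (simp add: Inf_many_def)
      then obtain F where F: "finite F" "card F = k" "F \<subseteq> {n. hit \<omega> n}"
        using infinite_arbitrarily_large by blast
      obtain t where "F \<subseteq> {..<t}" using F(1) finite_nat_iff_bounded by blast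
      then have "k \<le> card {n \<in> {..<t}. hit \<omega> n}"
        unfolding F(2)[symmetric] using F(3) by (intro card_mono) auto
      then show "\<omega> \<in> (\<Union>t. ?Z t)" using \<omega> by blast
    qed
    moreover have "(\<Union>t. ?Z t) \<in> sets (path_measure C)" using Z by blast
    ultimately show ?thesis using finite_measure_mono order_trans by blast
  qed
  have "prob ?bad \<le> 0"
    using LIMSEQ_realpow_zero[OF miss_prob_le_1 miss_prob_less] le by (intro LIMSEQ_le_const) auto
  then have "prob ?bad = 0" by (simp add: antisym)
  then have "AE \<omega> in path_measure C. \<omega> \<notin> ?bad" using bad prob_eq_0 by simp
  then show ?thesis
  proof (rule AE_mp, intro AE_I2 impI)
    fix \<omega> assume "\<omega> \<in> space (path_measure C)" "\<omega> \<notin> ?bad" "\<exists>\<^sub>\<infinity>n. hit \<omega> n"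
    then show "\<exists>n. hit \<omega> n \<and> \<omega> (Suc n) = Some m'"
      unfolding space_path_measure by blast
  qed
qed

end

text \<open>One success becomes infinitely many by restricting \<open>A\<close> to histories longer
  than \<open>l\<close>, for each of the countably many \<open>l\<close>: infinitely many hits
  remain, and the success lies at \<open>l\<close> or later.\<close>

lemma AE_recurrent_step:
  assumes "m \<in> mstates C" "m' \<in> mstates C" "mtrans C m m' > 0"
  shows "AE \<omega> in path_measure C. (\<exists>\<^sub>\<infinity>n. \<omega> n = Some m \<and> A (pre \<omega> n)) \<longrightarrow>
    (\<exists>\<^sub>\<infinity>n. \<omega> n = Some m \<and> A (pre \<omega> n) \<and> \<omega> (Suc n) = Some m')"
proof -
  have "AE \<omega> in path_measure C. \<forall>l. (\<exists>\<^sub>\<infinity>n. \<omega> n = Some m \<and> l < length (pre \<omega> n) \<and> A (pre \<omega> n)) \<longrightarrow>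
      (\<exists>n. (\<omega> n = Some m \<and> l < length (pre \<omega> n) \<and> A (pre \<omega> n)) \<and> \<omega> (Suc n) = Some m')"
    using AE_hit_success[OF assms, of "\<lambda>xs. l < length xs \<and> A xs" for l]
    unfolding AE_all_countable hit_def[OF assms] by blast
  then show ?thesis
  proof (rule AE_mp, intro AE_I2 impI)
    fix \<omega> assume *: "\<forall>l. (\<exists>\<^sub>\<infinity>n. \<omega> n = Some m \<and> l < length (pre \<omega> n) \<and> A (pre \<omega> n)) \<longrightarrow>
        (\<exists>n. (\<omega> n = Some m \<and> l < length (pre \<omega> n) \<and> A (pre \<omega> n)) \<and> \<omega> (Suc n) = Some m')"
      and inf: "\<exists>\<^sub>\<infinity>n. \<omega> n = Some m \<and> A (pre \<omega> n)"
    have len: "length (pre \<omega> n) = Suc n" for n by (simp add: pre_def)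
    have inf_l: "\<exists>\<^sub>\<infinity>n. \<omega> n = Some m \<and> l < length (pre \<omega> n) \<and> A (pre \<omega> n)" for l
      unfolding INFM_nat len
    proof
      fix N
      obtain n where "max N l < n" "\<omega> n = Some m \<and> A (pre \<omega> n)" using inf unfolding INFM_nat by blast
      then show "\<exists>n>N. \<omega> n = Some m \<and> l < Suc n \<and> A (pre \<omega> n)" by (intro exI[of _ n]) auto
    qed
    show "\<exists>\<^sub>\<infinity>n. \<omega> n = Some m \<and> A (pre \<omega> n) \<and> \<omega> (Suc n) = Some m'"
      unfolding INFM_nat_le
    proof
      fix l
      obtain n where "\<omega> n = Some m" "l < length (pre \<omega> n)" "A (pre \<omega> n)" "\<omega> (Suc n) = Some m'"
        using * inf_l by blast
      then show "\<exists>n\<ge>l. \<omega> n = Some m \<and> A (pre \<omega> n) \<and> \<omega> (Suc n) = Some m'"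
        unfolding len by (intro exI[of _ n]) simp
    qed
  qed
qed

end

section \<open>Products with deterministic automata\<close>

primrec daut_run :: "('x \<Rightarrow> 'a \<Rightarrow> 'x option) \<Rightarrow> 'x \<Rightarrow> (nat \<Rightarrow> 'a) \<Rightarrow> nat \<Rightarrow> 'x option" where
  "daut_run step x w 0 = Some x"
| "daut_run step x w (Suc n) = Option.bind (daut_run step x w n) (\<lambda>y. step y (w n))"

lemma daut_run_cong: "(\<And>j. j < n \<Longrightarrow> w j = w' j) \<Longrightarrow> daut_run step x w n = daut_run step x w' n"
  by (induction n) simp_all

lemma daut_run_add:
  "daut_run step x w n = Some y \<Longrightarrow> daut_run step x w (n + k) = daut_run step y (\<lambda>j. w (n + j)) k"
  by (induction k) simp_all

lemma daut_run_None_mono: "daut_run step x w i = None \<Longrightarrow> i \<le> j \<Longrightarrow> daut_run step x w j = None"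
  by (rotate_tac 1, induction rule: dec_induct) simp_all

lemma INFM_shift: "(\<exists>\<^sub>\<infinity>n. P (k + n)) \<longleftrightarrow> (\<exists>\<^sub>\<infinity>n. P n)" for P :: "nat \<Rightarrow> bool"
  unfolding INFM_nat_le
proof
  assume *: "\<forall>m. \<exists>n\<ge>m. P (k + n)"
  show "\<forall>m. \<exists>n\<ge>m. P n"
  proof
    fix m
    obtain n where "m \<le> n" "P (k + n)" using * by blast
    then show "\<exists>n\<ge>m. P n" by (intro exI[of _ "k + n"]) simp
  qed
next
  assume *: "\<forall>m. \<exists>n\<ge>m. P n"
  show "\<forall>m. \<exists>n\<ge>m. P (k + n)"
  proof
    fix m
    obtain n where "m + k \<le> n" "P n" using * by blast
    then show "\<exists>n\<ge>m. P (k + n)" by (intro exI[of _ "n - k"]) simp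
  qed
qed

lemma is_markov_chain_finite_chain:
  assumes "is_markov_chain S M"
  shows "finite_chain M"
proof
  show "finite (mstates M)" "(\<Sum>m \<in> mstates M. minit M m) = 1"
    using assms by (simp_all add: is_markov_chain_def)
  show "0 \<le> minit M m" "(\<Sum>m' \<in> mstates M. mtrans M m m') \<in> {0, 1}" if "m \<in> mstates M" for m
    using assms that by (simp_all add: is_markov_chain_def)
  show "0 \<le> mtrans M m m'" if "m \<in> mstates M" "m' \<in> mstates M" for m m'
    using assms that by (simp add: is_markov_chain_def)
qed

locale chain_daut =
  fixes M :: "('m, 'a) labelled_chain" and X :: "('x, 'a, 'z) daut_scheme" and S :: "'a set"
  assumes chain: "is_markov_chain S M"
    and finite_dstates: "finite (dstates X)"
    and step_states: "dstep X x a = Some y \<Longrightarrow> y \<in> dstates X"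
begin

sublocale M: finite_chain M
  using chain by (rule is_markov_chain_finite_chain)

lemma label_in: "m \<in> mstates M \<Longrightarrow> mlabel M m \<in> S"
  using chain by (auto simp: is_markov_chain_def)

section \<open>Transition weights and bottom SCCs of a product\<close>

abbreviation "prd \<equiv> chain_product M X"

lemma mstates_prd: "mstates prd = mstates M \<times> dstates X"
  by (simp add: chain_product_def)

lemma finite_mstates_prd: "finite (mstates prd)"
  using M.finite_states finite_dstates by (simp add: mstates_prd)

lemma mtrans_prd:
  "mtrans prd (m, x) (m', x') = (if dstep X x (mlabel M m') = Some x' then mtrans M m m' else 0)"
  by (simp add: chain_product_def)

lemma mtrans_prd_pos:
  "mtrans prd (m, x) (m', x') > 0 \<longleftrightarrow> dstep X x (mlabel M m') = Some x' \<and> mtrans M m m' > 0"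
  by (simp add: mtrans_prd)

text \<open>The automaton is deterministic, so each successor of \<open>m\<close> occurs in at most
  one product state of positive weight, and the sum can be taken over states of
  \<open>M\<close>.\<close>

lemma sum_mtrans_prd:
  assumes "D \<subseteq> mstates prd"
  shows "(\<Sum>t\<in>D. mtrans prd (m, x) t) =
    (\<Sum>m' | m' \<in> mstates M \<and> (\<exists>x'. dstep X x (mlabel M m') = Some x' \<and> (m', x') \<in> D). mtrans M m m')"
proof -
  let ?D = "{t \<in> D. dstep X x (mlabel M (fst t)) = Some (snd t)}"
  have fin: "finite D" using assms finite_mstates_prd finite_subset by blast
  have "(\<Sum>t\<in>D. mtrans prd (m, x) t) = (\<Sum>t\<in>?D. mtrans prd (m, x) t)"
    by (rule sum.mono_neutral_right) (use fin in \<open>auto simp: mtrans_prd split: if_splits\<close>)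
  also have "\<dots> = (\<Sum>t\<in>?D. mtrans M m (fst t))"
    by (rule sum.cong) (auto simp: mtrans_prd)
  also have "\<dots> = sum (mtrans M m) (fst ` ?D)"
    by (subst sum.reindex) (auto simp: inj_on_def)
  also have "fst ` ?D = {m' \<in> mstates M. \<exists>x'. dstep X x (mlabel M m') = Some x' \<and> (m', x') \<in> D}"
    using assms by (force simp: mstates_prd)
  finally show ?thesis .
qed

text \<open>The successors of \<open>(m, x)\<close> inside \<open>D\<close> already carry mass 1. A
  further successor of \<open>m\<close> would raise the row sum in \<open>M\<close> above 1, so
  inside a bottom SCC the automaton is never stuck.\<close>

lemma bottom_scc_total:
  assumes D: "bottom_scc prd D" and "(m, x) \<in> D" and m': "m' \<in> mstates M" "mtrans M m m' > 0"
  shows "\<exists>x'. dstep X x (mlabel M m') = Some x' \<and> (m', x') \<in> D"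
proof (rule ccontr)
  let ?G = "{m' \<in> mstates M. \<exists>x'. dstep X x (mlabel M m') = Some x' \<and> (m', x') \<in> D}"
  assume "\<not> ?thesis"
  then have notin: "m' \<notin> ?G" by blast
  have m: "m \<in> mstates M" and sub: "D \<subseteq> mstates prd"
    using assms by (auto simp: bottom_scc_def mstates_prd)
  have fin: "finite ?G" using M.finite_states by simp
  have "1 = (\<Sum>t\<in>D. mtrans prd (m, x) t)" using assms(1,2) by (simp add: bottom_scc_def)
  also have "\<dots> = sum (mtrans M m) ?G" by (rule sum_mtrans_prd[OF sub])
  also have "\<dots> < sum (mtrans M m) (insert m' ?G)" using notin fin m' by simp
  also have "\<dots> \<le> sum (mtrans M m) (mstates M)"
    using m' M.finite_states M.trans_nonneg[OF m] by (intro sum_mono2) auto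
  also have "\<dots> \<le> 1" by (rule M.row_le_1[OF m])
  finally show False by simp
qed

lemma bottom_scc_live:
  assumes D: "bottom_scc prd D" and "(m, x) \<in> D"
  shows "\<exists>m' \<in> mstates M. mtrans M m m' > 0"
proof (rule ccontr)
  assume "\<not> ?thesis"
  then have "(\<Sum>t\<in>D. mtrans prd (m, x) t) \<le> 0"
    using assms by (subst sum_mtrans_prd) (auto simp: bottom_scc_def not_less intro!: sum_nonpos)
  then show False using assms by (simp add: bottom_scc_def)
qed

text \<open>Nothing leaves \<open>D'\<close>, while all of \<open>D\<close> is reachable inside
  \<open>D\<close> from a state of \<open>D'\<close>. This identifies what recurs within a known
  component with the whole component.\<close>

lemma bottom_scc_subset_eq:
  assumes D: "bottom_scc prd D" and D': "bottom_scc prd D'" and sub: "D' \<subseteq> D"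
  shows "D' = D"
proof
  show "D \<subseteq> D'"
  proof
    fix t assume "t \<in> D"
    obtain s where "s \<in> D'" using D' by (auto simp: bottom_scc_def)
    then have "(s, t) \<in> {(u, w). u \<in> D \<and> w \<in> D \<and> mtrans prd u w > 0}\<^sup>*"
      using D sub \<open>t \<in> D\<close> by (auto simp: bottom_scc_def)
    then show "t \<in> D'"
    proof (induction rule: rtrancl_induct)
      case (step u w)
      obtain m x m' x' where uw: "u = (m, x)" "w = (m', x')" by (metis surj_pair)
      have "m' \<in> mstates M" using step D uw by (auto simp: bottom_scc_def mstates_prd)
      then show ?case
        using bottom_scc_total[OF D', of m x m'] step uw by (auto simp: mtrans_prd_pos)
    qed (rule \<open>s \<in> D'\<close>)
  qed
qed (rule sub)

text \<open>An observer in state \<open>x0\<close> at time \<open>k\<close> has already read the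
  label at time \<open>k\<close>, so its first letter is the one at \<open>Suc k\<close>. Start time
  and start state are quantified because both will depend on the path.\<close>

definition fair :: "(nat \<Rightarrow> 'm option) \<Rightarrow> bool" where
  "fair \<omega> \<longleftrightarrow> (\<forall>k. \<forall>x0 \<in> dstates X. \<forall>x \<in> dstates X. \<forall>m \<in> mstates M. \<forall>m' \<in> mstates M.
     mtrans M m m' > 0 \<longrightarrow>
     (\<exists>\<^sub>\<infinity>n. \<omega> (k + n) = Some m \<and>
        daut_run (dstep X) x0 (\<lambda>j. mlabel M (the (\<omega> (Suc (k + j))))) n = Some x) \<longrightarrow>
     (\<exists>\<^sub>\<infinity>n. \<omega> (k + n) = Some m \<and>
        daut_run (dstep X) x0 (\<lambda>j. mlabel M (the (\<omega> (Suc (k + j))))) n = Some x \<and>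
        \<omega> (Suc (k + n)) = Some m'))"

lemma AE_fair: "AE \<omega> in path_measure M. fair \<omega>"
proof -
  have fins: "countable (dstates X)" "countable (mstates M)"
    using finite_dstates M.finite_states by (auto intro: countable_finite)
  have "AE \<omega> in path_measure M. mtrans M m m' > 0 \<longrightarrow>
     (\<exists>\<^sub>\<infinity>n. \<omega> (k + n) = Some m \<and>
        daut_run (dstep X) x0 (\<lambda>j. mlabel M (the (\<omega> (Suc (k + j))))) n = Some x) \<longrightarrow>
     (\<exists>\<^sub>\<infinity>n. \<omega> (k + n) = Some m \<and>
        daut_run (dstep X) x0 (\<lambda>j. mlabel M (the (\<omega> (Suc (k + j))))) n = Some x \<and>
        \<omega> (Suc (k + n)) = Some m')"
    if m: "m \<in> mstates M" "m' \<in> mstates M" for k x0 x m m'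
  proof (cases "mtrans M m m' > 0")
    case True
    \<comment> \<open>The state of the observer as a property of the history: a history of length
      \<open>k + n + 1\<close> contains \<open>n\<close> letters after time
      \<open>k\<close>.\<close>
    define A where "A xs \<longleftrightarrow>
      daut_run (dstep X) x0 (\<lambda>j. mlabel M (xs ! Suc (k + j))) (length xs - Suc k) = Some x" for xs
    have A: "A (pre \<omega> (k + n)) \<longleftrightarrow>
        daut_run (dstep X) x0 (\<lambda>j. mlabel M (the (\<omega> (Suc (k + j))))) n = Some x" for \<omega> n
    proof -
      have "pre \<omega> (k + n) ! Suc (k + j) = the (\<omega> (Suc (k + j)))" if "j < n" for j
        using that by (simp add: pre_def del: upt_Suc)
      then have "daut_run (dstep X) x0 (\<lambda>j. mlabel M (pre \<omega> (k + n) ! Suc (k + j))) n =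
          daut_run (dstep X) x0 (\<lambda>j. mlabel M (the (\<omega> (Suc (k + j))))) n"
        by (intro daut_run_cong) simp
      moreover have "length (pre \<omega> (k + n)) - Suc k = n" by (simp add: pre_def)
      ultimately show ?thesis by (simp add: A_def)
    qed
    show ?thesis
      using M.AE_recurrent_step[OF m True, of A]
    proof (rule AE_mp, intro AE_I2 impI)
      fix \<omega>
      assume rec: "(\<exists>\<^sub>\<infinity>n. \<omega> n = Some m \<and> A (pre \<omega> n)) \<longrightarrow>
          (\<exists>\<^sub>\<infinity>n. \<omega> n = Some m \<and> A (pre \<omega> n) \<and> \<omega> (Suc n) = Some m')"
        and inf: "\<exists>\<^sub>\<infinity>n. \<omega> (k + n) = Some m \<and>
          daut_run (dstep X) x0 (\<lambda>j. mlabel M (the (\<omega> (Suc (k + j))))) n = Some x"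
      show "\<exists>\<^sub>\<infinity>n. \<omega> (k + n) = Some m \<and>
          daut_run (dstep X) x0 (\<lambda>j. mlabel M (the (\<omega> (Suc (k + j))))) n = Some x \<and>
          \<omega> (Suc (k + n)) = Some m'"
        using rec inf INFM_shift[of "\<lambda>n. \<omega> n = Some m \<and> A (pre \<omega> n)" k]
          INFM_shift[of "\<lambda>n. \<omega> n = Some m \<and> A (pre \<omega> n) \<and> \<omega> (Suc n) = Some m'" k]
        unfolding A by blast
    qed
  qed simp
  then show ?thesis
    unfolding fair_def AE_all_countable using fins by (simp add: AE_ball_countable)
qed

section \<open>Recurring product states along a single path\<close>

definition recurrent_run :: "(nat \<Rightarrow> 'm) \<Rightarrow> (nat \<Rightarrow> 'x) \<Rightarrow> bool" where
  "recurrent_run \<pi> x \<longleftrightarrow>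
     (\<forall>n. \<pi> n \<in> mstates M \<and> x n \<in> dstates X \<and> mtrans M (\<pi> n) (\<pi> (Suc n)) > 0 \<and>
        dstep X (x n) (mlabel M (\<pi> (Suc n))) = Some (x (Suc n))) \<and>
     (\<forall>m \<in> mstates M. \<forall>y \<in> dstates X. \<forall>m' \<in> mstates M. mtrans M m m' > 0 \<longrightarrow>
        (\<exists>\<^sub>\<infinity>n. \<pi> n = m \<and> x n = y) \<longrightarrow> (\<exists>\<^sub>\<infinity>n. \<pi> n = m \<and> x n = y \<and> \<pi> (Suc n) = m'))"

definition inf_states :: "(nat \<Rightarrow> 'm) \<Rightarrow> (nat \<Rightarrow> 'x) \<Rightarrow> ('m \<times> 'x) set" where
  "inf_states \<pi> x = {s. \<exists>\<^sub>\<infinity>n. (\<pi> n, x n) = s}"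

lemma recurrent_runD:
  assumes "recurrent_run \<pi> x"
  shows "\<pi> n \<in> mstates M" "x n \<in> dstates X" "mtrans M (\<pi> n) (\<pi> (Suc n)) > 0"
    "dstep X (x n) (mlabel M (\<pi> (Suc n))) = Some (x (Suc n))"
    and "m \<in> mstates M \<Longrightarrow> y \<in> dstates X \<Longrightarrow> m' \<in> mstates M \<Longrightarrow> mtrans M m m' > 0 \<Longrightarrow>
      \<exists>\<^sub>\<infinity>n. \<pi> n = m \<and> x n = y \<Longrightarrow> \<exists>\<^sub>\<infinity>n. \<pi> n = m \<and> x n = y \<and> \<pi> (Suc n) = m'"
  using assms unfolding recurrent_run_def by blast+

context
  fixes \<pi> :: "nat \<Rightarrow> 'm" and x :: "nat \<Rightarrow> 'x"
  assumes rec: "recurrent_run \<pi> x"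
begin

private lemmas states = recurrent_runD(1,2)[OF rec]
  and trans = recurrent_runD(3)[OF rec]
  and step = recurrent_runD(4)[OF rec]
  and recurrent = recurrent_runD(5)[OF rec]

lemma inf_states_subset: "inf_states \<pi> x \<subseteq> mstates prd"
proof
  fix s assume "s \<in> inf_states \<pi> x"
  then obtain n where "(\<pi> n, x n) = s" unfolding inf_states_def by (auto dest: INFM_EX)
  then show "s \<in> mstates prd" using states by (auto simp: mstates_prd)
qed

lemma eventually_inf_states: "\<exists>N. \<forall>n\<ge>N. (\<pi> n, x n) \<in> inf_states \<pi> x"
proof -
  have "\<forall>\<^sub>\<infinity>n. \<forall>s \<in> mstates prd - inf_states \<pi> x. (\<pi> n, x n) \<noteq> s"
    by (rule eventually_ball_finite)
      (use finite_mstates_prd in \<open>auto simp: inf_states_def not_frequently\<close>)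
  then obtain N where "\<forall>n\<ge>N. \<forall>s \<in> mstates prd - inf_states \<pi> x. (\<pi> n, x n) \<noteq> s"
    unfolding MOST_nat_le by blast
  then show ?thesis using states by (intro exI[of _ N]) (auto simp: mstates_prd)
qed

text \<open>Recurrence is needed for the move of the chain only; the move of the automaton is then
  forced, being a function of its state and the letter.\<close>

lemma inf_transition:
  assumes "s \<in> inf_states \<pi> x" "t \<in> mstates prd" "mtrans prd s t > 0"
  shows "\<exists>\<^sub>\<infinity>n. (\<pi> n, x n) = s \<and> (\<pi> (Suc n), x (Suc n)) = t"
proof -
  obtain m y m' y' where st: "s = (m, y)" "t = (m', y')" by (metis surj_pair)
  have pos: "dstep X y (mlabel M m') = Some y'" "mtrans M m m' > 0"
    using assms(3) st by (simp_all add: mtrans_prd_pos)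
  have "\<exists>\<^sub>\<infinity>n. \<pi> n = m \<and> x n = y" using assms(1) st by (simp add: inf_states_def)
  then have "\<exists>\<^sub>\<infinity>n. \<pi> n = m \<and> x n = y \<and> \<pi> (Suc n) = m'"
    using recurrent[OF _ _ _ pos(2)] assms(1,2) st inf_states_subset by (auto simp: mstates_prd)
  then show ?thesis
  proof (rule INFM_mono)
    fix n assume "\<pi> n = m \<and> x n = y \<and> \<pi> (Suc n) = m'"
    then show "(\<pi> n, x n) = s \<and> (\<pi> (Suc n), x (Suc n)) = t" using step[of n] pos(1) st by simp
  qed
qed

lemma bottom_scc_inf_states: "bottom_scc prd (inf_states \<pi> x)"
  unfolding bottom_scc_def
proof (intro conjI ballI)
  obtain N where N: "\<And>n. n \<ge> N \<Longrightarrow> (\<pi> n, x n) \<in> inf_states \<pi> x" using eventually_inf_states by blast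
  show "inf_states \<pi> x \<noteq> {}" using N by blast
  show "inf_states \<pi> x \<subseteq> mstates prd" by (rule inf_states_subset)
  have pos: "mtrans prd (\<pi> n, x n) (\<pi> (Suc n), x (Suc n)) > 0" for n
    using trans[of n] step[of n] by (simp add: mtrans_prd_pos)
  let ?R = "{(u, w). u \<in> inf_states \<pi> x \<and> w \<in> inf_states \<pi> x \<and> mtrans prd u w > 0}"
  show "(s, t) \<in> ?R\<^sup>*" if "s \<in> inf_states \<pi> x" "t \<in> inf_states \<pi> x" for s t
  proof -
    obtain n where n: "n \<ge> N" "(\<pi> n, x n) = s"
      using \<open>s \<in> inf_states \<pi> x\<close> unfolding inf_states_def INFM_nat_le by blast
    obtain n' where n': "n' \<ge> n" "(\<pi> n', x n') = t"
      using \<open>t \<in> inf_states \<pi> x\<close> unfolding inf_states_def INFM_nat_le by blast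
    have "((\<pi> n, x n), (\<pi> n', x n')) \<in> ?R\<^sup>*"
      using n'(1)
    proof (induction rule: dec_induct)
      case (step i)
      then show ?case using N[of i] N[of "Suc i"] n(1) pos[of i] by (auto intro: rtrancl_into_rtrancl)
    qed simp
    then show ?thesis using n n' by simp
  qed
  show "(\<Sum>t\<in>inf_states \<pi> x. mtrans prd s t) = 1" if s: "s \<in> inf_states \<pi> x" for s
  proof -
    obtain m y where my: "s = (m, y)" by (metis surj_pair)
    have m: "m \<in> mstates M" using s my inf_states_subset by (auto simp: mstates_prd)
    have "\<exists>\<^sub>\<infinity>n. \<pi> n = m \<and> x n = y" using s my by (simp add: inf_states_def)
    note inf = this
    let ?G = "{m' \<in> mstates M. \<exists>x'. dstep X y (mlabel M m') = Some x' \<and> (m', x') \<in> inf_states \<pi> x}"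
    \<comment> \<open>The step on the label of \<open>m'\<close> is defined because the path really
      moves from \<open>(m, y)\<close> to \<open>m'\<close>. So every successor of \<open>m\<close>
      is matched by a recurring product state, and these carry the full row sum 1.\<close>
    have in_G: "m' \<in> ?G" if m': "m' \<in> mstates M" "mtrans M m m' > 0" for m'
    proof -
      have y: "y \<in> dstates X" using s my inf_states_subset by (auto simp: mstates_prd)
      have "\<exists>\<^sub>\<infinity>n. \<pi> n = m \<and> x n = y \<and> \<pi> (Suc n) = m'"
        by (rule recurrent[OF m y m' inf])
      then obtain n where "x n = y" "\<pi> (Suc n) = m'" by (auto dest: INFM_EX)
      then have x': "dstep X y (mlabel M m') = Some (x (Suc n))" using step[of n] by simp
      have "(m', x (Suc n)) \<in> mstates prd" using m' states by (simp add: mstates_prd)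
      moreover have "mtrans prd s (m', x (Suc n)) > 0" using my x' m' by (simp add: mtrans_prd_pos)
      ultimately have "\<exists>\<^sub>\<infinity>n'. (\<pi> n', x n') = s \<and> (\<pi> (Suc n'), x (Suc n')) = (m', x (Suc n))"
        by (rule inf_transition[OF s])
      then have "\<exists>\<^sub>\<infinity>n'. (\<pi> (Suc n'), x (Suc n')) = (m', x (Suc n))" by (rule INFM_mono) simp
      then have "(m', x (Suc n)) \<in> inf_states \<pi> x"
        using INFM_shift[of "\<lambda>n'. (\<pi> n', x n') = (m', x (Suc n))" 1] by (simp add: inf_states_def)
      then show ?thesis using m' x' by blast
    qed
    obtain n where "\<pi> n = m" using inf by (auto dest: INFM_EX)
    then have "mtrans M m (\<pi> (Suc n)) > 0" using trans[of n] by simp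
    then have "M.row m = 1" using M.row_1_iff[OF m] states by blast
    have "(\<Sum>t\<in>inf_states \<pi> x. mtrans prd s t) = sum (mtrans M m) ?G"
      unfolding my by (rule sum_mtrans_prd[OF inf_states_subset])
    also have "\<dots> = sum (mtrans M m) (mstates M)"
      using in_G M.finite_states M.trans_nonneg[OF m]
      by (intro sum.mono_neutral_left) (auto simp: less_le)
    also have "\<dots> = 1" using \<open>M.row m = 1\<close> by (simp add: M.row_def)
    finally show ?thesis .
  qed
qed

end

text \<open>At time \<open>i\<close> the automaton has read the labels of \<open>i + 1\<close>
  states, including the initial one, hence \<open>Suc i\<close>. The lifted path ends where the
  automaton is stuck, even if the path itself goes on.\<close>

definition lift :: "(nat \<Rightarrow> 'm option) \<Rightarrow> nat \<Rightarrow> ('m \<times> 'x) option" where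
  "lift \<omega> i = (case \<omega> i of None \<Rightarrow> None
     | Some m \<Rightarrow> map_option (Pair m) (daut_run (dstep X) (dinit X) (\<lambda>j. mlabel M (the (\<omega> j))) (Suc i)))"

lemma lift_eq_Some:
  "lift \<omega> i = Some (m, x) \<longleftrightarrow> \<omega> i = Some m \<and>
     daut_run (dstep X) (dinit X) (\<lambda>j. mlabel M (the (\<omega> j))) (Suc i) = Some x"
  by (auto simp: lift_def split: option.splits)

lemma lift_eq_Some':
  "lift \<omega> i = Some y \<longleftrightarrow> \<omega> i = Some (fst y) \<and>
     daut_run (dstep X) (dinit X) (\<lambda>j. mlabel M (the (\<omega> j))) (Suc i) = Some (snd y)"
  by (cases y) (simp add: lift_eq_Some del: daut_run.simps)

lemma daut_run_states: "0 < n \<Longrightarrow> daut_run (dstep X) x0 w n = Some x \<Longrightarrow> x \<in> dstates X"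
  by (cases n) (auto simp: bind_eq_Some_conv intro: step_states)

end

text \<open>Under these conditions the row sums of the product are again \<^term>\<open>0\<close> or \<^term>\<open>1\<close>; otherwise
  no measure on its maximal paths has the prescribed values on the cylinders.\<close>

locale chain_uniform_daut = chain_daut M X S
  for M :: "('m, 'a) labelled_chain" and X :: "('x, 'a, 'z) daut_scheme" and S :: "'a set" +
  assumes init_total: "a \<in> S \<Longrightarrow> dstep X (dinit X) a \<noteq> None"
    and uniform: "a \<in> S \<Longrightarrow> b \<in> S \<Longrightarrow> dstep X x a = None \<Longrightarrow> dstep X x b = None"
begin

text \<open>The critical case is a path that goes on while the automaton is stuck. By
  \<open>uniform\<close> it is then stuck on every label, so the product state has no successor and
  a maximal path may end there.\<close>

lemma lift_maximal:
  assumes \<omega>: "\<omega> \<in> maximal_paths M"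
  shows "lift \<omega> \<in> maximal_paths prd"
proof -
  let ?run = "daut_run (dstep X) (dinit X) (\<lambda>j. mlabel M (the (\<omega> j)))"
  have init: "\<exists>s \<in> mstates prd. lift \<omega> 0 = Some s"
  proof -
    obtain m where m: "\<omega> 0 = Some m" using maximal_pathsD(1)[OF \<omega>] by blast
    have mM: "m \<in> mstates M" using maximal_pathsD(3)[OF \<omega> m] .
    obtain x where x: "dstep X (dinit X) (mlabel M m) = Some x"
      using init_total[OF label_in[OF mM]] by blast
    have "lift \<omega> 0 = Some (m, x)" using m x by (simp add: lift_eq_Some)
    then show ?thesis using mM step_states[OF x] by (auto simp: mstates_prd)
  qed
  have "case lift \<omega> i of None \<Rightarrow> lift \<omega> (Suc i) = None
      | Some s \<Rightarrow> (case lift \<omega> (Suc i) of None \<Rightarrow> \<forall>t \<in> mstates prd. mtrans prd s t = 0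
          | Some t \<Rightarrow> t \<in> mstates prd \<and> mtrans prd s t > 0)" for i
  proof (cases "lift \<omega> i")
    case None
    then have "\<omega> i = None \<or> ?run (Suc i) = None" by (auto simp: lift_def split: option.splits)
    then have "\<omega> (Suc i) = None \<or> ?run (Suc (Suc i)) = None"
    proof
      assume "?run (Suc i) = None"
      then have "?run (Suc (Suc i)) = None" by (rule daut_run_None_mono) simp
      then show ?thesis by (rule disjI2)
    qed (use maximal_pathsD(2)[OF \<omega>] in simp)
    then have "lift \<omega> (Suc i) = None" by (auto simp: lift_def split: option.splits)
    then show ?thesis using None by simp
  next
    case (Some s)
    then obtain m x where s: "s = (m, x)" "\<omega> i = Some m" "?run (Suc i) = Some x"
      by (cases s) (auto simp: lift_eq_Some)
    show ?thesis
    proof (cases "\<omega> (Suc i)")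
      case None
      have "mtrans M m m' = 0" if "m' \<in> mstates M" for m'
        using maximal_pathsD(5)[OF \<omega> s(2) None that] .
      then have "\<forall>t \<in> mstates prd. mtrans prd s t = 0" by (auto simp: s mstates_prd mtrans_prd)
      moreover have "lift \<omega> (Suc i) = None" using None by (simp add: lift_def)
      ultimately show ?thesis using Some by simp
    next
      case m': (Some m')
      note m'M = maximal_pathsD(3)[OF \<omega> m']
      have run: "?run (Suc (Suc i)) = dstep X x (mlabel M m')"
        using s(3) m' by simp
      show ?thesis
      proof (cases "dstep X x (mlabel M m')")
        case None
        then have "\<forall>t \<in> mstates prd. mtrans prd s t = 0"
          using uniform[OF label_in[OF m'M] label_in None] by (auto simp: s mstates_prd mtrans_prd)
        moreover have "lift \<omega> (Suc i) = None" using m' run None by (simp add: lift_def)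
        ultimately show ?thesis using Some by simp
      next
        case x': (Some x')
        then have "lift \<omega> (Suc i) = Some (m', x')" using m' run by (simp add: lift_eq_Some)
        moreover have "(m', x') \<in> mstates prd" using m'M step_states[OF x'] by (simp add: mstates_prd)
        moreover have "mtrans prd s (m', x') > 0"
          using x' maximal_pathsD(4)[OF \<omega> s(2) m'] s(1) by (simp add: mtrans_prd_pos)
        ultimately show ?thesis using Some by simp
      qed
    qed
  qed
  then show ?thesis using init by (simp only: maximal_paths_def mem_Collect_eq) blast
qed

definition consistent :: "('m \<times> 'x) list \<Rightarrow> bool" where
  "consistent ys \<longleftrightarrow> (\<forall>i < length ys.
     daut_run (dstep X) (dinit X) (\<lambda>j. mlabel M (fst (ys ! j))) (Suc i) = Some (snd (ys ! i)))"

lemma lift_cylinder: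
  assumes "\<omega> \<in> maximal_paths M"
  shows "lift \<omega> \<in> cylinder prd ys \<longleftrightarrow> consistent ys \<and> \<omega> \<in> cylinder M (map fst ys)"
proof -
  have run: "daut_run (dstep X) (dinit X) (\<lambda>j. mlabel M (the (\<omega> j))) (Suc i) =
      daut_run (dstep X) (dinit X) (\<lambda>j. mlabel M (fst (ys ! j))) (Suc i)"
    if "\<forall>i < length ys. \<omega> i = Some (fst (ys ! i))" "i < length ys" for i
    by (rule daut_run_cong) (use that in auto)
  have "lift \<omega> \<in> cylinder prd ys \<longleftrightarrow> (\<forall>i < length ys. \<omega> i = Some (fst (ys ! i)) \<and>
      daut_run (dstep X) (dinit X) (\<lambda>j. mlabel M (the (\<omega> j))) (Suc i) = Some (snd (ys ! i)))"
    unfolding cylinder_def using lift_maximal[OF assms]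
    by (simp add: lift_eq_Some' del: daut_run.simps)
  also have "\<dots> \<longleftrightarrow> (\<forall>i < length ys. \<omega> i = Some (fst (ys ! i))) \<and> consistent ys"
    unfolding consistent_def using run by (auto simp del: daut_run.simps)
  finally show ?thesis using assms by (auto simp: cylinder_def)
qed

lemma path_weight_prd:
  assumes "ys \<noteq> []"
  shows "path_weight prd ys = (if consistent ys then path_weight M (map fst ys) else 0)"
  using assms
proof (induction ys rule: rev_nonempty_induct)
  case (single y)
  then show ?case
    by (cases y) (simp add: path_weight_def consistent_def chain_product_def)
next
  case (snoc y ys)
  obtain l where l: "length ys = Suc l" using snoc.hyps by (cases ys) auto
  let ?run = "\<lambda>ys. daut_run (dstep X) (dinit X) (\<lambda>j. mlabel M (fst (ys ! j)))"
  have run: "?run (ys @ [y]) (Suc i) = ?run ys (Suc i)" if "i < length ys" for i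
    by (rule daut_run_cong) (use that in \<open>auto simp: nth_append\<close>)
  have "consistent (ys @ [y]) \<longleftrightarrow> consistent ys \<and> ?run (ys @ [y]) (Suc (length ys)) = Some (snd y)"
    unfolding consistent_def using run by (auto simp: less_Suc_eq nth_append simp del: daut_run.simps)
  moreover have "?run (ys @ [y]) (Suc (length ys)) = dstep X (snd (last ys)) (mlabel M (fst y))"
    if "consistent ys"
  proof -
    have "?run ys (length ys) = Some (snd (last ys))"
      using that snoc.hyps l unfolding consistent_def by (simp add: last_conv_nth del: daut_run.simps)
    then have "?run (ys @ [y]) (length ys) = Some (snd (last ys))"
      using run[of l] l by (simp del: daut_run.simps)
    then show ?thesis by simp
  qed
  moreover have "mtrans prd (last ys) y =
      (if dstep X (snd (last ys)) (mlabel M (fst y)) = Some (snd y) then mtrans M (fst (last ys)) (fst y) else 0)"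
    by (cases y, cases "last ys") (simp add: mtrans_prd)
  ultimately show ?case
    using snoc by (auto simp: path_weight_snoc last_map)
qed

text \<open>First components determine a product path, so the image measure under
  \<open>lift\<close> has the prescribed values: an inconsistent word has weight 0 and an empty
  event, and a consistent one inherits the weight of its projection.\<close>

lemma path_measure_prd:
  "lift \<in> path_measure M \<rightarrow>\<^sub>M sigma (maximal_paths prd) (cylinder prd ` chain_words prd)"
  "path_measure prd =
    distr (path_measure M) (sigma (maximal_paths prd) (cylinder prd ` chain_words prd)) lift"
proof -
  let ?N = "sigma (maximal_paths prd) (cylinder prd ` chain_words prd)"
  have words: "map fst ys \<in> chain_words M" if "ys \<in> chain_words prd" for ys
    using that by (auto simp: chain_words_def mstates_prd)
  have vim: "lift -` cylinder prd ys \<inter> space (path_measure M) =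
      (if consistent ys then cylinder M (map fst ys) else {})" for ys
    using lift_cylinder by (auto simp: cylinder_def)
  show meas: "lift \<in> path_measure M \<rightarrow>\<^sub>M ?N"
  proof (rule measurable_measure_of[OF cylinder_subset])
    fix A assume "A \<in> cylinder prd ` chain_words prd"
    then obtain ys where "A = cylinder prd ys" "ys \<in> chain_words prd" by blast
    then show "lift -` A \<inter> space (path_measure M) \<in> sets (path_measure M)"
      using cylinder_in_sets[OF words] by (simp only: vim) simp
  qed (use lift_maximal in auto)
  show "path_measure prd = distr (path_measure M) ?N lift"
  proof (rule path_measure_eqI[OF finite_mstates_prd])
    show "sets (distr (path_measure M) ?N lift) = sigma_sets (maximal_paths prd) (cylinder prd ` chain_words prd)"
      by (simp add: sets_measure_of[OF cylinder_subset])
    fix ys assume ys: "ys \<in> chain_words prd"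
    have "emeasure (distr (path_measure M) ?N lift) (cylinder prd ys) =
        emeasure (path_measure M) (lift -` cylinder prd ys \<inter> space (path_measure M))"
      by (rule emeasure_distr[OF meas]) (use ys in \<open>auto simp: sets_measure_of[OF cylinder_subset]\<close>)
    also have "\<dots> = ennreal (path_weight prd ys)"
      unfolding vim using M.emeasure_cylinder[OF words[OF ys]] ys
      by (simp add: path_weight_prd chain_words_def)
    finally show "emeasure (distr (path_measure M) ?N lift) (cylinder prd ys) = ennreal (path_weight prd ys)" .
  qed
qed

lemma measure_prd:
  assumes "E \<in> sets (path_measure prd)"
  shows "measure (path_measure prd) E = measure (path_measure M) {\<omega> \<in> maximal_paths M. lift \<omega> \<in> E}"
    and "{\<omega> \<in> maximal_paths M. lift \<omega> \<in> E} \<in> sets (path_measure M)"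
proof -
  have E: "E \<in> sets (sigma (maximal_paths prd) (cylinder prd ` chain_words prd))"
    using assms by (simp add: sets_path_measure sets_measure_of[OF cylinder_subset])
  have eq: "{\<omega> \<in> maximal_paths M. lift \<omega> \<in> E} = lift -` E \<inter> space (path_measure M)" by auto
  show "measure (path_measure prd) E = measure (path_measure M) {\<omega> \<in> maximal_paths M. lift \<omega> \<in> E}"
    unfolding eq using measure_distr[OF path_measure_prd(1) E] by (simp flip: path_measure_prd(2))
  show "{\<omega> \<in> maximal_paths M. lift \<omega> \<in> E} \<in> sets (path_measure M)"
    unfolding eq by (rule measurable_sets[OF path_measure_prd(1) E])
qed

lemma reach_paths_in_sets: "reach_paths prd U \<in> sets (path_measure prd)"
proof -
  have [measurable]: "Measurable.pred (path_measure prd) (\<lambda>\<omega>. \<exists>s \<in> U. \<omega> i = Some s)" for i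
    by (rule local_pred[OF finite_mstates_prd, of "Suc i"]) simp
  have "Measurable.pred (path_measure prd) (\<lambda>\<omega>. \<exists>i. \<exists>s \<in> U. \<omega> i = Some s)"
    by measurable
  then show ?thesis unfolding reach_paths_def by (rule path_event)
qed

end

section \<open>Accepted paths as measurable events\<close>

text \<open>Prepending one transition shifts all positions by one, which does not affect what
  happens infinitely often.\<close>

lemma lang_from_post:
  assumes "(\<lambda>j. w (Suc j)) \<in> lang_from B (post (ntrans B) R (w 0))"
  shows "w \<in> lang_from B R"
proof -
  obtain \<rho> where \<rho>: "\<rho> 0 \<in> post (ntrans B) R (w 0)"
    "\<And>i. (\<rho> i, w (Suc i), \<rho> (Suc i)) \<in> ntrans B"
    "\<And>j. j \<in> {1..nacc_count B} \<Longrightarrow> infinite {i. (\<rho> i, w (Suc i), \<rho> (Suc i)) \<in> nacc B j}"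
    using assms unfolding lang_from_def by blast
  obtain q where q: "q \<in> R" "(q, w 0, \<rho> 0) \<in> ntrans B" using \<rho>(1) by (auto simp: post_def)
  let ?\<rho> = "case_nat q \<rho>"
  have "(?\<rho> i, w i, ?\<rho> (Suc i)) \<in> ntrans B" for i
    using q(2) \<rho>(2) by (cases i) auto
  moreover have "infinite {i. (?\<rho> i, w i, ?\<rho> (Suc i)) \<in> nacc B j}" if "j \<in> {1..nacc_count B}" for j
  proof -
    have "\<exists>\<^sub>\<infinity>i. (?\<rho> (1 + i), w (1 + i), ?\<rho> (Suc (1 + i))) \<in> nacc B j"
      using \<rho>(3)[OF that] by (simp add: Inf_many_def)
    then have "\<exists>\<^sub>\<infinity>i. (?\<rho> i, w i, ?\<rho> (Suc i)) \<in> nacc B j"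
      by (subst (asm) INFM_shift[of "\<lambda>i. (?\<rho> i, w i, ?\<rho> (Suc i)) \<in> nacc B j" 1])
    then show ?thesis by (simp add: Inf_many_def)
  qed
  ultimately show ?thesis
    unfolding lang_from_def using q(1) by (auto intro!: exI[of _ ?\<rho>])
qed

lemma lang_from_subset_run:
  assumes "daut_run (dstep (subset_aut B)) R w n = Some R'" "(\<lambda>j. w (n + j)) \<in> lang_from B R'"
  shows "w \<in> lang_from B R"
  using assms
proof (induction n arbitrary: R')
  case (Suc n)
  obtain R1 where R1: "daut_run (dstep (subset_aut B)) R w n = Some R1"
    "dstep (subset_aut B) R1 (w n) = Some R'"
    using Suc.prems(1) by (auto simp: bind_eq_Some_conv)
  then have R': "R' = post (ntrans B) R1 (w n)" by (auto simp: subset_aut_def split: if_splits)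
  have "(\<lambda>j. w (n + j)) \<in> lang_from B R1"
    by (rule lang_from_post) (use Suc.prems(2) in \<open>simp add: R'\<close>)
  then show ?case using Suc.IH R1(1) by blast
qed simp

lemma rchd_initial: "rchd (initial_ght B) = ninit B"
  by (simp add: rchd_def initial_ght_def)

lemma rchd_states:
  assumes "is_ght B d"
  shows "rchd d \<subseteq> nstates B" "rchd d \<noteq> {}"
  using pre_ght_lab[OF is_ght_imp_pre_ght[OF assms] is_ght_root[OF assms]]
    pre_ght_lab_ne[OF is_ght_imp_pre_ght[OF assms] is_ght_root[OF assms]]
  by (simp_all add: rchd_def)

lemma subset_run_det:
  assumes "is_ngba B" "daut_run (ght_step B) d w n = Some d'"
  shows "daut_run (dstep (subset_aut B)) (rchd d) w n = Some (rchd d')"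
  using assms(2)
proof (induction n arbitrary: d')
  case (Suc n)
  obtain e where e: "daut_run (ght_step B) d w n = Some e" "ght_step B e (w n) = Some d'"
    using Suc.prems by (auto simp: bind_eq_Some_conv)
  then have "dstep (subset_aut B) (rchd e) (w n) = Some (rchd d')"
    using ght_stepD(2)[OF e(2)] rchd_states[OF ght_stepD(1)[OF e(2)]] rchd_ght_step[OF assms(1) e(2)]
    by (simp add: subset_aut_def)
  then show ?case using Suc.IH[OF e(1)] by simp
qed simp

text \<open>The existence of a run, a choice among uncountably many sequences, is replaced by
  quantifiers over \<open>v\<close>, \<open>n\<close> and \<open>i\<close>, which are countable. The
  conjunct on \<open>None\<close> makes \<open>the\<close> meaningful.\<close>

lemma lang_from_det_iff:
  assumes B: "is_ngba B" and d: "is_ght B d" and w: "\<And>i. w i \<in> alphabet B"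
  shows "w \<in> lang_from B (rchd d) \<longleftrightarrow>
    (\<forall>n. daut_run (ght_step B) d w n \<noteq> None) \<and>
    (\<exists>v n. (\<forall>i\<ge>n. stable_node B (w i) (the (daut_run (ght_step B) d w i)) v) \<and>
       (\<exists>\<^sub>\<infinity>i. saturated (ght_split B (w i) (the (daut_run (ght_step B) d w i))) v))"
    (is "_ \<longleftrightarrow> ?alive \<and> ?rabin")
proof -
  let ?d = "\<lambda>i. the (daut_run (ght_step B) d w i)"
  have step: "ght_step B (?d i) (w i) = Some (?d (Suc i))" if ?alive for i
  proof -
    obtain e where "daut_run (ght_step B) d w (Suc i) = Some e"
      using \<open>?alive\<close> by blast
    then show ?thesis by (auto simp: bind_eq_Some_conv)
  qed
  show ?thesis
  proof
    assume "w \<in> lang_from B (rchd d)"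
    then obtain \<rho> where \<rho>: "\<rho> 0 \<in> rchd d" "\<And>i. (\<rho> i, w i, \<rho> (Suc i)) \<in> ntrans B"
      "\<And>j. j \<in> {1..nacc_count B} \<Longrightarrow> infinite {i. (\<rho> i, w i, \<rho> (Suc i)) \<in> nacc B j}"
      unfolding lang_from_def by blast
    \<comment> \<open>The run witnesses at every step that the root label has a successor state, so
      the determinisation is never stuck.\<close>
    have "\<exists>e. daut_run (ght_step B) d w n = Some e \<and> is_ght B e \<and> \<rho> n \<in> rchd e" for n
    proof (induction n)
      case (Suc n)
      then obtain e where e: "daut_run (ght_step B) d w n = Some e" "is_ght B e" "\<rho> n \<in> rchd e" by blast
      then have "\<rho> (Suc n) \<in> post (ntrans B) (lab e []) (w n)"
        using \<rho>(2)[of n] by (auto simp: post_def rchd_def)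
      then obtain e' where e': "ght_step B e (w n) = Some e'"
        using e(2) w[of n] unfolding ght_step_def by fastforce
      moreover have "\<rho> (Suc n) \<in> rchd e'"
        using rchd_ght_step[OF B e'] e(3) \<rho>(2)[of n] by (auto simp: post_def)
      ultimately show ?case using e(1) ght_step_is_ght[OF B e'] by auto
    qed (use d \<rho>(1) in simp)
    then have alive: ?alive by (metis option.distinct(1))
    obtain v n where "\<And>i. n \<le> i \<Longrightarrow> stable_node B (w i) (?d i) v"
      "\<exists>\<^sub>\<infinity>i. saturated (ght_split B (w i) (?d i)) v"
      by (rule det_complete[where d = ?d and w = w and \<rho> = \<rho>, OF B step[OF alive]]) (use \<rho> in auto)
    then show "?alive \<and> ?rabin" using alive by blast
  next
    assume *: "?alive \<and> ?rabin"
    then obtain v n where "\<And>i. n \<le> i \<Longrightarrow> stable_node B (w i) (?d i) v"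
      "\<exists>\<^sub>\<infinity>i. saturated (ght_split B (w i) (?d i)) v" by blast
    then have "w \<in> lang_from B (rchd (?d 0))"
      using det_sound[where d = ?d and w = w, OF B step] * by blast
    then show "w \<in> lang_from B (rchd d)" by simp
  qed
qed

lemma det_simps:
  "dstep (det B) = ght_step B" "dinit (det B) = initial_ght B" "dstates (det B) = {d. is_ght B d}"
  "(d, a, d') \<in> racc (det B) v \<longleftrightarrow> ght_step B d a = Some d' \<and> saturated (ght_split B a d) v"
  "(d, a, d') \<in> rrej (det B) v \<longleftrightarrow> ght_step B d a = Some d' \<and> \<not> stable_node B a d v"
  by (auto simp: det_def Let_def stable_node_def)

lemma chain_daut_det:
  assumes "is_ngba B" "is_markov_chain (alphabet B) M"
  shows "chain_daut M (det B) (alphabet B)"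
  using assms finite_ghts ght_step_is_ght by unfold_locales (auto simp: det_simps)

lemma chain_uniform_daut_subset:
  assumes "is_ngba B" "is_markov_chain (alphabet B) M"
  shows "chain_uniform_daut M (subset_aut B) (alphabet B)"
  using assms is_ngbaD(2,3,4)[OF assms(1)] post_subset_nstates[OF assms(1)]
  by unfold_locales (auto simp: subset_aut_def split: if_splits)

context chain_daut
begin

lemma run_recurrent:
  assumes \<omega>: "\<omega> \<in> maximal_paths M" "\<And>n. \<omega> n = Some (\<pi> n)" "fair \<omega>"
    and x0: "x 0 \<in> dstates X"
    and run: "\<And>n. daut_run (dstep X) (x 0) (\<lambda>j. mlabel M (\<pi> (Suc (k + j)))) n = Some (x n)"
  shows "recurrent_run (\<lambda>n. \<pi> (k + n)) x"
  unfolding recurrent_run_def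
proof (intro conjI allI ballI impI)
  fix n
  show "\<pi> (k + n) \<in> mstates M" "mtrans M (\<pi> (k + n)) (\<pi> (k + Suc n)) > 0"
    using maximal_pathsD(3,4)[OF \<omega>(1)] \<omega>(2) by simp_all
  show "x n \<in> dstates X"
    using x0 daut_run_states[OF _ run, of n] by (cases n) auto
  show "dstep X (x n) (mlabel M (\<pi> (k + Suc n))) = Some (x (Suc n))"
    using run[of "Suc n"] run[of n] by simp
next
  show "\<exists>\<^sub>\<infinity>n. \<pi> (k + n) = m \<and> x n = y \<and> \<pi> (k + Suc n) = m'"
    if "m \<in> mstates M" "y \<in> dstates X" "m' \<in> mstates M" "mtrans M m m' > 0"
      "\<exists>\<^sub>\<infinity>n. \<pi> (k + n) = m \<and> x n = y" for m y m'
    using \<omega>(3)[unfolded fair_def, rule_format, OF x0 that(2,1,3,4), of k] that(5)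
    by (simp add: \<omega>(2) run)
qed

end

lemma accepted_iff:
  assumes B: "is_ngba B" and M: "is_markov_chain (alphabet B) M" and \<omega>: "\<omega> \<in> maximal_paths M"
  shows "(\<exists>\<pi>. (\<forall>i. \<omega> i = Some (\<pi> i)) \<and> (\<lambda>i. mlabel M (\<pi> i)) \<in> language B) \<longleftrightarrow>
    (\<forall>i. \<omega> i \<noteq> None) \<and> (\<lambda>i. mlabel M (the (\<omega> i))) \<in> lang_from B (ninit B)"
proof -
  interpret chain_daut M "det B" "alphabet B" using chain_daut_det[OF B M] .
  have eq: "(\<forall>i. \<omega> i = Some (\<pi> i)) \<longleftrightarrow> (\<forall>i. \<omega> i \<noteq> None) \<and> \<pi> = (\<lambda>i. the (\<omega> i))" for \<pi>
    by auto
  have "mlabel M (the (\<omega> i)) \<in> alphabet B" if "\<forall>i. \<omega> i \<noteq> None" for i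
    using that maximal_pathsD(3)[OF \<omega>, of i] label_in by fastforce
  then show ?thesis unfolding eq language_eq by auto
qed

text \<open>By \<open>lang_from_det_iff\<close>, acceptance is a countable combination of conditions
  on finite prefixes of the path.\<close>

lemma accepted_in_sets:
  fixes M :: "('m, 'a) labelled_chain"
  assumes B: "is_ngba B" and M: "is_markov_chain (alphabet B) M"
  shows "{\<omega> \<in> maximal_paths M. \<exists>\<pi>. (\<forall>i. \<omega> i = Some (\<pi> i)) \<and> (\<lambda>i. mlabel M (\<pi> i)) \<in> language B}
    \<in> sets (path_measure M)"
proof -
  interpret chain_daut M "det B" "alphabet B" using chain_daut_det[OF B M] .
  let ?w = "\<lambda>\<omega> i. mlabel M (the (\<omega> i))"
  let ?run = "\<lambda>\<omega>. daut_run (ght_step B) (initial_ght B) (?w \<omega>)"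
  have run_cong: "?run \<omega> n = ?run \<omega>' n" if "\<And>i. i < n \<Longrightarrow> \<omega> i = \<omega>' i" for \<omega> \<omega>' n
    by (rule daut_run_cong) (use that in simp)
  have [measurable]: "Measurable.pred (path_measure M) (\<lambda>\<omega>. \<omega> i \<noteq> None)" for i
    by (rule local_pred[OF M.finite_states, of "Suc i"]) simp
  have [measurable]: "Measurable.pred (path_measure M) (\<lambda>\<omega>. ?run \<omega> n \<noteq> None)" for n
    by (rule local_pred[OF M.finite_states, of n]) (metis run_cong)
  have [measurable]: "Measurable.pred (path_measure M) (\<lambda>\<omega>. stable_node B (?w \<omega> i) (the (?run \<omega> i)) v)" for i v
  proof (rule local_pred[OF M.finite_states, of "Suc i"])
    fix \<omega> \<omega>' :: "nat \<Rightarrow> 'm option" assume eq: "\<And>j. j < Suc i \<Longrightarrow> \<omega> j = \<omega>' j"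
    then show "stable_node B (?w \<omega> i) (the (?run \<omega> i)) v = stable_node B (?w \<omega>' i) (the (?run \<omega>' i)) v"
      using run_cong[of i \<omega> \<omega>'] by simp
  qed
  have [measurable]: "Measurable.pred (path_measure M) (\<lambda>\<omega>. saturated (ght_split B (?w \<omega> i) (the (?run \<omega> i))) v)" for i v
  proof (rule local_pred[OF M.finite_states, of "Suc i"])
    fix \<omega> \<omega>' :: "nat \<Rightarrow> 'm option" assume eq: "\<And>j. j < Suc i \<Longrightarrow> \<omega> j = \<omega>' j"
    then show "saturated (ght_split B (?w \<omega> i) (the (?run \<omega> i))) v =
        saturated (ght_split B (?w \<omega>' i) (the (?run \<omega>' i))) v"
      using run_cong[of i \<omega> \<omega>'] by simp
  qed
  let ?P = "\<lambda>\<omega>. (\<forall>i. \<omega> i \<noteq> None) \<and> (\<forall>n. ?run \<omega> n \<noteq> None) \<and>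
      (\<exists>v n. (\<forall>i\<ge>n. stable_node B (?w \<omega> i) (the (?run \<omega> i)) v) \<and>
        (\<exists>\<^sub>\<infinity>i. saturated (ght_split B (?w \<omega> i) (the (?run \<omega> i))) v))"
  have "{\<omega> \<in> maximal_paths M. ?P \<omega>} \<in> sets (path_measure M)"
    unfolding INFM_nat by (rule path_event) measurable
  moreover have "(\<exists>\<pi>. (\<forall>i. \<omega> i = Some (\<pi> i)) \<and> (\<lambda>i. mlabel M (\<pi> i)) \<in> language B) \<longleftrightarrow> ?P \<omega>"
    if \<omega>: "\<omega> \<in> maximal_paths M" for \<omega>
  proof -
    have "?w \<omega> i \<in> alphabet B" if "\<forall>i. \<omega> i \<noteq> None" for i
      using that maximal_pathsD(3)[OF \<omega>, of i] label_in by fastforce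
    then show ?thesis
      unfolding accepted_iff[OF B M \<omega>]
      using lang_from_det_iff[OF B is_ght_initial[OF B], of "?w \<omega>"] unfolding rchd_initial by blast
  qed
  ultimately show ?thesis by (simp cong: conj_cong)
qed

section \<open>Accepted paths reach the accepting region\<close>

lemma rabin_acceptingE:
  assumes "rabin_accepting M A D"
  obtains v m x m' x' where "v \<in> rindex A" "(m, x) \<in> D" "(m', x') \<in> D"
    "mtrans (chain_product M A) (m, x) (m', x') > 0" "(x, mlabel M m', x') \<in> racc A v"
    "\<And>m x m' x'. (m, x) \<in> D \<Longrightarrow> (m', x') \<in> D \<Longrightarrow> mtrans (chain_product M A) (m, x) (m', x') > 0 \<Longrightarrow>
       (x, mlabel M m', x') \<notin> rrej A v"
  using assms unfolding rabin_accepting_def Let_def by blast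

lemma rabin_acceptingI:
  assumes "v \<in> rindex A" "(m, x) \<in> D" "(m', x') \<in> D"
    "mtrans (chain_product M A) (m, x) (m', x') > 0" "(x, mlabel M m', x') \<in> racc A v"
    "\<And>m x m' x'. (m, x) \<in> D \<Longrightarrow> (m', x') \<in> D \<Longrightarrow> mtrans (chain_product M A) (m, x) (m', x') > 0 \<Longrightarrow>
       (x, mlabel M m', x') \<notin> rrej A v"
  shows "rabin_accepting M A D"
  using assms unfolding rabin_accepting_def Let_def by blast

context
  fixes M :: "('m, 'a) labelled_chain" and B :: "('q, 'a) ngba"
  assumes B: "is_ngba B" and M: "is_markov_chain (alphabet B) M"
begin

interpretation D: chain_daut M "det B" "alphabet B"
  using chain_daut_det[OF B M] .

interpretation S: chain_uniform_daut M "subset_aut B" "alphabet B"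
  using chain_uniform_daut_subset[OF B M] .

lemma accepted_reaches:
  assumes \<omega>: "\<omega> \<in> maximal_paths M" and fair: "D.fair \<omega>" "S.fair \<omega>"
    and acc: "\<forall>i. \<omega> i \<noteq> None" "(\<lambda>i. mlabel M (the (\<omega> i))) \<in> lang_from B (ninit B)"
  shows "S.lift \<omega> \<in> reach_paths S.prd (accepting_region M B)"
proof -
  define \<pi> where "\<pi> i = the (\<omega> i)" for i
  have \<pi>: "\<omega> i = Some (\<pi> i)" for i using acc(1) by (simp add: \<pi>_def)
  define w where "w i = mlabel M (\<pi> i)" for i
  have w: "w i \<in> alphabet B" for i
    using D.label_in[OF maximal_pathsD(3)[OF \<omega> \<pi>]] by (simp add: w_def)
  let ?run = "daut_run (ght_step B) (initial_ght B) w"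
  have "w \<in> lang_from B (rchd (initial_ght B))"
    using acc(2) by (simp add: rchd_initial w_def[abs_def] \<pi>_def)
  then obtain v N1 where run: "\<And>n. ?run n \<noteq> None"
    and stable: "\<And>i. N1 \<le> i \<Longrightarrow> stable_node B (w i) (the (?run i)) v"
    and sat: "\<exists>\<^sub>\<infinity>i. saturated (ght_split B (w i) (the (?run i))) v"
    using lang_from_det_iff[where w = w, OF B is_ght_initial[OF B] w] by blast
  \<comment> \<open>\<open>d n\<close> is the tree after \<open>n + 1\<close> letters, which is the
    one paired with \<open>\<pi> n\<close> in the product.\<close>
  define d where "d n = the (?run (Suc n))" for n
  have d: "?run (Suc n) = Some (d n)" for n
    unfolding d_def by (rule option.collapse[OF run, symmetric])
  have ght: "is_ght B (d n)" for n
    using D.daut_run_states[OF _ d[unfolded det_simps(1)[symmetric]]] by (simp add: det_simps)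
  have rund: "daut_run (ght_step B) (d 0) (\<lambda>j. w (Suc j)) n = Some (d n)" for n
    using daut_run_add[OF d[of 0], of n] d[of n] by simp
  have runS: "daut_run (dstep (subset_aut B)) (rchd (d 0)) (\<lambda>j. w (Suc j)) n = Some (rchd (d n))" for n
    by (rule subset_run_det[OF B rund])
  have recD: "D.recurrent_run \<pi> d"
    using D.run_recurrent[where k = 0 and x = d, OF \<omega> \<pi> fair(1)] ght rund
    by (simp add: det_simps w_def)
  have "rchd (d 0) \<in> dstates (subset_aut B)"
    using rchd_states[OF ght] by (simp add: subset_aut_def)
  then have recS: "S.recurrent_run \<pi> (\<lambda>n. rchd (d n))"
    using S.run_recurrent[where k = 0 and x = "\<lambda>n. rchd (d n)", OF \<omega> \<pi> fair(2)] runS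
    by (simp add: w_def)
  let ?D = "D.inf_states \<pi> d" and ?S = "S.inf_states \<pi> (\<lambda>n. rchd (d n))"
  have bsccD: "bottom_scc D.prd ?D" by (rule D.bottom_scc_inf_states[OF recD])
  have bsccS: "bottom_scc S.prd ?S" by (rule S.bottom_scc_inf_states[OF recS])
  obtain ND where ND: "\<And>n. ND \<le> n \<Longrightarrow> (\<pi> n, d n) \<in> ?D"
    using D.eventually_inf_states[OF recD] by blast
  obtain NS where NS: "\<And>n. NS \<le> n \<Longrightarrow> (\<pi> n, rchd (d n)) \<in> ?S"
    using S.eventually_inf_states[OF recS] by blast
  have stepd: "ght_step B (d n) (mlabel M (\<pi> (Suc n))) = Some (d (Suc n))" for n
    using D.recurrent_runD(4)[OF recD] by (simp add: det_simps)
  have stable_d: "stable_node B (mlabel M (\<pi> (Suc n))) (d n) v" if "N1 \<le> n" for n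
    using stable[of "Suc n"] that unfolding d_def w_def by simp
  have sat_d: "\<exists>\<^sub>\<infinity>n. saturated (ght_split B (mlabel M (\<pi> (Suc n))) (d n)) v"
    using sat INFM_shift[of "\<lambda>i. saturated (ght_split B (w i) (the (?run i))) v" 1]
    unfolding d_def w_def by simp
  have "rabin_accepting M (det B) ?D"
  proof -
    obtain n where n: "ND \<le> n" "saturated (ght_split B (mlabel M (\<pi> (Suc n))) (d n)) v"
      using sat_d unfolding INFM_nat_le by blast
    show ?thesis
    proof (rule rabin_acceptingI)
      have "v \<in> nodes (d N1)" using stable_d[of N1] by (simp add: stable_node_def)
      then show "v \<in> rindex (det B)" by (rule ght_node_in_rindex[OF B ght])
      show "(\<pi> n, d n) \<in> ?D" "(\<pi> (Suc n), d (Suc n)) \<in> ?D" using ND n(1) by auto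
      show "mtrans D.prd (\<pi> n, d n) (\<pi> (Suc n), d (Suc n)) > 0"
        using D.recurrent_runD(3,4)[OF recD] by (simp add: D.mtrans_prd_pos)
      show "(d n, mlabel M (\<pi> (Suc n)), d (Suc n)) \<in> racc (det B) v"
        using n(2) stepd by (simp add: det_simps)
      \<comment> \<open>A transition between recurring states is itself taken infinitely often,
        hence also after \<open>N1\<close>, where none rejects \<open>v\<close>.\<close>
      fix m x m' x' assume t: "(m, x) \<in> ?D" "(m', x') \<in> ?D" "mtrans D.prd (m, x) (m', x') > 0"
      have "(m', x') \<in> mstates D.prd" using bsccD t(2) by (auto simp: bottom_scc_def)
      then have "\<exists>\<^sub>\<infinity>n. (\<pi> n, d n) = (m, x) \<and> (\<pi> (Suc n), d (Suc n)) = (m', x')"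
        by (rule D.inf_transition[OF recD t(1) _ t(3)])
      then obtain i where "N1 \<le> i" "(\<pi> i, d i) = (m, x)" "(\<pi> (Suc i), d (Suc i)) = (m', x')"
        unfolding INFM_nat_le by blast
      then show "(x, mlabel M m', x') \<notin> rrej (det B) v"
        using stable_d[of i] by (auto simp: det_simps)
    qed
  qed
  \<comment> \<open>If a pair recurs, so does its image under \<open>rchd\<close>; this links the
    two components.\<close>
  moreover have "(\<pi> ND, rchd (d ND)) \<in> ?S"
  proof -
    have "\<exists>\<^sub>\<infinity>n. (\<pi> n, d n) = (\<pi> ND, d ND)" using ND[of ND] by (simp add: D.inf_states_def)
    then have "\<exists>\<^sub>\<infinity>n. (\<pi> n, rchd (d n)) = (\<pi> ND, rchd (d ND))" by (rule INFM_mono) simp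
    then show ?thesis by (simp add: S.inf_states_def)
  qed
  ultimately have "accepting_subset_bscc M B ?S"
    unfolding accepting_subset_bscc_def using bsccD bsccS ND[of ND] by blast
  then have "?S \<subseteq> accepting_region M B" by (auto simp: accepting_region_def)
  moreover have "S.lift \<omega> NS = Some (\<pi> NS, rchd (d NS))"
  proof -
    have "daut_run (dstep (subset_aut B)) (ninit B) w (Suc NS) = Some (rchd (d NS))"
      using subset_run_det[OF B d] by (simp only: rchd_initial)
    moreover have "dinit (subset_aut B) = ninit B" by (simp add: subset_aut_def)
    ultimately show ?thesis
      using \<pi> by (simp add: S.lift_eq_Some w_def[abs_def] del: daut_run.simps)
  qed
  ultimately show ?thesis
    using S.lift_maximal[OF \<omega>] NS[of NS] unfolding reach_paths_def by blast
qed

lemma reaches_accepted: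
  assumes \<omega>: "\<omega> \<in> maximal_paths M" and fair: "D.fair \<omega>" "S.fair \<omega>"
    and reach: "S.lift \<omega> \<in> reach_paths S.prd (accepting_region M B)"
  shows "\<forall>i. \<omega> i \<noteq> None" "(\<lambda>i. mlabel M (the (\<omega> i))) \<in> lang_from B (ninit B)"
proof -
  obtain i0 s T where i0: "S.lift \<omega> i0 = Some s" "s \<in> T" and T: "accepting_subset_bscc M B T"
    using reach unfolding reach_paths_def accepting_region_def by blast
  obtain D m d where bsccT: "bottom_scc S.prd T" and bsccD: "bottom_scc D.prd D"
    and rabin: "rabin_accepting M (det B) D" and md: "(m, d) \<in> D" "(m, rchd d) \<in> T"
    using T unfolding accepting_subset_bscc_def by blast
  let ?run = "daut_run (dstep (subset_aut B)) (ninit B) (\<lambda>j. mlabel M (the (\<omega> j)))"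
  have init: "dinit (subset_aut B) = ninit B" by (simp add: subset_aut_def)
  \<comment> \<open>States of \<open>T\<close> have successors in \<open>M\<close>, so the path
    cannot end there, and whichever successor it takes leads back into \<open>T\<close>.\<close>
  have stay: "\<exists>s\<in>T. S.lift \<omega> i = Some s" if "i0 \<le> i" for i
    using that
  proof (induction rule: dec_induct)
    case base
    then show ?case using i0 by blast
  next
    case (step i)
    then obtain m1 R1 where mR: "(m1, R1) \<in> T" "S.lift \<omega> i = Some (m1, R1)" by auto
    then have \<omega>i: "\<omega> i = Some m1" "?run (Suc i) = Some R1"
      by (simp_all add: S.lift_eq_Some init del: daut_run.simps)
    obtain m' where "m' \<in> mstates M" "mtrans M m1 m' > 0"
      using S.bottom_scc_live[OF bsccT mR(1)] by blast
    then obtain m2 where m2: "\<omega> (Suc i) = Some m2"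
      using maximal_pathsD(5)[OF \<omega> \<omega>i(1)] by (cases "\<omega> (Suc i)") auto
    obtain R2 where R2: "dstep (subset_aut B) R1 (mlabel M m2) = Some R2" "(m2, R2) \<in> T"
      using S.bottom_scc_total[OF bsccT mR(1) maximal_pathsD(3)[OF \<omega> m2] maximal_pathsD(4)[OF \<omega> \<omega>i(1) m2]]
      by blast
    have "?run (Suc (Suc i)) = Some R2"
      using \<omega>i(2) m2 R2(1) by simp
    then have "S.lift \<omega> (Suc i) = Some (m2, R2)"
      using m2 by (simp add: S.lift_eq_Some init del: daut_run.simps)
    then show ?case using R2(2) by blast
  qed
  show alive: "\<forall>i. \<omega> i \<noteq> None"
  proof
    fix i
    obtain s where "S.lift \<omega> (max i i0) = Some s" using stay[of "max i i0"] by auto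
    then have "\<omega> (max i i0) \<noteq> None" by (cases s) (auto simp: S.lift_eq_Some)
    then show "\<omega> i \<noteq> None"
      by (rule contrapos_nn) (rule maximal_path_None_mono[OF \<omega> _ max.cobounded1])
  qed
  define \<pi> where "\<pi> i = the (\<omega> i)" for i
  have \<pi>: "\<omega> i = Some (\<pi> i)" for i using alive by (simp add: \<pi>_def)
  define w where "w i = mlabel M (\<pi> i)" for i
  have run_w: "?run = daut_run (dstep (subset_aut B)) (ninit B) w"
    by (simp add: w_def[abs_def] \<pi>_def)
  define R where "R n = the (?run (Suc (i0 + n)))" for n
  have R: "?run (Suc (i0 + n)) = Some (R n)" "(\<pi> (i0 + n), R n) \<in> T" for n
  proof -
    obtain s where s: "s \<in> T" "S.lift \<omega> (i0 + n) = Some s" using stay[of "i0 + n"] by auto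
    then have "\<omega> (i0 + n) = Some (fst s)" "?run (Suc (i0 + n)) = Some (snd s)"
      by (simp_all add: S.lift_eq_Some' init del: daut_run.simps)
    then show "?run (Suc (i0 + n)) = Some (R n)" "(\<pi> (i0 + n), R n) \<in> T"
      using s(1) \<pi>[of "i0 + n"] by (simp_all add: R_def del: daut_run.simps)
  qed
  have runR: "daut_run (dstep (subset_aut B)) (R 0) (\<lambda>j. mlabel M (\<pi> (Suc (i0 + j)))) n = Some (R n)" for n
    using daut_run_add[OF R(1)[of 0], of n] R(1)[of n] by (simp add: \<pi>_def del: daut_run.simps)
  have R0: "R 0 \<in> dstates (subset_aut B)"
    using S.daut_run_states[OF _ R(1)[of 0]] by simp
  note recS = S.run_recurrent[where k = i0 and x = R, OF \<omega> \<pi> fair(2) R0 runR]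
  let ?S = "S.inf_states (\<lambda>n. \<pi> (i0 + n)) R"
  have "bottom_scc S.prd ?S" by (rule S.bottom_scc_inf_states[OF recS])
  moreover have "?S \<subseteq> T"
  proof
    fix s assume "s \<in> ?S"
    then obtain n where "(\<pi> (i0 + n), R n) = s"
      by (auto simp: S.inf_states_def dest: INFM_EX)
    then show "s \<in> T" using R(2)[of n] by simp
  qed
  \<comment> \<open>What recurs is a bottom SCC inside \<open>T\<close>, hence all of
    \<open>T\<close>. So \<open>(m, rchd d)\<close> is visited, at the time called \<open>k\<close>
    below.\<close>
  ultimately have "?S = T" using S.bottom_scc_subset_eq[OF bsccT] by blast
  then have "\<exists>\<^sub>\<infinity>n. (\<pi> (i0 + n), R n) = (m, rchd d)"
    using md(2) by (auto simp: S.inf_states_def)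
  then obtain n0 where n0: "\<pi> (i0 + n0) = m" "R n0 = rchd d" by (auto dest: INFM_EX)
  define k where "k = i0 + n0"
  define u where "u j = w (Suc (k + j))" for j
  \<comment> \<open>Since \<open>(m, d)\<close> lies in the bottom SCC \<open>D\<close>, the copy
    started in \<open>d\<close> at time \<open>k\<close> follows the rest of the path inside
    \<open>D\<close> without getting stuck.\<close>
  have "\<exists>x. daut_run (ght_step B) d u n = Some x \<and> (\<pi> (k + n), x) \<in> D" for n
  proof (induction n)
    case 0
    then show ?case using md(1) n0(1) by (simp add: k_def)
  next
    case (Suc n)
    then obtain x where x: "daut_run (ght_step B) d u n = Some x" "(\<pi> (k + n), x) \<in> D" by blast
    then obtain x' where "dstep (det B) x (mlabel M (\<pi> (Suc (k + n)))) = Some x'" "(\<pi> (Suc (k + n)), x') \<in> D"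
      using D.bottom_scc_total[OF bsccD x(2)] maximal_pathsD(3,4)[OF \<omega>] \<pi> by blast
    moreover from this have "daut_run (ght_step B) d u (Suc n) = Some x'"
      using x(1) by (simp add: det_simps u_def w_def)
    ultimately show ?case by auto
  qed
  then obtain x where x: "\<And>n. daut_run (ght_step B) d u n = Some (x n)" "\<And>n. (\<pi> (k + n), x n) \<in> D"
    by metis
  have x0: "x 0 = d" using x(1)[of 0] by simp
  have "x 0 \<in> dstates (det B)" using x(2)[of 0] bsccD by (auto simp: bottom_scc_def D.mstates_prd)
  moreover have "daut_run (dstep (det B)) (x 0) (\<lambda>j. mlabel M (\<pi> (Suc (k + j)))) n = Some (x n)" for n
    using x(1)[of n] x0 by (simp add: det_simps u_def[abs_def] w_def)
  ultimately have recD: "D.recurrent_run (\<lambda>n. \<pi> (k + n)) x"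
    using D.run_recurrent[where k = k and x = x, OF \<omega> \<pi> fair(1)] by blast
  let ?D = "D.inf_states (\<lambda>n. \<pi> (k + n)) x"
  have "bottom_scc D.prd ?D" by (rule D.bottom_scc_inf_states[OF recD])
  moreover have "?D \<subseteq> D"
  proof
    fix s assume "s \<in> ?D"
    then obtain n where "(\<pi> (k + n), x n) = s"
      by (auto simp: D.inf_states_def dest: INFM_EX)
    then show "s \<in> D" using x(2)[of n] by simp
  qed
  ultimately have D_eq: "?D = D" using D.bottom_scc_subset_eq[OF bsccD] by blast
  obtain v m1 x1 m2 x2 where v: "(m1, x1) \<in> D" "(m2, x2) \<in> D" "mtrans D.prd (m1, x1) (m2, x2) > 0"
    "(x1, mlabel M m2, x2) \<in> racc (det B) v"
    and not_rej: "\<And>m x m' x'. (m, x) \<in> D \<Longrightarrow> (m', x') \<in> D \<Longrightarrow> mtrans D.prd (m, x) (m', x') > 0 \<Longrightarrow>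
       (x, mlabel M m', x') \<notin> rrej (det B) v"
    by (rule rabin_acceptingE[OF rabin]) blast
  have step: "ght_step B (x n) (u n) = Some (x (Suc n))" for n
    using D.recurrent_runD(4)[OF recD, of n] by (simp add: det_simps u_def w_def)
  have "(m2, x2) \<in> mstates D.prd" using bsccD v(2) by (auto simp: bottom_scc_def)
  then have "\<exists>\<^sub>\<infinity>n. (\<pi> (k + n), x n) = (m1, x1) \<and> (\<pi> (k + Suc n), x (Suc n)) = (m2, x2)"
    by (rule D.inf_transition[OF recD _ _ v(3), unfolded D_eq, OF v(1)])
  then have sat: "\<exists>\<^sub>\<infinity>n. saturated (ght_split B (u n) (x n)) v"
  proof (rule INFM_mono)
    fix n assume "(\<pi> (k + n), x n) = (m1, x1) \<and> (\<pi> (k + Suc n), x (Suc n)) = (m2, x2)"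
    then show "saturated (ght_split B (u n) (x n)) v"
      using v(4) by (auto simp: det_simps u_def w_def)
  qed
  have "stable_node B (u n) (x n) v" for n
  proof -
    have "mtrans D.prd (\<pi> (k + n), x n) (\<pi> (k + Suc n), x (Suc n)) > 0"
      using D.recurrent_runD(3,4)[OF recD, of n] by (simp add: D.mtrans_prd_pos)
    then have "(x n, mlabel M (\<pi> (k + Suc n)), x (Suc n)) \<notin> rrej (det B) v"
      by (rule not_rej[OF x(2) x(2)])
    then show ?thesis using step[of n] by (simp add: det_simps u_def w_def)
  qed
  \<comment> \<open>No transition inside \<open>D\<close> rejects \<open>v\<close>, so stability
    holds from the start of the copy and \<open>n = 0\<close> suffices.\<close>
  then have "u \<in> lang_from B (rchd (x 0))"
    by (intro det_sound[where n = 0 and v = v, OF B step _ sat])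
  then have "(\<lambda>j. w (Suc k + j)) \<in> lang_from B (rchd d)"
    by (simp add: u_def[abs_def] x0)
  \<comment> \<open>At time \<open>k\<close> the subset automaton is in \<open>rchd d\<close>, so a
    finite run of \<open>B\<close> leads from an initial state to the start of the accepting run on
    \<open>u\<close>.\<close>
  moreover have "daut_run (dstep (subset_aut B)) (ninit B) w (Suc k) = Some (rchd d)"
    using R(1)[of n0] n0(2) unfolding run_w k_def by simp
  ultimately have "w \<in> lang_from B (ninit B)" using lang_from_subset_run by blast
  then show "(\<lambda>i. mlabel M (the (\<omega> i))) \<in> lang_from B (ninit B)"
    by (simp add: w_def[abs_def] \<pi>_def)
qed

text \<open>Accepted and reaching paths coincide on paths fair for both automata, hence almost
  surely. Both events are measurable, and \<open>lift\<close> carries the second one to the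
  product.\<close>

lemma prob_ngba_eq_reach:
  "prob_ngba M B = measure (path_measure S.prd) (reach_paths S.prd (accepting_region M B))"
proof -
  let ?acc = "{\<omega> \<in> maximal_paths M. \<exists>\<pi>. (\<forall>i. \<omega> i = Some (\<pi> i)) \<and> (\<lambda>i. mlabel M (\<pi> i)) \<in> language B}"
  let ?reach = "{\<omega> \<in> maximal_paths M. S.lift \<omega> \<in> reach_paths S.prd (accepting_region M B)}"
  have "AE \<omega> in path_measure M. \<omega> \<in> ?acc \<longleftrightarrow> \<omega> \<in> ?reach"
    using D.AE_fair S.AE_fair
  proof eventually_elim
    case (elim \<omega>)
    then show ?case
      using accepted_iff[OF B M, of \<omega>] accepted_reaches[of \<omega>] reaches_accepted[of \<omega>] by blast
  qed
  then have "measure (path_measure M) ?acc = measure (path_measure M) ?reach"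
    using accepted_in_sets[OF B M] S.measure_prd(2)[OF S.reach_paths_in_sets]
    by (intro measure_eq_AE)
  then show ?thesis
    by (simp add: prob_ngba_def S.measure_prd(1)[OF S.reach_paths_in_sets])
qed

end

theorem theorem33:
  fixes M :: "('m, 'a) labelled_chain" and B :: "('q, 'a) ngba"
  assumes "is_ngba B"
    and "is_markov_chain (alphabet B) M"
  shows "prob_ngba M B =
    measure (path_measure (chain_product M (subset_aut B)))
      (reach_paths (chain_product M (subset_aut B)) (accepting_region M B))"
  using assms by (rule prob_ngba_eq_reach)

end
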